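(* Let $\Gamma=(V,E,s,t)$ be a row-finite digraph, $\mathbb F$ a field, $C(\Gamma)$ its Cohn path algebra, $L(\Gamma)$ its Leavitt path algebra, and $I$ the kernel of the quotient homomorphism $C(\Gamma)\to L(\Gamma)$, i.e. the ideal of $C(\Gamma)$ generated by the elements $v-\sum_{se=v}ee^*$ where $v$ ranges over the vertices that are not sinks. Then the exact sequence $$0\rightarrow I\rightarrow C(\Gamma)\rightarrow L(\Gamma)\rightarrow 0$$ is a projective resolution of $L(\Gamma)$ as a left $\mathbb F\Gamma$-module, and it is graded with respect to any grading of $\mathbb F\Gamma$ (by a group) with all elements of $V\sqcup E$ homogeneous.
   Context: A digraph $\Gamma=(V,E,s,t)$ has vertex set $V$, arrow set $E$ and source and target maps $s,t:E\to V$ ($se=s(e)$, $te=t(e)$). It is row-finite if $s^{-1}(v)$ is finite for all $v\in V$; $v$ is a sink if $s^{-1}(v)=\emptyset$. The path algebra $\mathbb F\Gamma$ has as basis all paths (including vertices as paths of length $0$), with product given by concatenation when possible and $0$ otherwise. The Cohn path algebra $C(\Gamma)$ is the (not necessarily unital) $\mathbb F$-algebra generated by $V\sqcup E\sqcup E^*$, $E^*=\{e^*: e\in E\}$, $s(e^* )=te$, $t(e^* )=se$, subject to: (V) $vw=\delta_{v,w}v$ for $v,w\in V$; (E) $s(e)e=e=e\,t(e)$ for $e\in E\sqcup E^*$; (CK1) $e^*f=\delta_{e,f}\,te$ for $e,f\in E$. The Leavitt path algebra $L(\Gamma)$ is the quotient of $C(\Gamma)$ by the further relations (CK2) $v=\sum_{se=v}ee^*$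 for every non-sink $v$. $C(\Gamma)$ and $L(\Gamma)$ are left $\mathbb F\Gamma$-modules via the natural homomorphisms from $\mathbb F\Gamma$. Left $\mathbb F\Gamma$-modules $N$ are unital, i.e. $\mathbb F\Gamma N=N$; projectivity is in the category of such modules. A grading of $\mathbb F\Gamma$ by a group $G$ with $V\sqcup E$ homogeneous (so $|v|=1$ for $v\in V$) induces gradings on $C(\Gamma)$ and $L(\Gamma)$ with $|v|=1$, the same $|e|$, and $|e^*|=|e|^{-1}$. *)

theory Defs
  imports
    "HOL-Library.Poly_Mapping"
    "Graph_Theory.Arc_Walk"
    "HOL-Algebra.QuotRing"
    "HOL-Algebra.Module"
    "HOL-Algebra.Generated_Groups"
begin

section \<open>Not necessarily unital algebras over a field\<close>

text \<open>
  An algebra over the field \<open>'f\<close> is carried by the record \<^type>\<open>module\<close>, whose field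
  \<open>smult\<close> is the action of \<open>'f\<close>. Our algebras need not have a unit; the field \<open>one\<close> is never
  read.
\<close>

text \<open>
  \<open>basis_algebra B c\<close> is the vector space with basis \<open>B\<close>, with product extended bilinearly from
  the partial product \<open>c\<close> on basis elements (product \<open>0\<close> where \<open>c\<close> is undefined).
\<close>

definition lin_mult ::
  "('k \<Rightarrow> 'k \<Rightarrow> 'k option) \<Rightarrow> ('k \<Rightarrow>\<^sub>0 'f::field) \<Rightarrow> ('k \<Rightarrow>\<^sub>0 'f) \<Rightarrow> ('k \<Rightarrow>\<^sub>0 'f)" where
  "lin_mult c a b =
     (\<Sum>p\<in>Poly_Mapping.keys a. \<Sum>q\<in>Poly_Mapping.keys b.
        case c p q of
          None \<Rightarrow> 0
        | Some r \<Rightarrow> Poly_Mapping.single r (Poly_Mapping.lookup a p * Poly_Mapping.lookup b q))"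

definition basis_algebra ::
  "'k set \<Rightarrow> ('k \<Rightarrow> 'k \<Rightarrow> 'k option) \<Rightarrow> ('f::field, 'k \<Rightarrow>\<^sub>0 'f) module" where
  "basis_algebra B c =
     \<lparr>carrier = {a. Poly_Mapping.keys a \<subseteq> B}, mult = lin_mult c, one = undefined,
      zero = 0, add = (+), smult = (\<lambda>k. Poly_Mapping.map ((*) k))\<rparr>"

definition alg_subspace :: "('f::field, 'a) module \<Rightarrow> 'a set \<Rightarrow> bool" where
  "alg_subspace R S \<longleftrightarrow> additive_subgroup S R \<and> (\<forall>k. \<forall>x\<in>S. k \<odot>\<^bsub>R\<^esub> x \<in> S)"

definition alg_ideal :: "('f::field, 'a) module \<Rightarrow> 'a set \<Rightarrow> bool" where
  "alg_ideal R J \<longleftrightarrow> alg_subspace R J \<and>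
     (\<forall>r\<in>carrier R. \<forall>x\<in>J. r \<otimes>\<^bsub>R\<^esub> x \<in> J \<and> x \<otimes>\<^bsub>R\<^esub> r \<in> J)"

definition alg_ideal_gen :: "('f::field, 'a) module \<Rightarrow> 'a set \<Rightarrow> 'a set" where
  "alg_ideal_gen R B = \<Inter>{J. alg_ideal R J \<and> B \<subseteq> J}"

definition quotient_algebra :: "('f::field, 'a) module \<Rightarrow> 'a set \<Rightarrow> ('f, 'a set) module" where
  "quotient_algebra R J =
     \<lparr>carrier = carrier (R Quot J), mult = mult (R Quot J), one = undefined,
      zero = zero (R Quot J), add = add (R Quot J),
      smult = (\<lambda>k X. \<Union>x\<in>X. J +>\<^bsub>R\<^esub> (k \<odot>\<^bsub>R\<^esub> x))\<rparr>"


section \<open>Unital left modules and projectivity\<close>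

text \<open>
  A left module over a possibly non-unital ring \<open>A\<close>; unital means \<open>A M = M\<close>, where \<open>A M\<close> is the
  additive subgroup generated by the products. If \<open>A\<close> is a path algebra over a field, such a module
  carries a unique compatible vector space structure, preserved by all homomorphisms, because \<open>A\<close>
  has local units; so the scalars need not be mentioned.
\<close>

definition unital_left_module ::
  "('a, 'r) ring_scheme \<Rightarrow> ('a, 'm) module \<Rightarrow> bool" where
  "unital_left_module A M \<longleftrightarrow>
     abelian_group M \<and>
     (\<forall>a\<in>carrier A. \<forall>x\<in>carrier M. a \<odot>\<^bsub>M\<^esub> x \<in> carrier M) \<and>
     (\<forall>a\<in>carrier A. \<forall>b\<in>carrier A. \<forall>x\<in>carrier M.
        (a \<oplus>\<^bsub>A\<^esub> b) \<odot>\<^bsub>M\<^esub> x = a \<odot>\<^bsub>M\<^esub> x \<oplus>\<^bsub>M\<^esub> b \<odot>\<^bsub>M\<^esub> x) \<and>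
     (\<forall>a\<in>carrier A. \<forall>x\<in>carrier M. \<forall>y\<in>carrier M.
        a \<odot>\<^bsub>M\<^esub> (x \<oplus>\<^bsub>M\<^esub> y) = a \<odot>\<^bsub>M\<^esub> x \<oplus>\<^bsub>M\<^esub> a \<odot>\<^bsub>M\<^esub> y) \<and>
     (\<forall>a\<in>carrier A. \<forall>b\<in>carrier A. \<forall>x\<in>carrier M.
        (a \<otimes>\<^bsub>A\<^esub> b) \<odot>\<^bsub>M\<^esub> x = a \<odot>\<^bsub>M\<^esub> (b \<odot>\<^bsub>M\<^esub> x)) \<and>
     generate (add_monoid M) {a \<odot>\<^bsub>M\<^esub> x |a x. a \<in> carrier A \<and> x \<in> carrier M} = carrier M"

definition left_module_hom ::
  "('a, 'r) ring_scheme \<Rightarrow> ('a, 'm) module \<Rightarrow> ('a, 'n) module \<Rightarrow> ('m \<Rightarrow> 'n) set" where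
  "left_module_hom A M N =
     {h. h \<in> carrier M \<rightarrow> carrier N \<and>
         (\<forall>x\<in>carrier M. \<forall>y\<in>carrier M. h (x \<oplus>\<^bsub>M\<^esub> y) = h x \<oplus>\<^bsub>N\<^esub> h y) \<and>
         (\<forall>a\<in>carrier A. \<forall>x\<in>carrier M. h (a \<odot>\<^bsub>M\<^esub> x) = a \<odot>\<^bsub>N\<^esub> h x)}"

text \<open>
  Projectivity in the category of unital left \<open>A\<close>-modules: maps from \<open>P\<close> lift through surjections.
  A definition cannot quantify over the element types of the test modules, so these are the type
  arguments \<open>'m\<close> and \<open>'n\<close>; projectivity proper is the statement for all \<open>'m\<close> and \<open>'n\<close>, which is
  what a theorem says that leaves them as free type variables in its conclusion.
\<close>

definition projective_left_module ::
  "('a, 'r) ring_scheme \<Rightarrow> ('a, 'p) module \<Rightarrow> 'm itself \<Rightarrow> 'n itself \<Rightarrow> bool" where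
  "projective_left_module A P _ _ \<longleftrightarrow>
     unital_left_module A P \<and>
     (\<forall>(M :: ('a, 'm) module) (N :: ('a, 'n) module) g f.
        unital_left_module A M \<and> unital_left_module A N \<and>
        g \<in> left_module_hom A M N \<and> g ` carrier M = carrier N \<and>
        f \<in> left_module_hom A P N \<longrightarrow>
        (\<exists>h\<in>left_module_hom A P M. \<forall>x\<in>carrier P. g (h x) = f x))"

definition short_exact ::
  "('a, 'r) ring_scheme \<Rightarrow> ('a, 'k) module \<Rightarrow> ('a, 'm) module \<Rightarrow> ('a, 'n) module \<Rightarrow>
   ('k \<Rightarrow> 'm) \<Rightarrow> ('m \<Rightarrow> 'n) \<Rightarrow> bool" where
  "short_exact A K M N f g \<longleftrightarrow>
     f \<in> left_module_hom A K M \<and> g \<in> left_module_hom A M N \<and>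
     inj_on f (carrier K) \<and> f ` carrier K = a_kernel M N g \<and> g ` carrier M = carrier N"

definition short_projective_resolution ::
  "('a, 'r) ring_scheme \<Rightarrow> ('a, 'k) module \<Rightarrow> ('a, 'p) module \<Rightarrow> ('a, 'q) module \<Rightarrow>
   ('k \<Rightarrow> 'p) \<Rightarrow> ('p \<Rightarrow> 'q) \<Rightarrow> 'm itself \<Rightarrow> 'n itself \<Rightarrow> bool" where
  "short_projective_resolution A P1 P0 N f g tm tn \<longleftrightarrow>
     projective_left_module A P1 tm tn \<and> projective_left_module A P0 tm tn \<and>
     unital_left_module A N \<and> short_exact A P1 P0 N f g"


section \<open>Gradings by a group\<close>

definition direct_sum_decomp ::
  "('m, 'r) ring_scheme \<Rightarrow> 'g set \<Rightarrow> ('g \<Rightarrow> 'm set) \<Rightarrow> bool" where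
  "direct_sum_decomp M S D \<longleftrightarrow>
     (\<forall>g\<in>S. additive_subgroup (D g) M) \<and>
     (\<forall>x\<in>carrier M. \<exists>!f. f \<in> (\<Pi>\<^sub>E g\<in>S. D g) \<and> finite {g\<in>S. f g \<noteq> \<zero>\<^bsub>M\<^esub>} \<and>
        x = (\<Oplus>\<^bsub>M\<^esub>g\<in>{g\<in>S. f g \<noteq> \<zero>\<^bsub>M\<^esub>}. f g))"

definition algebra_grading ::
  "'g monoid \<Rightarrow> ('f::field, 'a) module \<Rightarrow> ('g \<Rightarrow> 'a set) \<Rightarrow> bool" where
  "algebra_grading H R D \<longleftrightarrow>
     direct_sum_decomp R (carrier H) D \<and>
     (\<forall>g\<in>carrier H. alg_subspace R (D g)) \<and>
     (\<forall>g\<in>carrier H. \<forall>h\<in>carrier H. \<forall>x\<in>D g. \<forall>y\<in>D h. x \<otimes>\<^bsub>R\<^esub> y \<in> D (g \<otimes>\<^bsub>H\<^esub> h))"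

definition graded_left_module ::
  "'g monoid \<Rightarrow> ('a, 'r) ring_scheme \<Rightarrow> ('g \<Rightarrow> 'a set) \<Rightarrow>
   ('a, 'm) module \<Rightarrow> ('g \<Rightarrow> 'm set) \<Rightarrow> bool" where
  "graded_left_module H A D M E \<longleftrightarrow>
     unital_left_module A M \<and> direct_sum_decomp M (carrier H) E \<and>
     (\<forall>g\<in>carrier H. \<forall>h\<in>carrier H. \<forall>a\<in>D g. \<forall>x\<in>E h. a \<odot>\<^bsub>M\<^esub> x \<in> E (g \<otimes>\<^bsub>H\<^esub> h))"

definition degree_preserving ::
  "'g monoid \<Rightarrow> ('g \<Rightarrow> 'm set) \<Rightarrow> ('g \<Rightarrow> 'n set) \<Rightarrow> ('m \<Rightarrow> 'n) \<Rightarrow> bool" where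
  "degree_preserving H E E' f \<longleftrightarrow> (\<forall>g\<in>carrier H. f ` E g \<subseteq> E' g)"


section \<open>Path algebras\<close>

text \<open>Arrows run from \<^const>\<open>tail\<close> to \<^const>\<open>head\<close>: \<open>s = tail \<Gamma>\<close> and \<open>t = head \<Gamma>\<close>.\<close>

definition row_finite :: "('v, 'e) pre_digraph \<Rightarrow> bool" where
  "row_finite \<Gamma> \<longleftrightarrow> (\<forall>v\<in>verts \<Gamma>. finite (out_arcs \<Gamma> v))"

definition sink :: "('v, 'e) pre_digraph \<Rightarrow> 'v \<Rightarrow> bool" where
  "sink \<Gamma> v \<longleftrightarrow> out_arcs \<Gamma> v = {}"

text \<open>
  A path is a pair of its source vertex and its list of arrows; \<open>(v, [])\<close> is the vertex \<open>v\<close>.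
\<close>

type_synonym ('v, 'e, 'f) path_elt = "('v \<times> 'e list) \<Rightarrow>\<^sub>0 'f"

definition paths :: "('v, 'e) pre_digraph \<Rightarrow> ('v \<times> 'e list) set" where
  "paths \<Gamma> = {(u, p). \<exists>w. pre_digraph.awalk \<Gamma> u p w}"

definition path_comp ::
  "('v, 'e) pre_digraph \<Rightarrow> 'v \<times> 'e list \<Rightarrow> 'v \<times> 'e list \<Rightarrow> ('v \<times> 'e list) option" where
  "path_comp \<Gamma> = (\<lambda>(u, p) (v, q).
     if last (pre_digraph.awalk_verts \<Gamma> u p) = v then Some (u, p @ q) else None)"

definition path_algebra ::
  "('v, 'e) pre_digraph \<Rightarrow> ('f::field, ('v, 'e, 'f) path_elt) module" where
  "path_algebra \<Gamma> = basis_algebra (paths \<Gamma>) (path_comp \<Gamma>)"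

definition path_vertex :: "'v \<Rightarrow> ('v, 'e, 'f::field) path_elt" where
  "path_vertex v = Poly_Mapping.single (v, []) 1"

definition path_arrow :: "('v, 'e) pre_digraph \<Rightarrow> 'e \<Rightarrow> ('v, 'e, 'f::field) path_elt" where
  "path_arrow \<Gamma> e = Poly_Mapping.single (tail \<Gamma> e, [e]) 1"


section \<open>Cohn and Leavitt path algebras\<close>

datatype ('v, 'e) gen = Vtx 'v | Arr 'e | Gst 'e  \<comment> \<open>\<open>Gst e\<close> is the ghost arrow \<open>e\<^sup>*\<close>\<close>

primrec gen_source :: "('v, 'e) pre_digraph \<Rightarrow> ('v, 'e) gen \<Rightarrow> 'v" where
  "gen_source \<Gamma> (Vtx v) = v"
| "gen_source \<Gamma> (Arr e) = tail \<Gamma> e"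
| "gen_source \<Gamma> (Gst e) = head \<Gamma> e"

primrec gen_target :: "('v, 'e) pre_digraph \<Rightarrow> ('v, 'e) gen \<Rightarrow> 'v" where
  "gen_target \<Gamma> (Vtx v) = v"
| "gen_target \<Gamma> (Arr e) = head \<Gamma> e"
| "gen_target \<Gamma> (Gst e) = tail \<Gamma> e"

definition gens :: "('v, 'e) pre_digraph \<Rightarrow> ('v, 'e) gen set" where
  "gens \<Gamma> = Vtx ` verts \<Gamma> \<union> Arr ` arcs \<Gamma> \<union> Gst ` arcs \<Gamma>"

type_synonym ('v, 'e, 'f) free_elt = "('v, 'e) gen list \<Rightarrow>\<^sub>0 'f"
type_synonym ('v, 'e, 'f) cohn_elt = "('v, 'e, 'f) free_elt set"
type_synonym ('v, 'e, 'f) leavitt_elt = "('v, 'e, 'f) cohn_elt set"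

text \<open>Only nonempty words are basis elements: the free algebra is not unital.\<close>

definition free_algebra ::
  "('v, 'e) pre_digraph \<Rightarrow> ('f::field, ('v, 'e, 'f) free_elt) module" where
  "free_algebra \<Gamma> =
     basis_algebra {w. w \<noteq> [] \<and> set w \<subseteq> gens \<Gamma>} (\<lambda>w w'. Some (w @ w'))"

abbreviation word :: "('v, 'e) gen list \<Rightarrow> ('v, 'e, 'f::field) free_elt" where
  "word w \<equiv> Poly_Mapping.single w 1"

definition cohn_relators :: "('v, 'e) pre_digraph \<Rightarrow> ('v, 'e, 'f::field) free_elt set" where
  "cohn_relators \<Gamma> =
     {word [Vtx v, Vtx w] - (if v = w then word [Vtx v] else 0) |v w.
        v \<in> verts \<Gamma> \<and> w \<in> verts \<Gamma>} \<union>
     {word [Vtx (gen_source \<Gamma> x), x] - word [x] |x. x \<in> Arr ` arcs \<Gamma> \<union> Gst ` arcs \<Gamma>} \<union>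
     {word [x, Vtx (gen_target \<Gamma> x)] - word [x] |x. x \<in> Arr ` arcs \<Gamma> \<union> Gst ` arcs \<Gamma>} \<union>
     {word [Gst e, Arr f] - (if e = f then word [Vtx (head \<Gamma> e)] else 0) |e f.
        e \<in> arcs \<Gamma> \<and> f \<in> arcs \<Gamma>}"

definition cohn_ideal :: "('v, 'e) pre_digraph \<Rightarrow> ('v, 'e, 'f::field) free_elt set" where
  "cohn_ideal \<Gamma> = alg_ideal_gen (free_algebra \<Gamma>) (cohn_relators \<Gamma>)"

definition cohn_algebra ::
  "('v, 'e) pre_digraph \<Rightarrow> ('f::field, ('v, 'e, 'f) cohn_elt) module" where
  "cohn_algebra \<Gamma> = quotient_algebra (free_algebra \<Gamma>) (cohn_ideal \<Gamma>)"

definition cohn_class ::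
  "('v, 'e) pre_digraph \<Rightarrow> ('v, 'e, 'f::field) free_elt \<Rightarrow> ('v, 'e, 'f) cohn_elt" where
  "cohn_class \<Gamma> a = cohn_ideal \<Gamma> +>\<^bsub>free_algebra \<Gamma>\<^esub> a"

abbreviation cohn_gen ::
  "('v, 'e) pre_digraph \<Rightarrow> ('v, 'e) gen \<Rightarrow> ('v, 'e, 'f::field) cohn_elt" where
  "cohn_gen \<Gamma> x \<equiv> cohn_class \<Gamma> (word [x])"

definition ck2_elements :: "('v, 'e) pre_digraph \<Rightarrow> ('v, 'e, 'f::field) cohn_elt set" where
  "ck2_elements \<Gamma> =
     {cohn_gen \<Gamma> (Vtx v) \<ominus>\<^bsub>cohn_algebra \<Gamma>\<^esub>
        (\<Oplus>\<^bsub>cohn_algebra \<Gamma>\<^esub>e\<in>out_arcs \<Gamma> v.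
           cohn_gen \<Gamma> (Arr e) \<otimes>\<^bsub>cohn_algebra \<Gamma>\<^esub> cohn_gen \<Gamma> (Gst e)) |v.
      v \<in> verts \<Gamma> \<and> \<not> sink \<Gamma> v}"

definition ck2_ideal :: "('v, 'e) pre_digraph \<Rightarrow> ('v, 'e, 'f::field) cohn_elt set" where
  "ck2_ideal \<Gamma> = alg_ideal_gen (cohn_algebra \<Gamma>) (ck2_elements \<Gamma>)"

definition leavitt_algebra ::
  "('v, 'e) pre_digraph \<Rightarrow> ('f::field, ('v, 'e, 'f) leavitt_elt) module" where
  "leavitt_algebra \<Gamma> = quotient_algebra (cohn_algebra \<Gamma>) (ck2_ideal \<Gamma>)"

definition cohn_to_leavitt ::
  "('v, 'e) pre_digraph \<Rightarrow> ('v, 'e, 'f::field) cohn_elt \<Rightarrow> ('v, 'e, 'f) leavitt_elt" where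
  "cohn_to_leavitt \<Gamma> c = ck2_ideal \<Gamma> +>\<^bsub>cohn_algebra \<Gamma>\<^esub> c"

definition leavitt_kernel :: "('v, 'e) pre_digraph \<Rightarrow> ('v, 'e, 'f::field) cohn_elt set" where
  "leavitt_kernel \<Gamma> =
     a_kernel (cohn_algebra \<Gamma>) (leavitt_algebra \<Gamma>) (cohn_to_leavitt \<Gamma>)"


section \<open>The modules over the path algebra\<close>

fun path_word :: "'v \<times> 'e list \<Rightarrow> ('v, 'e) gen list" where
  "path_word (u, p) = (if p = [] then [Vtx u] else map Arr p)"

definition path_to_cohn ::
  "('v, 'e) pre_digraph \<Rightarrow> ('v, 'e, 'f::field) path_elt \<Rightarrow> ('v, 'e, 'f) cohn_elt" where
  "path_to_cohn \<Gamma> a = cohn_class \<Gamma>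
     (\<Sum>p\<in>Poly_Mapping.keys a. Poly_Mapping.single (path_word p) (Poly_Mapping.lookup a p))"

definition restrict_scalars :: "('a \<Rightarrow> 'b) \<Rightarrow> ('f, 'b) module \<Rightarrow> ('a, 'b) module" where
  "restrict_scalars \<phi> R =
     \<lparr>carrier = carrier R, mult = mult R, one = one R, zero = zero R, add = add R,
      smult = (\<lambda>a x. \<phi> a \<otimes>\<^bsub>R\<^esub> x)\<rparr>"

definition cohn_module ::
  "('v, 'e) pre_digraph \<Rightarrow> (('v, 'e, 'f::field) path_elt, ('v, 'e, 'f) cohn_elt) module" where
  "cohn_module \<Gamma> = restrict_scalars (path_to_cohn \<Gamma>) (cohn_algebra \<Gamma>)"

definition leavitt_module ::
  "('v, 'e) pre_digraph \<Rightarrow> (('v, 'e, 'f::field) path_elt, ('v, 'e, 'f) leavitt_elt) module" where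
  "leavitt_module \<Gamma> =
     restrict_scalars (cohn_to_leavitt \<Gamma> \<circ> path_to_cohn \<Gamma>) (leavitt_algebra \<Gamma>)"

definition kernel_module ::
  "('v, 'e) pre_digraph \<Rightarrow> (('v, 'e, 'f::field) path_elt, ('v, 'e, 'f) cohn_elt) module" where
  "kernel_module \<Gamma> = (cohn_module \<Gamma>)\<lparr>carrier := leavitt_kernel \<Gamma>\<rparr>"


section \<open>Induced gradings\<close>

definition generators_homogeneous ::
  "'g monoid \<Rightarrow> ('v, 'e) pre_digraph \<Rightarrow> ('g \<Rightarrow> ('v, 'e, 'f::field) path_elt set) \<Rightarrow> bool" where
  "generators_homogeneous H \<Gamma> D \<longleftrightarrow>
     (\<forall>v\<in>verts \<Gamma>. \<exists>g\<in>carrier H. path_vertex v \<in> D g) \<and>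
     (\<forall>e\<in>arcs \<Gamma>. \<exists>g\<in>carrier H. path_arrow \<Gamma> e \<in> D g)"

text \<open>
  In a grading with homogeneous generators the degree of an arrow is unique, since the arrow is a
  nonzero element of the path algebra.
\<close>

definition arrow_degree ::
  "'g monoid \<Rightarrow> ('v, 'e) pre_digraph \<Rightarrow> ('g \<Rightarrow> ('v, 'e, 'f::field) path_elt set) \<Rightarrow> 'e \<Rightarrow> 'g" where
  "arrow_degree H \<Gamma> D e = (THE g. g \<in> carrier H \<and> path_arrow \<Gamma> e \<in> D g)"

primrec gen_degree :: "'g monoid \<Rightarrow> ('e \<Rightarrow> 'g) \<Rightarrow> ('v, 'e) gen \<Rightarrow> 'g" where
  "gen_degree H d (Vtx v) = \<one>\<^bsub>H\<^esub>"
| "gen_degree H d (Arr e) = d e"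
| "gen_degree H d (Gst e) = inv\<^bsub>H\<^esub> (d e)"

definition word_degree :: "'g monoid \<Rightarrow> ('e \<Rightarrow> 'g) \<Rightarrow> ('v, 'e) gen list \<Rightarrow> 'g" where
  "word_degree H d w = foldr (\<lambda>x g. gen_degree H d x \<otimes>\<^bsub>H\<^esub> g) w \<one>\<^bsub>H\<^esub>"

text \<open>
  The component of degree \<open>g\<close> of the Cohn algebra is spanned by the classes of the words of
  degree \<open>g\<close>.
\<close>

definition cohn_grading ::
  "'g monoid \<Rightarrow> ('v, 'e) pre_digraph \<Rightarrow> ('g \<Rightarrow> ('v, 'e, 'f::field) path_elt set) \<Rightarrow>
   'g \<Rightarrow> ('v, 'e, 'f) cohn_elt set" where
  "cohn_grading H \<Gamma> D g =
     cohn_class \<Gamma> `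
       {a \<in> carrier (free_algebra \<Gamma>).
          \<forall>w\<in>Poly_Mapping.keys a. word_degree H (arrow_degree H \<Gamma> D) w = g}"

definition leavitt_grading ::
  "'g monoid \<Rightarrow> ('v, 'e) pre_digraph \<Rightarrow> ('g \<Rightarrow> ('v, 'e, 'f::field) path_elt set) \<Rightarrow>
   'g \<Rightarrow> ('v, 'e, 'f) leavitt_elt set" where
  "leavitt_grading H \<Gamma> D g = cohn_to_leavitt \<Gamma> ` cohn_grading H \<Gamma> D g"

definition kernel_grading ::
  "'g monoid \<Rightarrow> ('v, 'e) pre_digraph \<Rightarrow> ('g \<Rightarrow> ('v, 'e, 'f::field) path_elt set) \<Rightarrow>
   'g \<Rightarrow> ('v, 'e, 'f) cohn_elt set" where
  "kernel_grading H \<Gamma> D g = leavitt_kernel \<Gamma> \<inter> cohn_grading H \<Gamma> D g"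

end

(*
  Every word in the generators of C(Gamma) reduces to a monomial a b^* (a and b paths with a common
  target) or to 0, and this reduction is compatible with the relations. So an additive map on
  C(Gamma) may be prescribed freely on the monomials, and C(Gamma) is the direct sum, over the
  paths b, of the modules generated by b^*, each isomorphic to F Gamma v with v the target of b.

  Put q_v = v - sum e e^*. Since e^* q_v = 0 = q_v f, the kernel I is spanned by the elements
  a q_v b^*. Choose an arrow e_v out of every non-sink v. An additive map on C(Gamma) that vanishes
  on the monomials which do not end in a common chosen arrow can be given arbitrary values on the
  a q_v b^*, by recursion on the length of the common end, because
  (a e_v)(b e_v)^* = a b^* - a q_v b^* - (sum of the (a e)(b e)^* with e not e_v). Hence I is the
  direct sum of the modules generated by the q_v b^*.

  In a grading with homogeneous vertices and arrows the paths are homogeneous, so the grading is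
  the one by the degrees of paths. The relators and the q_v are homogeneous for the degrees of
  words, and an ideal generated by homogeneous elements is spanned by homogeneous elements.
*)

theory Submission
  imports Defs
begin

section \<open>Additive spans and direct sums\<close>

text \<open>Uniqueness of reduced forms is obtained without a confluence argument. The generators
  act on an abstract set of monomials in such a way that the defining relations hold as identities
  of maps, so the monomial which a word reaches from the empty word yields well-defined values on
  the Cohn algebra. That each word equals its monomial is a separate computation inside the algebra.

  The test modules for projectivity carry no action of the field. Maps are therefore only additive,
  with values prescribed on all multiples \<open>k p\<close> of basis elements \<open>p\<close>. The
  algebras need not have a unit either, so freeness takes the following form: each generator
  \<open>b\<close> comes with a vertex \<open>e\<close> such that \<open>e b = b\<close>, and its
  image may be any \<open>m\<close> with \<open>e m = m\<close>.

  The kernel is known only as an ideal, which gives no direct way to define maps on it. Its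
  homomorphisms are built as additive maps on the whole Cohn algebra, where values on monomials are
  free; compatibility with the path algebra is claimed only after restriction.\<close>

abbreviation "single \<equiv> Poly_Mapping.single"
abbreviation "keys \<equiv> Poly_Mapping.keys"
abbreviation "lookup \<equiv> Poly_Mapping.lookup"

abbreviation additive_span :: "('a, 'r) ring_scheme \<Rightarrow> 'a set \<Rightarrow> 'a set" where
  "additive_span M S \<equiv> generate (add_monoid M) S"

section \<open>Additive subgroups, their spans and additive maps\<close>

lemma (in abelian_group) additive_subgroup_criterion:
  assumes "K \<subseteq> carrier G" "\<zero> \<in> K" "\<And>a b. a \<in> K \<Longrightarrow> b \<in> K \<Longrightarrow> a \<oplus> b \<in> K" "\<And>a. a \<in> K \<Longrightarrow> \<ominus> a \<in> K"
  shows "additive_subgroup K G"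
  using assms by (intro additive_subgroup.intro subgroup.intro) (auto simp: a_inv_def)

lemma (in abelian_group) additive_subgroup_span:
  assumes "S \<subseteq> carrier G"
  shows "additive_subgroup (additive_span G S) G"
  using add.generate_is_subgroup[of S] assms by (auto intro: additive_subgroup.intro)

lemma (in abelian_group) additive_span_minimal:
  assumes "additive_subgroup K G" "S \<subseteq> K"
  shows "additive_span G S \<subseteq> K"
  using add.generate_subgroup_incl[OF assms(2)] assms(1) by (simp add: additive_subgroup_def)

lemma abelian_group_hom_intro:
  assumes "abelian_group M" "abelian_group N" "f \<in> carrier M \<rightarrow> carrier N"
    and "\<And>x y. x \<in> carrier M \<Longrightarrow> y \<in> carrier M \<Longrightarrow> f (x \<oplus>\<^bsub>M\<^esub> y) = f x \<oplus>\<^bsub>N\<^esub> f y"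
  shows "abelian_group_hom M N f"
  using assms
  by (intro abelian_group_homI)
    (auto simp: group_hom_def group_hom_axioms_def hom_def intro: abelian_group.a_group)

lemma (in abelian_group_hom) additive_subgroup_vimage:
  assumes "additive_subgroup K H"
  shows "additive_subgroup {x \<in> carrier G. h x \<in> K} G"
proof -
  interpret K: additive_subgroup K H by fact
  show ?thesis
    by (rule G.additive_subgroup_criterion) auto
qed

lemma (in abelian_group_hom) additive_subgroup_image:
  assumes "additive_subgroup K G"
  shows "additive_subgroup (h ` K) H"
proof -
  interpret K: additive_subgroup K G by fact
  show ?thesis
  proof (rule H.additive_subgroup_criterion)
    show "\<zero>\<^bsub>H\<^esub> \<in> h ` K" using K.zero_closed by (metis image_eqI hom_zero)
    show "a \<oplus>\<^bsub>H\<^esub> b \<in> h ` K" if "a \<in> h ` K" "b \<in> h ` K" for a b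
      using that K.a_subset by (force simp flip: hom_add)
    show "\<ominus>\<^bsub>H\<^esub> a \<in> h ` K" if "a \<in> h ` K" for a
      using that K.a_subset K.a_inv_closed by (force simp flip: hom_a_inv)
  qed (use K.a_subset in auto)
qed

text \<open>The preimage of \<open>K\<close> is an additive subgroup containing \<open>S\<close>.
  This is the induction principle for spans used throughout: membership in a subgroup after an
  additive map is checked on generators only.\<close>

lemma (in abelian_group_hom) additive_span_hom:
  assumes "S \<subseteq> carrier G" "additive_subgroup K H" "\<And>x. x \<in> S \<Longrightarrow> h x \<in> K" "x \<in> additive_span G S"
  shows "h x \<in> K"
proof -
  have "additive_span G S \<subseteq> {x \<in> carrier G. h x \<in> K}"
    using assms by (intro G.additive_span_minimal additive_subgroup_vimage) auto
  with assms(4) show ?thesis by auto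
qed

text \<open>The equaliser of two additive maps is a subgroup, so agreement spreads from
  \<open>S\<close> to its span.\<close>

lemma additive_span_hom_eq:
  assumes "abelian_group_hom M N f" "abelian_group_hom M N g" "S \<subseteq> carrier M"
    and "\<And>x. x \<in> S \<Longrightarrow> f x = g x" "x \<in> additive_span M S"
  shows "f x = g x"
proof -
  interpret f: abelian_group_hom M N f by fact
  interpret g: abelian_group_hom M N g by fact
  have "additive_subgroup {x \<in> carrier M. f x = g x} M"
    by (rule f.G.additive_subgroup_criterion) auto
  then have "additive_span M S \<subseteq> {x \<in> carrier M. f x = g x}"
    using assms(3,4) by (intro f.G.additive_span_minimal) auto
  with assms(5) show ?thesis by auto
qed

lemma (in abelian_group_hom) hom_finsum:
  assumes "f \<in> A \<rightarrow> carrier G"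
  shows "h (finsum G f A) = finsum H (\<lambda>i. h (f i)) A"
  using assms
proof (induction A rule: infinite_finite_induct)
  case (insert a A)
  then show ?case
    by (subst G.finsum_insert; (subst H.finsum_insert)?) (auto simp: Pi_iff)
qed auto

lemma (in abelian_group) abelian_group_hom_id: "abelian_group_hom G G (\<lambda>x. x)"
  by (rule abelian_group_hom_intro) (auto simp: abelian_group_axioms)

lemma abelian_group_hom_compose:
  assumes "abelian_group_hom M N f" "abelian_group_hom N P g"
  shows "abelian_group_hom M P (\<lambda>x. g (f x))"
proof -
  interpret f: abelian_group_hom M N f by fact
  interpret g: abelian_group_hom N P g by fact
  show ?thesis
    by (rule abelian_group_hom_intro) (auto simp: hom_def f.G.abelian_group_axioms g.H.abelian_group_axioms)
qed

section \<open>Direct sums of additive subgroups and their projections\<close>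

definition decomposes ::
  "('m, 'r) ring_scheme \<Rightarrow> 'g set \<Rightarrow> ('g \<Rightarrow> 'm set) \<Rightarrow> ('g \<Rightarrow> 'm) \<Rightarrow> 'm \<Rightarrow> bool" where
  "decomposes M S D f x \<longleftrightarrow> f \<in> (\<Pi>\<^sub>E g\<in>S. D g) \<and> finite {g\<in>S. f g \<noteq> \<zero>\<^bsub>M\<^esub>} \<and>
     x = (\<Oplus>\<^bsub>M\<^esub>g\<in>{g\<in>S. f g \<noteq> \<zero>\<^bsub>M\<^esub>}. f g)"

text \<open>A certificate of directness. Only the values of the projections on the summands are
  specified; once the summands span, the image of \<open>\<pi> g\<close> lies in \<open>D g\<close>
  automatically.\<close>

definition component_maps ::
  "('m, 'r) ring_scheme \<Rightarrow> 'g set \<Rightarrow> ('g \<Rightarrow> 'm set) \<Rightarrow> ('g \<Rightarrow> 'm \<Rightarrow> 'm) \<Rightarrow> bool" where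
  "component_maps M S D \<pi> \<longleftrightarrow>
     (\<forall>g\<in>S. abelian_group_hom M M (\<pi> g) \<and> (\<forall>y\<in>D g. \<pi> g y = y) \<and>
        (\<forall>h\<in>S. h \<noteq> g \<longrightarrow> (\<forall>y\<in>D h. \<pi> g y = \<zero>\<^bsub>M\<^esub>)))"

locale subgroup_family = abelian_group M for M (structure) +
  fixes S :: "'g set" and D :: "'g \<Rightarrow> 'a set"
  assumes additive_subgroups: "g \<in> S \<Longrightarrow> additive_subgroup (D g) M"
begin

lemma family_closed: "g \<in> S \<Longrightarrow> x \<in> D g \<Longrightarrow> x \<in> carrier M"
  using additive_subgroups additive_subgroup.a_Hcarr by metis

lemma family_zero: "g \<in> S \<Longrightarrow> \<zero> \<in> D g"
  using additive_subgroups additive_subgroup.zero_closed by metis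

lemma Union_carrier: "(\<Union>g\<in>S. D g) \<subseteq> carrier M"
  using family_closed by auto

text \<open>The sum may be taken over any finite index set containing the support, which allows two
  decompositions to be added over a common set.\<close>

lemma decomposes_finsum:
  assumes "decomposes M S D f x" "finite F" "{g\<in>S. f g \<noteq> \<zero>} \<subseteq> F" "F \<subseteq> S"
  shows "x = finsum M f F"
proof -
  have "finsum M f {g\<in>S. f g \<noteq> \<zero>} = finsum M f F"
    using assms family_closed
    by (intro add.finprod_mono_neutral_cong_left) (auto simp: decomposes_def PiE_iff)
  with assms(1) show ?thesis by (simp add: decomposes_def)
qed

lemma decomposes_closed: "decomposes M S D f x \<Longrightarrow> x \<in> carrier M"
  using family_closed by (auto simp: decomposes_def PiE_iff intro!: finsum_closed)

lemma decomposesI: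
  assumes "f \<in> (\<Pi>\<^sub>E g\<in>S. D g)" "finite F" "{g\<in>S. f g \<noteq> \<zero>} \<subseteq> F" "F \<subseteq> S" "x = finsum M f F"
  shows "decomposes M S D f x"
proof -
  have "finsum M f {g\<in>S. f g \<noteq> \<zero>} = finsum M f F"
    using assms family_closed
    by (intro add.finprod_mono_neutral_cong_left) (auto simp: PiE_iff)
  with assms show ?thesis by (auto simp: decomposes_def intro: finite_subset)
qed

lemma decomposes_add:
  assumes "decomposes M S D f x" "decomposes M S D f' x'"
  shows "decomposes M S D (\<lambda>g\<in>S. f g \<oplus> f' g) (x \<oplus> x')"
proof -
  let ?F = "{g\<in>S. f g \<noteq> \<zero>} \<union> {g\<in>S. f' g \<noteq> \<zero>}"
  have fin: "finite ?F" using assms by (auto simp: decomposes_def)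
  have x: "x = finsum M f ?F" "x' = finsum M f' ?F"
    using assms fin by (auto intro!: decomposes_finsum)
  have D: "f g \<in> D g" "f' g \<in> D g" if "g \<in> S" for g
    using assms that by (auto simp: decomposes_def PiE_iff)
  have "x \<oplus> x' = finsum M (\<lambda>g. f g \<oplus> f' g) ?F"
    unfolding x using D family_closed by (subst finsum_addf) auto
  also have "\<dots> = finsum M (\<lambda>g\<in>S. f g \<oplus> f' g) ?F"
    using D family_closed by (intro finsum_cong') auto
  finally show ?thesis
    using D fin family_closed additive_subgroup.a_closed[OF additive_subgroups]
    by (intro decomposesI[where F="?F"]) (auto split: if_splits)
qed

lemma decomposes_single:
  assumes "g \<in> S" "y \<in> D g"
  shows "decomposes M S D (\<lambda>h\<in>S. if h = g then y else \<zero>) y"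
proof (rule decomposesI[where F="{g}"])
  show "y = (\<Oplus>h\<in>{g}. (\<lambda>h\<in>S. if h = g then y else \<zero>) h)"
    using assms family_closed by (simp add: finsum_insert[OF finite.emptyI])
qed (use assms family_zero in \<open>auto split: if_splits\<close>)

lemma decomposes_zero: "decomposes M S D (\<lambda>g\<in>S. \<zero>) \<zero>"
  by (rule decomposesI[where F="{}"]) (auto simp: family_zero)

text \<open>Applied to the finite sum, \<open>\<pi> g\<close> leaves only the summand of index
  \<open>g\<close>; so the components are determined by the element.\<close>

lemma decomposes_component:
  assumes "component_maps M S D \<pi>" "decomposes M S D f x" "g \<in> S"
  shows "\<pi> g x = f g"
proof -
  interpret p: abelian_group_hom M M "\<pi> g"
    using assms by (auto simp: component_maps_def)
  \<comment> \<open>Inserting \<open>g\<close> makes a separate treatment of a vanishing component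
    unnecessary.\<close>
  let ?F = "insert g {g\<in>S. f g \<noteq> \<zero>}"
  have fin: "finite ?F" using assms by (auto simp: decomposes_def)
  have D: "f h \<in> D h" if "h \<in> S" for h
    using assms that by (auto simp: decomposes_def PiE_iff)
  have "x = finsum M f ?F"
    using assms fin by (auto intro!: decomposes_finsum)
  then have "\<pi> g x = finsum M (\<lambda>h. \<pi> g (f h)) ?F"
    using D family_closed assms(3) by (simp only:) (subst p.hom_finsum, auto)
  also have "\<dots> = finsum M (\<lambda>h. if g = h then f h else \<zero>) ?F"
    using D family_closed assms by (intro finsum_cong') (auto simp: component_maps_def)
  also have "\<dots> = f g"
    using D family_closed assms(3) fin by (intro finsum_singleton) auto
  finally show ?thesis .
qed

lemma decomposes_exists:
  assumes "x \<in> additive_span M (\<Union>g\<in>S. D g)"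
  shows "\<exists>f. decomposes M S D f x"
  using assms
proof (induction rule: generate.induct)
  case one
  then show ?case using decomposes_zero by auto
next
  case (incl h)
  then show ?case using decomposes_single by blast
next
  case (inv h)
  then obtain g where g: "g \<in> S" "h \<in> D g" by auto
  then have "\<ominus> h \<in> D g"
    using additive_subgroup.a_inv_closed[OF additive_subgroups g(2)] by blast
  with g show ?case using decomposes_single unfolding a_inv_def by blast
next
  case (eng h1 h2)
  then show ?case using decomposes_add by (simp) blast
qed

text \<open>Existence of a decomposition comes from spanning, uniqueness from the
  projections.\<close>

lemma direct_sum_decompI:
  assumes "carrier M \<subseteq> additive_span M (\<Union>g\<in>S. D g)" "component_maps M S D \<pi>"
  shows "direct_sum_decomp M S D"
proof -
  have "\<exists>!f. decomposes M S D f x" if "x \<in> carrier M" for x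
  proof (rule ex_ex1I)
    show "\<exists>f. decomposes M S D f x" using assms(1) that decomposes_exists by auto
  next
    fix f f' assume *: "decomposes M S D f x" "decomposes M S D f' x"
    then have "f g = f' g" if "g \<in> S" for g
      using decomposes_component[OF assms(2)] that by metis
    with * show "f = f'" by (auto simp: decomposes_def intro: PiE_ext)
  qed
  then show ?thesis
    unfolding direct_sum_decomp_def decomposes_def using additive_subgroups by auto
qed

end

lemma direct_sum_decomp_family:
  "abelian_group M \<Longrightarrow> direct_sum_decomp M S D \<Longrightarrow> subgroup_family M S D"
  by (auto simp: direct_sum_decomp_def subgroup_family_def subgroup_family_axioms_def)

text \<open>Uniqueness makes the component of index \<open>g\<close> a function of the element, and
  the sum of two decompositions, being the decomposition of the sum, shows that this function is
  additive.\<close>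

lemma direct_sum_decomp_component_maps:
  fixes M (structure)
  assumes "abelian_group M" "direct_sum_decomp M S D"
  shows "\<exists>\<pi>. component_maps M S D \<pi>"
proof -
  interpret subgroup_family M S D using assms by (rule direct_sum_decomp_family)
  have ex1: "\<exists>!f. decomposes M S D f x" if "x \<in> carrier M" for x
    using assms(2) that by (auto simp: direct_sum_decomp_def decomposes_def)
  define c where "c = (\<lambda>x. THE f. decomposes M S D f x)"
  have c: "decomposes M S D (c x) x" if "x \<in> carrier M" for x
    unfolding c_def using theI'[OF ex1[OF that]] .
  have c_eq: "c x = f" if "decomposes M S D f x" for f x
    using ex1[OF decomposes_closed[OF that]] c[OF decomposes_closed[OF that]] that by blast
  have D: "c x g \<in> D g" if "x \<in> carrier M" "g \<in> S" for x g
    using c[OF that(1)] that(2) by (auto simp: decomposes_def PiE_iff)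
  have "component_maps M S D (\<lambda>g x. c x g)"
    unfolding component_maps_def
  proof (intro ballI conjI impI)
    fix g assume g: "g \<in> S"
    show "abelian_group_hom M M (\<lambda>x. c x g)"
      using g D family_closed c_eq[OF decomposes_add[OF c c]]
      by (intro abelian_group_hom_intro) (auto simp: hom_def abelian_group_axioms)
    show "c y g = y" if "y \<in> D g" for y
      using c_eq[OF decomposes_single[OF g that]] g by simp
    show "c y g = \<zero>" if "y \<in> D h" "h \<in> S" "h \<noteq> g" for y h
      using c_eq[OF decomposes_single[OF that(2,1)]] g that by simp
  qed
  then show ?thesis by blast
qed

lemma direct_sum_decomp_span:
  fixes M (structure)
  assumes "abelian_group M" "direct_sum_decomp M S D"
  shows "carrier M \<subseteq> additive_span M (\<Union>g\<in>S. D g)"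
proof
  interpret subgroup_family M S D using assms by (rule direct_sum_decomp_family)
  interpret K: additive_subgroup "additive_span M (\<Union>g\<in>S. D g)" M
    by (rule additive_subgroup_span) (rule Union_carrier)
  fix x assume "x \<in> carrier M"
  then obtain f where f: "decomposes M S D f x"
    using assms(2) by (auto simp: direct_sum_decomp_def decomposes_def)
  have "finsum M f F \<in> additive_span M (\<Union>g\<in>S. D g)" if "finite F" "F \<subseteq> S" for F
    using that
  proof (induction F)
    case (insert g F)
    have D: "f h \<in> D h" if "h \<in> S" for h
      using f that by (auto simp: decomposes_def PiE_iff)
    have "f g \<in> additive_span M (\<Union>g\<in>S. D g)"
      using D insert.prems by (auto intro!: generate.incl)
    with insert D family_closed show ?case
      by (subst finsum_insert) auto
  qed simp
  then show "x \<in> additive_span M (\<Union>g\<in>S. D g)"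
    using f by (auto simp: decomposes_def)
qed

text \<open>The projection fixes \<open>D' g\<close> and kills every other \<open>D' h\<close>,
  hence sends all of them, and so their span, into \<open>D' g\<close>. This is the common core of
  the three results below on smaller families, graded subgroups and graded quotients.\<close>

lemma component_maps_subset:
  assumes "subgroup_family M S D" "component_maps M S D \<pi>" "\<And>g. g \<in> S \<Longrightarrow> D' g \<subseteq> D g"
    and "\<And>g. g \<in> S \<Longrightarrow> additive_subgroup (D' g) M"
    and "x \<in> additive_span M (\<Union>g\<in>S. D' g)" "g \<in> S"
  shows "\<pi> g x \<in> D' g"
proof -
  interpret subgroup_family M S D by fact
  interpret p: abelian_group_hom M M "\<pi> g"
    using assms by (auto simp: component_maps_def)
  show ?thesis
  proof (rule p.additive_span_hom[OF _ _ _ assms(5)])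
    show "(\<Union>g\<in>S. D' g) \<subseteq> carrier M"
      using assms(3) Union_carrier by blast
    show "\<pi> g x \<in> D' g" if "x \<in> (\<Union>g\<in>S. D' g)" for x
    proof -
      obtain h where h: "h \<in> S" "x \<in> D' h" using \<open>x \<in> _\<close> by auto
      then have "x \<in> D h" using assms(3) by blast
      with h show ?thesis
        using assms(2,6) additive_subgroup.zero_closed[OF assms(4)[OF assms(6)]]
        by (cases "h = g") (auto simp: component_maps_def)
    qed
  qed (use assms in auto)
qed

text \<open>An element of \<open>D g\<close> is fixed by the projection to index \<open>g\<close>,
  which carries the span of the smaller family into \<open>D' g\<close>; so summands cannot be
  shrunk properly and still span. This identifies a given grading of the path algebra with the one
  by degrees of paths.\<close>

lemma direct_sum_decomp_refine:
  assumes "abelian_group M" "direct_sum_decomp M S D"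
    and "\<And>g. g \<in> S \<Longrightarrow> D' g \<subseteq> D g" "\<And>g. g \<in> S \<Longrightarrow> additive_subgroup (D' g) M"
    and "carrier M \<subseteq> additive_span M (\<Union>g\<in>S. D' g)" "g \<in> S"
  shows "D g = D' g"
proof -
  interpret subgroup_family M S D using assms(1,2) by (rule direct_sum_decomp_family)
  obtain \<pi> where \<pi>: "component_maps M S D \<pi>"
    using direct_sum_decomp_component_maps[OF assms(1,2)] by blast
  have "x \<in> D' g" if "x \<in> D g" for x
  proof -
    have "\<pi> g x \<in> D' g"
      by (rule component_maps_subset[OF _ \<pi> assms(3,4)])
        (use assms(5,6) that family_closed subgroup_family_axioms in auto)
    moreover have "\<pi> g x = x" using \<pi> that assms(6) by (auto simp: component_maps_def)
    ultimately show ?thesis by simp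
  qed
  with assms(3,6) show ?thesis by blast
qed

lemma abelian_group_restrict:
  fixes M (structure)
  assumes "abelian_group M" "additive_subgroup J M"
  shows "abelian_group (M\<lparr>carrier := J\<rparr>)"
proof -
  interpret abelian_group M by fact
  interpret J: additive_subgroup J M by fact
  let ?N = "M\<lparr>carrier := J\<rparr>"
  show ?thesis
  proof (rule abelian_groupI)
    show "\<exists>y\<in>carrier ?N. y \<oplus>\<^bsub>?N\<^esub> x = \<zero>\<^bsub>?N\<^esub>" if "x \<in> carrier ?N" for x
      using that J.a_inv_closed by (auto intro!: bexI[of _ "\<ominus> x"] l_neg)
  qed (auto intro: a_assoc a_comm)
qed

text \<open>The projections of \<open>M\<close> preserve \<open>J\<close> because \<open>J\<close>
  is spanned by homogeneous elements; restricted to \<open>J\<close> they certify its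
  decomposition.\<close>

lemma direct_sum_decomp_sub:
  fixes M (structure)
  assumes "abelian_group M" "direct_sum_decomp M S D" "additive_subgroup J M"
    and "J \<subseteq> additive_span M (\<Union>g\<in>S. J \<inter> D g)"
  shows "direct_sum_decomp (M\<lparr>carrier := J\<rparr>) S (\<lambda>g. J \<inter> D g)"
proof -
  interpret subgroup_family M S D using assms(1,2) by (rule direct_sum_decomp_family)
  interpret J: additive_subgroup J M by fact
  obtain \<pi> where \<pi>: "component_maps M S D \<pi>"
    using direct_sum_decomp_component_maps[OF assms(1,2)] by blast
  let ?N = "M\<lparr>carrier := J\<rparr>"
  note ag = abelian_group_restrict[OF assms(1,3)]
  have inter: "additive_subgroup (J \<inter> D g) M" if "g \<in> S" for g
    using additive_subgroups[OF that] assms(3)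
    by (auto simp: additive_subgroup_def intro: add.subgroups_Inter_pair)
  have sub: "additive_subgroup (J \<inter> D g) ?N" if "g \<in> S" for g
  proof -
    interpret K: additive_subgroup "J \<inter> D g" M using inter that .
    interpret N: abelian_group ?N by (rule ag)
    show ?thesis
    proof (rule N.additive_subgroup_criterion)
      fix a assume a: "a \<in> J \<inter> D g"
      have "\<ominus>\<^bsub>?N\<^esub> a = \<ominus> a"
        using a J.a_inv_closed
        by (intro N.minus_equality) (auto simp: l_neg)
      then show "\<ominus>\<^bsub>?N\<^esub> a \<in> J \<inter> D g" using K.a_inv_closed[OF a] by simp
    qed (use K.a_closed K.zero_closed in auto)
  qed
  interpret N: subgroup_family ?N S "\<lambda>g. J \<inter> D g"
    using ag sub by (auto simp: subgroup_family_def subgroup_family_axioms_def)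
  show ?thesis
  proof (rule N.direct_sum_decompI)
    have "generate (add_monoid M) (\<Union>g\<in>S. J \<inter> D g) = generate (add_monoid M\<lparr>carrier := J\<rparr>) (\<Union>g\<in>S. J \<inter> D g)"
      by (rule add.generate_consistent[symmetric]) (use J.a_subgroup in auto)
    with assms(4) show "carrier ?N \<subseteq> additive_span ?N (\<Union>g\<in>S. J \<inter> D g)" by simp
    have "\<pi> g x \<in> J" if "x \<in> J" "g \<in> S" for x g
    proof -
      have "\<pi> g x \<in> J \<inter> D g"
        by (rule component_maps_subset[OF subgroup_family_axioms \<pi> _ inter])
          (use assms(4) that in auto)
      then show ?thesis by simp
    qed
    then show "component_maps ?N S (\<lambda>g. J \<inter> D g) \<pi>"
      using \<pi> unfolding component_maps_def
      by (auto intro!: abelian_group_hom_intro ag simp: hom_def abelian_group_hom.hom_add)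
  qed
qed

text \<open>Each projection of \<open>M\<close> maps the kernel of \<open>p\<close> into itself,
  since the kernel is spanned by homogeneous elements, and therefore descends to
  \<open>N\<close>.\<close>

lemma direct_sum_decomp_image:
  fixes M (structure)
  assumes "direct_sum_decomp M S D" "abelian_group_hom M N p" "p ` carrier M = carrier N"
    and "a_kernel M N p \<subseteq> additive_span M (\<Union>g\<in>S. a_kernel M N p \<inter> D g)"
  shows "direct_sum_decomp N S (\<lambda>g. p ` D g)"
proof -
  interpret p: abelian_group_hom M N p by fact
  have M: "abelian_group M" by (rule p.G.abelian_group_axioms)
  interpret subgroup_family M S D using M assms(1) by (rule direct_sum_decomp_family)
  obtain \<pi> where \<pi>: "component_maps M S D \<pi>"
    using direct_sum_decomp_component_maps[OF M assms(1)] by blast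
  let ?J = "a_kernel M N p"
  have J: "x \<in> ?J \<longleftrightarrow> x \<in> carrier M \<and> p x = \<zero>\<^bsub>N\<^esub>" for x
    unfolding a_kernel_def kernel_def by simp
  have inter: "additive_subgroup (?J \<inter> D g) M" if "g \<in> S" for g
    using additive_subgroups[OF that] p.additive_subgroup_a_kernel
    by (auto simp: additive_subgroup_def intro: p.G.add.subgroups_Inter_pair)
  have ker: "p (\<pi> g x) = \<zero>\<^bsub>N\<^esub>" if "x \<in> ?J" "g \<in> S" for x g
  proof -
    have "\<pi> g x \<in> ?J \<inter> D g"
      by (rule component_maps_subset[OF subgroup_family_axioms \<pi> _ inter])
        (use assms(4) that in auto)
    then show ?thesis by (simp add: J)
  qed
  have hom: "abelian_group_hom M M (\<pi> g)" if "g \<in> S" for g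
    using \<pi> that by (auto simp: component_maps_def)
  have well_defined: "p (\<pi> g x) = p (\<pi> g y)" if "x \<in> carrier M" "y \<in> carrier M" "p x = p y" "g \<in> S" for x y g
  proof -
    interpret q: abelian_group_hom M M "\<pi> g" using hom that by simp
    have "p (x \<oplus> \<ominus> y) = \<zero>\<^bsub>N\<^esub>" using that(1,2,3) by (simp add: p.H.r_neg)
    moreover have "x \<oplus> \<ominus> y \<in> carrier M" using that by simp
    ultimately have "p (\<pi> g (x \<oplus> \<ominus> y)) = \<zero>\<^bsub>N\<^esub>" using ker that(4) J by blast
    then have "p (\<pi> g x) \<oplus>\<^bsub>N\<^esub> \<ominus>\<^bsub>N\<^esub> p (\<pi> g y) = \<zero>\<^bsub>N\<^esub>" using that(1,2) by simp
    then show ?thesis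
      using that(1,2) p.H.minus_equality[of "p (\<pi> g x)" "\<ominus>\<^bsub>N\<^esub> p (\<pi> g y)"] by simp
  qed
  \<comment> \<open>An arbitrary set-theoretic section of \<open>p\<close>. It may fail to be
    additive, but by \<open>well_defined\<close> the value \<open>p (\<pi> g (s y))\<close> does not
    depend on the choice.\<close>
  define s where "s = (\<lambda>y. SOME x. x \<in> carrier M \<and> p x = y)"
  have s: "s y \<in> carrier M" "p (s y) = y" if "y \<in> carrier N" for y
  proof -
    have "\<exists>x. x \<in> carrier M \<and> p x = y" using that unfolding assms(3)[symmetric] by auto
    from someI_ex[OF this] show "s y \<in> carrier M" "p (s y) = y" by (simp_all add: s_def)
  qed
  have ps: "p (\<pi> g (s (p x))) = p (\<pi> g x)" if "x \<in> carrier M" "g \<in> S" for x g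
    using that by (intro well_defined s) auto
  have sub: "additive_subgroup (p ` D g) N" if g: "g \<in> S" for g
    by (rule p.additive_subgroup_image[OF additive_subgroups[OF g]])
  interpret N: subgroup_family N S "\<lambda>g. p ` D g"
    using p.H.abelian_group_axioms sub by (auto simp: subgroup_family_def subgroup_family_axioms_def)
  show ?thesis
  proof (rule N.direct_sum_decompI)
    show "carrier N \<subseteq> additive_span N (\<Union>g\<in>S. p ` D g)"
    proof
      fix y assume "y \<in> carrier N"
      then obtain x where x: "x \<in> carrier M" "y = p x" using assms(3) by auto
      have "p x \<in> additive_span N (\<Union>g\<in>S. p ` D g)"
      proof (rule p.additive_span_hom[OF Union_carrier])
        show "additive_subgroup (additive_span N (\<Union>g\<in>S. p ` D g)) N"
          by (rule p.H.additive_subgroup_span[OF N.Union_carrier])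
        show "x \<in> additive_span M (\<Union>g\<in>S. D g)"
          using direct_sum_decomp_span[OF M assms(1)] x(1) by (rule subsetD)
        show "p z \<in> additive_span N (\<Union>g\<in>S. p ` D g)" if "z \<in> (\<Union>g\<in>S. D g)" for z
          using that by (intro generate.incl) blast
      qed
      with x show "y \<in> additive_span N (\<Union>g\<in>S. p ` D g)" by simp
    qed
    show "component_maps N S (\<lambda>g. p ` D g) (\<lambda>g y. p (\<pi> g (s y)))"
      unfolding component_maps_def
    proof (intro ballI conjI impI)
      fix g assume g: "g \<in> S"
      interpret q: abelian_group_hom M M "\<pi> g" using hom g by simp
      show "abelian_group_hom N N (\<lambda>y. p (\<pi> g (s y)))"
      proof (rule abelian_group_hom_intro)
        have "p (\<pi> g (s (x \<oplus>\<^bsub>N\<^esub> y))) = p (\<pi> g (s x)) \<oplus>\<^bsub>N\<^esub> p (\<pi> g (s y))"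
          if "x \<in> carrier N" "y \<in> carrier N" for x y
        proof -
          have "p (\<pi> g (s (x \<oplus>\<^bsub>N\<^esub> y))) = p (\<pi> g (s x \<oplus> s y))"
            using that s g by (intro well_defined) auto
          then show ?thesis using that s by simp
        qed
        then show "p (\<pi> g (s (x \<oplus>\<^bsub>N\<^esub> y))) = p (\<pi> g (s x)) \<oplus>\<^bsub>N\<^esub> p (\<pi> g (s y))"
          if "x \<in> carrier N" "y \<in> carrier N" for x y
          using that .
      qed (use s p.H.abelian_group_axioms in auto)
      show "p (\<pi> g (s y)) = y" if "y \<in> p ` D g" for y
        using that ps g \<pi> family_closed by (auto simp: component_maps_def)
      show "p (\<pi> g (s y)) = \<zero>\<^bsub>N\<^esub>" if "h \<in> S" "h \<noteq> g" "y \<in> p ` D h" for y h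
        using that ps g \<pi> family_closed by (auto simp: component_maps_def)
    qed
  qed
qed

section \<open>Algebras without unit and their ideals\<close>

text \<open>The common setting for the path algebra, the free algebra, the Cohn and the Leavitt path
  algebra, none of which need have a unit.\<close>

locale scalar_rng = abelian_group R for R :: "('f::field, 'a) module" (structure) +
  assumes mult_closed [simp]: "a \<in> carrier R \<Longrightarrow> b \<in> carrier R \<Longrightarrow> a \<otimes> b \<in> carrier R"
    and mult_assoc: "a \<in> carrier R \<Longrightarrow> b \<in> carrier R \<Longrightarrow> c \<in> carrier R \<Longrightarrow> (a \<otimes> b) \<otimes> c = a \<otimes> (b \<otimes> c)"
    and mult_add_left: "a \<in> carrier R \<Longrightarrow> b \<in> carrier R \<Longrightarrow> c \<in> carrier R \<Longrightarrow>
      (a \<oplus> b) \<otimes> c = a \<otimes> c \<oplus> b \<otimes> c"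
    and mult_add_right: "a \<in> carrier R \<Longrightarrow> b \<in> carrier R \<Longrightarrow> c \<in> carrier R \<Longrightarrow>
      a \<otimes> (b \<oplus> c) = a \<otimes> b \<oplus> a \<otimes> c"
    and scale_closed [simp]: "a \<in> carrier R \<Longrightarrow> k \<odot> a \<in> carrier R"
    and scale_add: "a \<in> carrier R \<Longrightarrow> b \<in> carrier R \<Longrightarrow> k \<odot> (a \<oplus> b) = k \<odot> a \<oplus> k \<odot> b"
    and scale_mult_left: "a \<in> carrier R \<Longrightarrow> b \<in> carrier R \<Longrightarrow> (k \<odot> a) \<otimes> b = k \<odot> (a \<otimes> b)"
    and scale_mult_right: "a \<in> carrier R \<Longrightarrow> b \<in> carrier R \<Longrightarrow> a \<otimes> (k \<odot> b) = k \<odot> (a \<otimes> b)"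
begin

lemma mult_left_hom: "c \<in> carrier R \<Longrightarrow> abelian_group_hom R R (\<lambda>x. c \<otimes> x)"
  by (rule abelian_group_hom_intro) (auto simp: mult_add_right abelian_group_axioms)

lemma mult_right_hom: "c \<in> carrier R \<Longrightarrow> abelian_group_hom R R (\<lambda>x. x \<otimes> c)"
  by (rule abelian_group_hom_intro) (auto simp: mult_add_left abelian_group_axioms)

lemma scale_hom: "abelian_group_hom R R (\<lambda>x. k \<odot> x)"
  by (rule abelian_group_hom_intro) (auto simp: scale_add abelian_group_axioms)

lemma mult_zero_right [simp]: "c \<in> carrier R \<Longrightarrow> c \<otimes> \<zero> = \<zero>"
  by (rule abelian_group_hom.hom_zero[OF mult_left_hom])

lemma mult_zero_left [simp]: "c \<in> carrier R \<Longrightarrow> \<zero> \<otimes> c = \<zero>"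
  by (rule abelian_group_hom.hom_zero[OF mult_right_hom])

lemma alg_ideal_carrier: "alg_ideal R (carrier R)"
  by (auto simp: alg_ideal_def alg_subspace_def intro!: additive_subgroup_criterion)

text \<open>Scalings and one-sided multiplications are additive, so closure is tested on the
  spanning set.\<close>

lemma alg_ideal_additive_span:
  assumes S: "S \<subseteq> carrier R" and scale: "\<And>k x. x \<in> S \<Longrightarrow> k \<odot> x \<in> additive_span R S"
    and left: "\<And>r x. r \<in> carrier R \<Longrightarrow> x \<in> S \<Longrightarrow> r \<otimes> x \<in> additive_span R S"
    and right: "\<And>r x. r \<in> carrier R \<Longrightarrow> x \<in> S \<Longrightarrow> x \<otimes> r \<in> additive_span R S"
  shows "alg_ideal R (additive_span R S)"
proof -
  note K = additive_subgroup_span[OF S]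
  show ?thesis
    unfolding alg_ideal_def alg_subspace_def
    using abelian_group_hom.additive_span_hom[OF scale_hom S K scale]
      abelian_group_hom.additive_span_hom[OF mult_left_hom S K left]
      abelian_group_hom.additive_span_hom[OF mult_right_hom S K right] K by blast
qed

lemma alg_ideal_gen_incl: "B \<subseteq> alg_ideal_gen R B"
  by (auto simp: alg_ideal_gen_def)

lemma alg_ideal_gen_minimal: "alg_ideal R J \<Longrightarrow> B \<subseteq> J \<Longrightarrow> alg_ideal_gen R B \<subseteq> J"
  by (auto simp: alg_ideal_gen_def)

lemma alg_ideal_alg_ideal_gen:
  assumes "B \<subseteq> carrier R"
  shows "alg_ideal R (alg_ideal_gen R B)"
proof -
  have sub: "additive_subgroup J R" if "alg_ideal R J" for J
    using that by (simp add: alg_ideal_def alg_subspace_def)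
  have "additive_subgroup (alg_ideal_gen R B) R"
  proof (rule additive_subgroup_criterion)
    show "alg_ideal_gen R B \<subseteq> carrier R"
      using assms by (intro alg_ideal_gen_minimal alg_ideal_carrier)
    show "\<zero> \<in> alg_ideal_gen R B"
      by (auto simp: alg_ideal_gen_def intro: additive_subgroup.zero_closed[OF sub])
    show "a \<oplus> b \<in> alg_ideal_gen R B" if "a \<in> alg_ideal_gen R B" "b \<in> alg_ideal_gen R B" for a b
      using that by (auto simp: alg_ideal_gen_def intro: additive_subgroup.a_closed[OF sub])
    show "\<ominus> a \<in> alg_ideal_gen R B" if "a \<in> alg_ideal_gen R B" for a
      using that by (auto simp: alg_ideal_gen_def intro!: additive_subgroup.a_inv_closed[OF sub])
  qed
  then show ?thesis
    unfolding alg_ideal_def alg_subspace_def by (auto simp: alg_ideal_gen_def alg_ideal_def alg_subspace_def)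
qed

end

locale scalar_rng_ideal = scalar_rng R for R :: "('f::field, 'a) module" (structure) +
  fixes J :: "'a set"
  assumes ideal: "alg_ideal R J"
begin

sublocale J: abelian_subgroup J R
  using ideal by (intro abelian_subgroupI3) (auto simp: alg_ideal_def alg_subspace_def abelian_group_axioms)

abbreviation Q :: "('f, 'a set) module" where "Q \<equiv> quotient_algebra R J"

lemma ideal_mult: "r \<in> carrier R \<Longrightarrow> x \<in> J \<Longrightarrow> r \<otimes> x \<in> J" "r \<in> carrier R \<Longrightarrow> x \<in> J \<Longrightarrow> x \<otimes> r \<in> J"
  and ideal_scale: "x \<in> J \<Longrightarrow> k \<odot> x \<in> J"
  using ideal by (auto simp: alg_ideal_def alg_subspace_def)

lemma carrier_quotient: "carrier Q = (\<lambda>x. J +> x) ` carrier R"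
  by (auto simp: quotient_algebra_def FactRing_def A_RCOSETS_def')

lemma zero_quotient: "\<zero>\<^bsub>Q\<^esub> = J"
  by (simp add: quotient_algebra_def FactRing_def)

lemma coset_add: "x \<in> carrier R \<Longrightarrow> y \<in> carrier R \<Longrightarrow> (J +> x) \<oplus>\<^bsub>Q\<^esub> (J +> y) = J +> (x \<oplus> y)"
  by (simp add: quotient_algebra_def FactRing_def J.a_rcos_sum)

lemma coset_eq_iff:
  assumes "x \<in> carrier R" "y \<in> carrier R"
  shows "J +> x = J +> y \<longleftrightarrow> x \<oplus> \<ominus> y \<in> J"
  using assms J.a_rcos_module[of y x] J.a_rcos_self[of x] a_repr_independence[of x J y] J.a_subgroup
  by (auto intro: a_repr_independence[OF _ _ J.a_subgroup])

lemma coset_memD: "x' \<in> J +> x \<Longrightarrow> x \<in> carrier R \<Longrightarrow> x' \<in> carrier R \<and> (\<exists>h\<in>J. x' = h \<oplus> x)"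
  by (auto simp: a_r_coset_def')

lemma coset_translate: "x \<in> carrier R \<Longrightarrow> h \<in> J \<Longrightarrow> J +> (h \<oplus> x) = J +> x"
  by (subst coset_eq_iff) (auto simp: a_assoc r_neg)

text \<open>The product of cosets in \<open>R Quot J\<close> is a union over all pairs of
  representatives. Every pair gives the same coset, so the union collapses.\<close>

lemma coset_mult:
  assumes "x \<in> carrier R" "y \<in> carrier R"
  shows "(J +> x) \<otimes>\<^bsub>Q\<^esub> (J +> y) = J +> (x \<otimes> y)"
proof -
  have "J +> (a \<otimes> b) = J +> (x \<otimes> y)" if ab: "a \<in> J +> x" "b \<in> J +> y" for a b
  proof -
    obtain h h' where h: "h \<in> J" "a = h \<oplus> x" "h' \<in> J" "b = h' \<oplus> y"
      using coset_memD[OF ab(1) assms(1)] coset_memD[OF ab(2) assms(2)] by auto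
    \<comment> \<open>The bracket collects the terms with a factor from \<open>J\<close>; they lie
      in \<open>J\<close> because the ideal is two-sided.\<close>
    then have "a \<otimes> b = (h \<otimes> (h' \<oplus> y) \<oplus> x \<otimes> h') \<oplus> x \<otimes> y"
      using assms by (simp add: mult_add_left mult_add_right a_assoc a_lcomm)
    then show ?thesis
      using h assms by (simp only:) (intro coset_translate J.a_closed ideal_mult, auto)
  qed
  then have "(\<Union>a\<in>J +> x. \<Union>b\<in>J +> y. J +> (a \<otimes> b)) = (\<Union>a\<in>J +> x. \<Union>b\<in>J +> y. J +> (x \<otimes> y))"
    by (intro SUP_cong refl)
  also have "\<dots> = J +> (x \<otimes> y)"
    using J.a_rcos_self[OF assms(1)] J.a_rcos_self[OF assms(2)] by blast
  finally show ?thesis by (simp add: quotient_algebra_def FactRing_def rcoset_mult_def)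
qed

lemma coset_scale:
  assumes "x \<in> carrier R"
  shows "k \<odot>\<^bsub>Q\<^esub> (J +> x) = J +> (k \<odot> x)"
proof -
  have "J +> (k \<odot> a) = J +> (k \<odot> x)" if a: "a \<in> J +> x" for a
  proof -
    obtain h where "h \<in> J" "a = h \<oplus> x" using coset_memD[OF a assms] by auto
    then show ?thesis using assms ideal_scale by (simp add: scale_add coset_translate)
  qed
  then have "(\<Union>a\<in>J +> x. J +> (k \<odot> a)) = (\<Union>a\<in>J +> x. J +> (k \<odot> x))"
    by (intro SUP_cong refl)
  also have "\<dots> = J +> (k \<odot> x)"
    using J.a_rcos_self[OF assms] by blast
  finally show ?thesis by (simp add: quotient_algebra_def)
qed

lemma zero_quotient_coset: "\<zero>\<^bsub>Q\<^esub> = J +> \<zero>"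
  by (simp add: zero_quotient a_coset_add_zero J.a_subset)

lemma abelian_group_quotient: "abelian_group Q"
proof (rule abelian_groupI)
  show "\<exists>y\<in>carrier Q. y \<oplus>\<^bsub>Q\<^esub> x = \<zero>\<^bsub>Q\<^esub>" if x: "x \<in> carrier Q" for x
  proof -
    obtain a where "a \<in> carrier R" "x = J +> a" using x by (auto simp: carrier_quotient)
    then show ?thesis
      by (intro bexI[of _ "J +> (\<ominus> a)"])
        (auto simp: carrier_quotient zero_quotient_coset coset_add l_neg)
  qed
qed (auto simp: carrier_quotient zero_quotient_coset coset_add a_ac)

lemma scalar_rng_quotient: "scalar_rng Q"
  unfolding scalar_rng_def scalar_rng_axioms_def carrier_quotient
  by (auto simp: abelian_group_quotient coset_add coset_mult coset_scale
      mult_add_left mult_add_right mult_assoc scale_add scale_mult_left scale_mult_right)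

lemma coset_hom: "abelian_group_hom R Q (\<lambda>x. J +> x)"
  by (rule abelian_group_hom_intro)
    (auto simp: abelian_group_axioms abelian_group_quotient carrier_quotient coset_add)

lemma coset_zero_iff: "x \<in> carrier R \<Longrightarrow> J +> x = \<zero>\<^bsub>Q\<^esub> \<longleftrightarrow> x \<in> J"
  using coset_eq_iff[of x \<zero>] minus_equality[of \<zero> \<zero>]
  by (simp add: zero_quotient a_coset_add_zero J.a_subset)

lemma kernel_coset: "a_kernel R Q (\<lambda>x. J +> x) = J"
proof (rule Set.set_eqI)
  show "x \<in> a_kernel R Q (\<lambda>x. J +> x) \<longleftrightarrow> x \<in> J" for x
    using coset_zero_iff[of x] J.a_Hcarr[of x] unfolding a_kernel_def kernel_def by auto
qed

text \<open>\<open>F\<close> evaluates \<open>f\<close> at an arbitrary representative; two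
  representatives differ by an element of \<open>J\<close>, where \<open>f\<close> vanishes.\<close>

lemma lift_quotient:
  assumes "abelian_group_hom R M f" "\<And>x. x \<in> J \<Longrightarrow> f x = \<zero>\<^bsub>M\<^esub>"
  shows "\<exists>F. abelian_group_hom Q M F \<and> (\<forall>x\<in>carrier R. F (J +> x) = f x)"
proof -
  interpret f: abelian_group_hom R M f by fact
  define F where "F = (\<lambda>X. f (SOME x. x \<in> X))"
  have F: "F (J +> x) = f x" if x: "x \<in> carrier R" for x
  proof -
    have "(SOME x'. x' \<in> J +> x) \<in> J +> x"
      using J.a_rcos_self[OF x] by (rule someI)
    from coset_memD[OF this x] show ?thesis
      using x assms(2) unfolding F_def by auto
  qed
  have "abelian_group_hom Q M F"
    by (rule abelian_group_hom_intro)
      (auto simp: abelian_group_quotient f.H.abelian_group_axioms carrier_quotient F coset_add)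
  with F show ?thesis by blast
qed

lemma quotient_grading:
  assumes "algebra_grading H R D" "J \<subseteq> additive_span R (\<Union>g\<in>carrier H. J \<inter> D g)"
  shows "algebra_grading H Q (\<lambda>g. (\<lambda>x. J +> x) ` D g)"
proof -
  have dsd: "direct_sum_decomp Q (carrier H) (\<lambda>g. (\<lambda>x. J +> x) ` D g)"
    by (rule direct_sum_decomp_image[OF _ coset_hom])
      (use assms in \<open>auto simp: algebra_grading_def kernel_coset carrier_quotient\<close>)
  have sub: "D g \<subseteq> carrier R" if "g \<in> carrier H" for g
    using assms(1) that additive_subgroup.a_subset
    by (fastforce simp: algebra_grading_def alg_subspace_def)
  then have mem: "x \<in> carrier R" if "g \<in> carrier H" "x \<in> D g" for g x using that by auto
  show ?thesis
    unfolding algebra_grading_def alg_subspace_def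
  proof (intro conjI ballI allI dsd)
    fix g assume g: "g \<in> carrier H"
    show "additive_subgroup ((\<lambda>x. J +> x) ` D g) Q"
      using dsd g by (simp add: direct_sum_decomp_def)
    show "k \<odot>\<^bsub>Q\<^esub> x \<in> (\<lambda>x. J +> x) ` D g" if "x \<in> (\<lambda>x. J +> x) ` D g" for k x
      using that g assms(1) by (auto simp: mem coset_scale algebra_grading_def alg_subspace_def)
    show "x \<otimes>\<^bsub>Q\<^esub> y \<in> (\<lambda>x. J +> x) ` D (g \<otimes>\<^bsub>H\<^esub> h)"
      if "h \<in> carrier H" "x \<in> (\<lambda>x. J +> x) ` D g" "y \<in> (\<lambda>x. J +> x) ` D h" for h x y
      using that g assms(1) by (auto simp: mem coset_mult algebra_grading_def)
  qed
qed

end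

text \<open>The span of the homogeneous elements of the generated ideal is itself an ideal:
  multiplied by a homogeneous ring element, such an element stays homogeneous and in the ideal, and
  every ring element is a sum of homogeneous ones. As this span contains \<open>B\<close>,
  minimality of the generated ideal applies.\<close>

lemma (in scalar_rng) homogeneous_alg_ideal_gen:
  assumes H: "group H" and gr: "algebra_grading H R D"
    and B: "\<And>b. b \<in> B \<Longrightarrow> \<exists>g\<in>carrier H. b \<in> D g"
  shows "alg_ideal_gen R B \<subseteq> additive_span R (\<Union>g\<in>carrier H. alg_ideal_gen R B \<inter> D g)"
proof -
  interpret H: group H by fact
  interpret subgroup_family R "carrier H" D
    using gr by (intro direct_sum_decomp_family abelian_group_axioms) (simp add: algebra_grading_def)
  have "B \<subseteq> carrier R" using B family_closed by blast
  then interpret I: scalar_rng_ideal R "alg_ideal_gen R B"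
    by (intro scalar_rng_ideal.intro scalar_rng_ideal_axioms.intro alg_ideal_alg_ideal_gen scalar_rng_axioms)
  let ?U = "\<Union>g\<in>carrier H. alg_ideal_gen R B \<inter> D g"
  have U: "?U \<subseteq> carrier R" using family_closed by blast
  interpret K: additive_subgroup "additive_span R ?U" R by (rule additive_subgroup_span[OF U])
  have span: "carrier R \<subseteq> additive_span R (\<Union>g\<in>carrier H. D g)"
    using gr by (intro direct_sum_decomp_span abelian_group_axioms) (simp add: algebra_grading_def)
  have prod: "r \<otimes> y \<in> additive_span R ?U \<and> y \<otimes> r \<in> additive_span R ?U"
    if r: "r \<in> carrier R" and y: "y \<in> ?U" for r y
  proof -
    obtain g where g: "g \<in> carrier H" "y \<in> alg_ideal_gen R B" "y \<in> D g" using y by auto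
    have yc: "y \<in> carrier R" using family_closed g by blast
    have "z \<otimes> y \<in> additive_span R ?U \<and> y \<otimes> z \<in> additive_span R ?U"
      if z: "z \<in> (\<Union>g\<in>carrier H. D g)" for z
    proof -
      obtain h where h: "h \<in> carrier H" "z \<in> D h" using z by auto
      then have "z \<in> carrier R" using family_closed by blast
      then have "z \<otimes> y \<in> alg_ideal_gen R B \<inter> D (h \<otimes>\<^bsub>H\<^esub> g)" "h \<otimes>\<^bsub>H\<^esub> g \<in> carrier H"
          "y \<otimes> z \<in> alg_ideal_gen R B \<inter> D (g \<otimes>\<^bsub>H\<^esub> h)" "g \<otimes>\<^bsub>H\<^esub> h \<in> carrier H"
        using gr g h I.ideal_mult by (auto simp: algebra_grading_def)
      then show ?thesis by (blast intro: generate.incl)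
    qed
    then show ?thesis
      using abelian_group_hom.additive_span_hom[OF mult_right_hom[OF yc] Union_carrier K.additive_subgroup_axioms]
        abelian_group_hom.additive_span_hom[OF mult_left_hom[OF yc] Union_carrier K.additive_subgroup_axioms]
        span r by blast
  qed
  have scale: "k \<odot> y \<in> additive_span R ?U" if "y \<in> ?U" for k y
  proof -
    obtain g where "g \<in> carrier H" "y \<in> alg_ideal_gen R B" "y \<in> D g" using \<open>y \<in> ?U\<close> by auto
    then have "g \<in> carrier H" "k \<odot> y \<in> alg_ideal_gen R B \<inter> D g"
      using gr I.ideal_scale by (auto simp: algebra_grading_def alg_subspace_def)
    then show ?thesis by (intro generate.incl UN_I)
  qed
  show ?thesis
  proof (rule alg_ideal_gen_minimal)
    show "alg_ideal R (additive_span R ?U)"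
      by (rule alg_ideal_additive_span[OF U scale]) (use prod in auto)
    show "B \<subseteq> additive_span R ?U" using B alg_ideal_gen_incl by (auto intro!: generate.incl)
  qed
qed

section \<open>Algebras on a basis\<close>

lemma poly_mapping_sum_single:
  fixes a :: "'k \<Rightarrow>\<^sub>0 'b::comm_monoid_add"
  shows
  "(\<Sum>p\<in>keys a. single p (lookup a p)) = a"
  by (rule poly_mapping_eqI)
    (auto simp: lookup_sum lookup_single when_def in_keys_iff)

text \<open>The points of the support are added one at a time. Additive identities thereby reduce to
  functions \<open>single p k\<close>.\<close>

lemma poly_mapping_additive_induct [consumes 1, case_names zero single add]:
  fixes a :: "'k \<Rightarrow>\<^sub>0 'b::comm_monoid_add"
  assumes "keys a \<subseteq> B" "P 0" "\<And>p k. p \<in> B \<Longrightarrow> P (single p k)"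
    and "\<And>a b. keys a \<subseteq> B \<Longrightarrow> keys b \<subseteq> B \<Longrightarrow> P a \<Longrightarrow> P b \<Longrightarrow> P (a + b)"
  shows "P a"
proof -
  let ?s = "\<lambda>A. \<Sum>p\<in>A. single p (lookup a p)"
  \<comment> \<open>The bound on the keys is carried along because the rule for sums demands it of
    both summands.\<close>
  have "P (?s A) \<and> keys (?s A) \<subseteq> B" if "finite A" "A \<subseteq> B" for A
    using that
  proof (induction A)
    case (insert p A)
    then have "keys (single p (lookup a p)) \<subseteq> B" by simp
    with insert show ?case
      using keys_add[of "single p (lookup a p)" "?s A"]
      by (simp add: assms(3,4)) (blast dest: subsetD)
  qed (use assms(2) in auto)
  from this[of "keys a"] show ?thesis
    using assms(1) by (simp add: poly_mapping_sum_single)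
qed

text \<open>Isolates the contribution of one pair of basis elements to \<open>lin_mult\<close> as an
  additive function of the scalar.\<close>

definition basis_prod :: "('k \<Rightarrow> 'k \<Rightarrow> 'k option) \<Rightarrow> 'k \<Rightarrow> 'k \<Rightarrow> 'f::field \<Rightarrow> ('k \<Rightarrow>\<^sub>0 'f)" where
  "basis_prod c p q k = (case c p q of None \<Rightarrow> 0 | Some r \<Rightarrow> single r k)"

lemma basis_prod_add: "basis_prod c p q (k + l) = basis_prod c p q k + basis_prod c p q l"
  by (simp add: basis_prod_def single_add split: option.split)

lemma basis_prod_zero [simp]: "basis_prod c p q 0 = 0"
  by (simp add: basis_prod_def split: option.split)

text \<open>Supports are not compatible with addition, since cancellation can shrink them. Over
  fixed finite supersets the double sum is visibly biadditive.\<close>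

lemma lin_mult_supset:
  assumes "finite P" "finite Q" "keys a \<subseteq> P" "keys b \<subseteq> Q"
  shows "lin_mult c a b =
    (\<Sum>p\<in>P. \<Sum>q\<in>Q. basis_prod c p q (lookup a p * lookup b q))"
proof -
  have "lin_mult c a b = (\<Sum>p\<in>keys a. \<Sum>q\<in>keys b.
      basis_prod c p q (lookup a p * lookup b q))"
    by (simp add: lin_mult_def basis_prod_def)
  also have "\<dots> = (\<Sum>p\<in>keys a. \<Sum>q\<in>Q.
      basis_prod c p q (lookup a p * lookup b q))"
    using assms by (intro sum.cong sum.mono_neutral_left) (auto simp: in_keys_iff)
  also have "\<dots> = (\<Sum>p\<in>P. \<Sum>q\<in>Q. basis_prod c p q (lookup a p * lookup b q))"
    using assms by (intro sum.mono_neutral_left) (auto simp: in_keys_iff)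
  finally show ?thesis .
qed

lemma lin_mult_add_left: "lin_mult c (a + a') b = lin_mult c a b + lin_mult c a' b"
  using keys_add[of a a']
  by (simp add: lin_mult_supset[where P="keys a \<union> keys a'" and Q="keys b"]
      lookup_add distrib_right basis_prod_add sum.distrib)

lemma lin_mult_add_right: "lin_mult c a (b + b') = lin_mult c a b + lin_mult c a b'"
  using keys_add[of b b']
  by (simp add: lin_mult_supset[where P="keys a" and Q="keys b \<union> keys b'"]
      lookup_add distrib_left basis_prod_add sum.distrib)

lemma lin_mult_zero [simp]: "lin_mult c 0 b = 0" "lin_mult c a 0 = 0"
  by (simp_all add: lin_mult_def)

lemma lin_mult_single:
  "lin_mult c (single p k) (single q l) = basis_prod c p q (k * l)"
  by (subst lin_mult_supset[where P="{p}" and Q="{q}"]) auto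

lemma map_scale_add:
  "Poly_Mapping.map ((*) k) (a + b) = Poly_Mapping.map ((*) k) a + Poly_Mapping.map ((*) (k::'f::field)) b"
  by (rule poly_mapping_eqI) (auto simp: Poly_Mapping.map.rep_eq lookup_add when_def simp flip: distrib_left)

lemma map_scale_single: "Poly_Mapping.map ((*) k) (single p l) = single p (k * (l::'f::field))"
  by (rule poly_mapping_eqI) (simp add: Poly_Mapping.map.rep_eq lookup_single when_def)

lemma map_scale_zero [simp]: "Poly_Mapping.map ((*) (k::'f::field)) 0 = 0"
  by (rule poly_mapping_eqI) (simp add: Poly_Mapping.map.rep_eq)

lemma keys_map_scale: "keys (Poly_Mapping.map ((*) (k::'f::field)) a) \<subseteq> keys a"
  by (auto simp: in_keys_iff Poly_Mapping.map.rep_eq when_def)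

text \<open>\<open>Option.bind\<close> expresses associativity together with its domain: one
  bracketing is defined exactly when the other is. The instances are composable paths and nonempty
  words.\<close>

locale partial_semigroup =
  fixes B :: "'k set" and c :: "'k \<Rightarrow> 'k \<Rightarrow> 'k option"
  assumes comp_closed: "p \<in> B \<Longrightarrow> q \<in> B \<Longrightarrow> c p q = Some r \<Longrightarrow> r \<in> B"
    and comp_assoc: "p \<in> B \<Longrightarrow> q \<in> B \<Longrightarrow> r \<in> B \<Longrightarrow>
      Option.bind (c p q) (\<lambda>s. c s r) = Option.bind (c q r) (c p)"
begin

lemma keys_basis_prod: "p \<in> B \<Longrightarrow> q \<in> B \<Longrightarrow> keys (basis_prod c p q k) \<subseteq> B"
  using comp_closed[of p q] by (cases "c p q") (auto simp: basis_prod_def)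

lemma keys_lin_mult:
  assumes "keys a \<subseteq> B" "keys b \<subseteq> B"
  shows "keys (lin_mult c a b) \<subseteq> B"
proof -
  have "keys (lin_mult c a b) \<subseteq> (\<Union>p\<in>keys a. \<Union>q\<in>keys b.
      keys (basis_prod c p q (lookup a p * lookup b q)))"
    unfolding lin_mult_def basis_prod_def[symmetric]
    by (rule order_trans[OF keys_sum]) (intro UN_mono order_refl keys_sum)
  also have "\<dots> \<subseteq> B" using assms keys_basis_prod by blast
  finally show ?thesis .
qed

text \<open>Associativity of basis elements is extended additively to one argument at a time, from
  the last to the first.\<close>

lemma lin_mult_assoc:
  fixes x y z :: "'k \<Rightarrow>\<^sub>0 'f::field"
  assumes "keys x \<subseteq> B" "keys y \<subseteq> B" "keys z \<subseteq> B"
  shows "lin_mult c (lin_mult c x y) z = lin_mult c x (lin_mult c y z)"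
proof -
  have *: "lin_mult c (lin_mult c (single p k) (single q l)) (single r m)
      = lin_mult c (single p k) (lin_mult c (single q l) (single r m))"
    if "p \<in> B" "q \<in> B" "r \<in> B" for p q r and k l m :: 'f
    using comp_assoc[OF that]
    by (auto simp: lin_mult_single basis_prod_def mult.assoc split: option.splits)
  have **: "lin_mult c (lin_mult c (single p k) (single q l)) z
      = lin_mult c (single p k) (lin_mult c (single q l) z)"
    if "p \<in> B" "q \<in> B" for p q and k l :: 'f
    using assms(3) by (induction z rule: poly_mapping_additive_induct)
      (simp_all add: * that lin_mult_add_right)
  have "lin_mult c (lin_mult c (single p k) y) z
      = lin_mult c (single p k) (lin_mult c y z)" if "p \<in> B" for p k
    using assms(2) by (induction y rule: poly_mapping_additive_induct)
      (simp_all add: ** that lin_mult_add_right lin_mult_add_left)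
  with assms(1) show ?thesis
    by (induction x rule: poly_mapping_additive_induct) (simp_all add: lin_mult_add_left)
qed

lemma lin_mult_scale_left:
  "lin_mult c (Poly_Mapping.map ((*) (k::'f::field)) a) b = Poly_Mapping.map ((*) k) (lin_mult c a b)"
proof -
  have "lin_mult c (Poly_Mapping.map ((*) k) (single p l)) b = Poly_Mapping.map ((*) k) (lin_mult c (single p l) b)" for p l
    by (induction b rule: poly_mapping_additive_induct[where B=UNIV, OF subset_UNIV])
      (simp_all add: lin_mult_add_right map_scale_add map_scale_single lin_mult_single
        basis_prod_def mult.assoc split: option.splits)
  then show ?thesis
    by (induction a rule: poly_mapping_additive_induct[where B=UNIV, OF subset_UNIV])
      (simp_all add: lin_mult_add_left map_scale_add)
qed

lemma lin_mult_scale_right: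
  "lin_mult c a (Poly_Mapping.map ((*) (k::'f::field)) b) = Poly_Mapping.map ((*) k) (lin_mult c a b)"
proof -
  have "lin_mult c (single p l) (Poly_Mapping.map ((*) k) b) = Poly_Mapping.map ((*) k) (lin_mult c (single p l) b)" for p l
    by (induction b rule: poly_mapping_additive_induct[where B=UNIV, OF subset_UNIV])
      (simp_all add: lin_mult_add_right map_scale_add map_scale_single lin_mult_single
        basis_prod_def mult.left_commute split: option.splits)
  then show ?thesis
    by (induction a rule: poly_mapping_additive_induct[where B=UNIV, OF subset_UNIV])
      (simp_all add: lin_mult_add_left map_scale_add)
qed

end

lemma basis_algebra_simps [simp]:
  "carrier (basis_algebra B c) = {a. keys a \<subseteq> B}"
  "mult (basis_algebra B c) = lin_mult c"
  "zero (basis_algebra B c) = 0"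
  "add (basis_algebra B c) = (+)"
  "smult (basis_algebra B c) = (\<lambda>k. Poly_Mapping.map ((*) k))"
  by (simp_all add: basis_algebra_def)

lemma keys_add_subset: "keys a \<subseteq> B \<Longrightarrow> keys b \<subseteq> B \<Longrightarrow> keys (a + b) \<subseteq> B"
  using keys_add[of a b] by auto

lemma abelian_group_basis_algebra: "abelian_group (basis_algebra B c :: ('f::field, 'k \<Rightarrow>\<^sub>0 'f) module)"
proof (rule abelian_groupI)
  show "\<exists>y\<in>carrier (basis_algebra B c). y \<oplus>\<^bsub>basis_algebra B c\<^esub> x = \<zero>\<^bsub>basis_algebra B c\<^esub>"
    if "x \<in> carrier (basis_algebra B c)" for x :: "'k \<Rightarrow>\<^sub>0 'f"
    using that by (auto intro!: exI[of _ "- x"])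
qed (auto simp: keys_add_subset add.assoc add.commute dest: subsetD[OF keys_add])

lemma (in partial_semigroup) scalar_rng_basis_algebra: "scalar_rng (basis_algebra B c)"
  unfolding scalar_rng_def scalar_rng_axioms_def
  using keys_lin_mult lin_mult_assoc order_trans[OF keys_map_scale]
  by (auto simp: abelian_group_basis_algebra lin_mult_add_left lin_mult_add_right
      map_scale_add lin_mult_scale_left lin_mult_scale_right del: subsetI)

lemma a_inv_basis_algebra:
  assumes "keys a \<subseteq> B"
  shows "\<ominus>\<^bsub>basis_algebra B c\<^esub> a = - a"
proof -
  interpret abelian_group "basis_algebra B c" by (rule abelian_group_basis_algebra)
  show ?thesis by (rule minus_equality) (use assms in auto)
qed

lemma basis_algebra_span:
  fixes B :: "'k set"
  shows "carrier (basis_algebra B c) \<subseteq>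
    additive_span (basis_algebra B c) {single p (k::'f::field) |p k. p \<in> B}"
proof
  fix a :: "'k \<Rightarrow>\<^sub>0 'f" assume "a \<in> carrier (basis_algebra B c)"
  then have "keys a \<subseteq> B" by simp
  then show "a \<in> additive_span (basis_algebra B c) {single p k |p k. p \<in> B}"
  proof (induction a rule: poly_mapping_additive_induct)
    case zero
    then show ?case using generate.one[of "add_monoid (basis_algebra B c)"] by simp
  next
    case (single p k)
    then show ?case by (auto intro: generate.incl)
  next
    case (add a b)
    then show ?case using generate.eng[of a "add_monoid (basis_algebra B c)" _ b] by simp
  qed
qed

section \<open>Additive maps out of an algebra on a basis, and gradings by degrees of basis
  elements\<close>

definition basis_extend :: "('m, 'r) ring_scheme \<Rightarrow> ('k \<Rightarrow> 'f::zero \<Rightarrow> 'm) \<Rightarrow> ('k \<Rightarrow>\<^sub>0 'f) \<Rightarrow> 'm" where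
  "basis_extend M \<theta> a = (\<Oplus>\<^bsub>M\<^esub>p\<in>keys a. \<theta> p (lookup a p))"

text \<open>\<open>\<theta> p k\<close> is the value prescribed on \<open>k p\<close>. Additivity in
  \<open>k\<close> takes the place of linearity, as the target is just an abelian group.\<close>

locale additive_family = abelian_group M for M (structure) +
  fixes \<theta> :: "'k \<Rightarrow> 'f::field \<Rightarrow> 'a"
  assumes \<theta>_closed [simp]: "\<theta> p k \<in> carrier M"
    and \<theta>_add: "\<theta> p (k + l) = \<theta> p k \<oplus> \<theta> p l"
begin

lemma \<theta>_zero [simp]: "\<theta> p 0 = \<zero>"
proof -
  have "\<theta> p 0 = \<theta> p 0 \<oplus> \<theta> p 0" using \<theta>_add[of p 0 0] by simp
  then show ?thesis by simp
qed

lemma basis_extend_supset: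
  assumes "finite P" "keys a \<subseteq> P"
  shows "basis_extend M \<theta> a = (\<Oplus>p\<in>P. \<theta> p (lookup a p))"
  unfolding basis_extend_def using assms
  by (intro add.finprod_mono_neutral_cong_left) (auto simp: in_keys_iff)

lemma basis_extend_add: "basis_extend M \<theta> (a + b) = basis_extend M \<theta> a \<oplus> basis_extend M \<theta> b"
  using keys_add[of a b]
  by (simp add: basis_extend_supset[where P="keys a \<union> keys b"]
      lookup_add \<theta>_add finsum_addf)

lemma basis_extend_single: "basis_extend M \<theta> (single p k) = \<theta> p k"
  by (subst basis_extend_supset[where P="{p}"]) (auto simp: finsum_insert[OF finite.emptyI])

lemma basis_extend_hom: "abelian_group_hom (basis_algebra B c) M (basis_extend M \<theta>)"
  by (rule abelian_group_hom_intro)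
    (auto simp: abelian_group_basis_algebra abelian_group_axioms basis_extend_add,
      auto simp: basis_extend_def intro!: finsum_closed)

end

text \<open>The degree is multiplicative on the partial product, so the spans of the basis elements
  of equal degree form a grading. It is applied to paths and to words.\<close>

lemma basis_algebra_grading:
  fixes B :: "'k set" and H :: "'g monoid"
  assumes "partial_semigroup B c" "group H" "\<And>p. p \<in> B \<Longrightarrow> deg p \<in> carrier H"
    and "\<And>p q r. p \<in> B \<Longrightarrow> q \<in> B \<Longrightarrow> c p q = Some r \<Longrightarrow> deg r = deg p \<otimes>\<^bsub>H\<^esub> deg q"
  shows "algebra_grading H (basis_algebra B c :: ('f::field, 'k \<Rightarrow>\<^sub>0 'f) module)
    (\<lambda>g. {a \<in> carrier (basis_algebra B c). \<forall>p\<in>keys a. deg p = g})"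
proof -
  let ?R = "basis_algebra B c :: ('f::field, 'k \<Rightarrow>\<^sub>0 'f) module"
  define D where "D = (\<lambda>g. {a \<in> carrier ?R. \<forall>p\<in>keys a. deg p = g})"
  interpret partial_semigroup B c by fact
  interpret scalar_rng ?R by (rule scalar_rng_basis_algebra)
  have sub: "additive_subgroup (D g) ?R" for g
    by (rule additive_subgroup_criterion)
      (auto simp: D_def a_inv_basis_algebra dest!: subsetD[OF keys_add])
  interpret subgroup_family ?R "carrier H" D
    using sub abelian_group_axioms by (simp add: subgroup_family_def subgroup_family_axioms_def)
  \<comment> \<open>The projection truncates the support to the basis elements of degree
    \<open>g\<close>.\<close>
  define \<pi> :: "'g \<Rightarrow> ('k \<Rightarrow>\<^sub>0 'f) \<Rightarrow> ('k \<Rightarrow>\<^sub>0 'f)"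
    where "\<pi> = (\<lambda>g. Poly_Mapping.mapp (\<lambda>p k. if deg p = g then k else 0))"
  have lookup_\<pi>: "lookup (\<pi> g a) p = (if deg p = g then lookup a p else 0)" for g a p
    by (simp add: \<pi>_def lookup_mapp when_def in_keys_iff)
  have single_D: "single p k \<in> D (deg p)" if "p \<in> B" for p k
    using that by (simp add: D_def)
  have "direct_sum_decomp ?R (carrier H) D"
  proof (rule direct_sum_decompI)
    have "{single p k |p k. p \<in> B} \<subseteq> additive_span ?R (\<Union>g\<in>carrier H. D g)"
      using single_D assms(3) by (auto intro!: generate.incl)
    then have "additive_span ?R {single p k |p k. p \<in> B}
        \<subseteq> additive_span ?R (\<Union>g\<in>carrier H. D g)"
      by (intro additive_span_minimal additive_subgroup_span Union_carrier)
    with basis_algebra_span show "carrier ?R \<subseteq> additive_span ?R (\<Union>g\<in>carrier H. D g)"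
      by (rule subset_trans)
    have "abelian_group_hom ?R ?R (\<pi> g)" for g
    proof (rule abelian_group_hom_intro)
      show "\<pi> g \<in> carrier ?R \<rightarrow> carrier ?R"
        using keys_mapp_subset by (fastforce simp: \<pi>_def)
      show "\<pi> g (x \<oplus>\<^bsub>?R\<^esub> y) = \<pi> g x \<oplus>\<^bsub>?R\<^esub> \<pi> g y" for x y
        by (simp, rule poly_mapping_eqI) (simp add: lookup_\<pi> lookup_add)
    qed (rule abelian_group_axioms)+
    moreover have "\<pi> g y = y" if "y \<in> D g" for g y
      using that by (intro poly_mapping_eqI) (auto simp: lookup_\<pi> D_def in_keys_iff)
    moreover have "\<pi> g y = 0" if "y \<in> D h" "h \<noteq> g" for g h y
      using that by (intro poly_mapping_eqI) (auto simp: lookup_\<pi> D_def in_keys_iff)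
    ultimately show "component_maps ?R (carrier H) D \<pi>"
      by (simp add: component_maps_def)
  qed
  moreover have "alg_subspace ?R (D g)" for g
    unfolding alg_subspace_def using sub keys_map_scale
    by (auto simp: D_def dest!: subsetD[OF keys_map_scale])
  moreover have "lin_mult c x y \<in> D (g \<otimes>\<^bsub>H\<^esub> h)" if "x \<in> D g" "y \<in> D h" for g h x y
  proof -
    have xy: "keys x \<subseteq> B \<inter> {p. deg p = g}" "keys y \<subseteq> B \<inter> {p. deg p = h}"
      using that by (auto simp: D_def)
    interpret K: additive_subgroup "D (g \<otimes>\<^bsub>H\<^esub> h)" ?R by (rule sub)
    have "lin_mult c (single p k) y \<in> D (g \<otimes>\<^bsub>H\<^esub> h)" if p: "p \<in> B \<inter> {p. deg p = g}" for p k
      using xy(2)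
    proof (induction y rule: poly_mapping_additive_induct)
      case (single q l)
      then show ?case
        using p assms(4)[of p q] comp_closed[of p q]
        by (cases "c p q") (auto simp: lin_mult_single basis_prod_def D_def)
    qed (use K.zero_closed K.a_closed in \<open>auto simp: lin_mult_add_right\<close>)
    with xy(1) show ?thesis
      using K.zero_closed K.a_closed
      by (induction x rule: poly_mapping_additive_induct) (auto simp: lin_mult_add_left)
  qed
  ultimately show ?thesis
    unfolding algebra_grading_def D_def[symmetric] by simp
qed

section \<open>Unital modules and projectivity\<close>

text \<open>Restriction of scalars replaces only \<open>smult\<close>, but the new record has
  another type. Notions that depend on the additive structure alone are carried over through the
  three fields assumed equal here.\<close>

context
  fixes M :: "('m, 'r) ring_scheme" and N :: "('m, 's) ring_scheme"
  assumes same_carrier: "carrier N = carrier M"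
    and same_add: "add N = add M"
    and same_zero: "zero N = zero M"
begin

lemma m_inv_add_monoid_cong: "m_inv (add_monoid N) = m_inv (add_monoid M)"
  by (intro ext) (simp add: m_inv_def same_carrier same_add same_zero)

lemma additive_span_cong: "additive_span N S = additive_span M S"
proof (intro subset_antisym subsetI)
  show "x \<in> additive_span M S" if "x \<in> additive_span N S" for x
    using that
  proof (induction rule: generate.induct)
    case (eng a b)
    then show ?case using generate.eng[of a "add_monoid M" S b] by (simp add: same_add)
  next
    case one
    then show ?case using generate.one[of "add_monoid M"] by (simp add: same_zero)
  qed (auto simp: m_inv_add_monoid_cong intro: generate.incl generate.inv)
  show "x \<in> additive_span N S" if "x \<in> additive_span M S" for x
    using that
  proof (induction rule: generate.induct)
    case (eng a b)
    then show ?case using generate.eng[of a "add_monoid N" S b] by (simp add: same_add)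
  next
    case one
    then show ?case using generate.one[of "add_monoid N"] by (simp add: same_zero)
  next
    case (inv h)
    then show ?case using generate.inv[of h S "add_monoid N"] by (simp add: m_inv_add_monoid_cong)
  qed (auto intro: generate.incl)
qed

lemma finsum_same: "finsum N f A = finsum M f A"
  by (simp add: finsum_def finprod_def same_carrier same_add same_zero)

lemma additive_subgroup_cong: "additive_subgroup K N \<longleftrightarrow> additive_subgroup K M"
  unfolding additive_subgroup_def subgroup_def m_inv_add_monoid_cong
  by (simp add: same_carrier same_add same_zero)

lemma direct_sum_decomp_cong: "direct_sum_decomp N S D \<longleftrightarrow> direct_sum_decomp M S D"
  by (simp add: direct_sum_decomp_def additive_subgroup_cong finsum_same same_carrier same_zero)

lemma abelian_group_cong:
  assumes "abelian_group M"
  shows "abelian_group N"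
proof -
  interpret abelian_group M by fact
  show ?thesis
    by (rule abelian_groupI)
      (auto simp: same_carrier same_add same_zero a_ac intro: l_neg a_inv_closed)
qed

end

lemma a_kernel_cong:
  assumes "carrier M' = carrier M" "zero N' = zero N"
  shows "a_kernel M' N' h = a_kernel M N h"
  using assms by (simp add: a_kernel_def kernel_def)

lemma unital_left_moduleD:
  assumes "unital_left_module A M"
  shows "abelian_group M"
    and "\<And>a x. a \<in> carrier A \<Longrightarrow> x \<in> carrier M \<Longrightarrow> a \<odot>\<^bsub>M\<^esub> x \<in> carrier M"
    and "\<And>a b x. a \<in> carrier A \<Longrightarrow> b \<in> carrier A \<Longrightarrow> x \<in> carrier M \<Longrightarrow>
      (a \<oplus>\<^bsub>A\<^esub> b) \<odot>\<^bsub>M\<^esub> x = a \<odot>\<^bsub>M\<^esub> x \<oplus>\<^bsub>M\<^esub> b \<odot>\<^bsub>M\<^esub> x"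
    and "\<And>a x y. a \<in> carrier A \<Longrightarrow> x \<in> carrier M \<Longrightarrow> y \<in> carrier M \<Longrightarrow>
      a \<odot>\<^bsub>M\<^esub> (x \<oplus>\<^bsub>M\<^esub> y) = a \<odot>\<^bsub>M\<^esub> x \<oplus>\<^bsub>M\<^esub> a \<odot>\<^bsub>M\<^esub> y"
    and "\<And>a b x. a \<in> carrier A \<Longrightarrow> b \<in> carrier A \<Longrightarrow> x \<in> carrier M \<Longrightarrow>
      (a \<otimes>\<^bsub>A\<^esub> b) \<odot>\<^bsub>M\<^esub> x = a \<odot>\<^bsub>M\<^esub> (b \<odot>\<^bsub>M\<^esub> x)"
  using assms by (simp_all add: unital_left_module_def)

lemma module_action_hom:
  assumes "unital_left_module A M" "a \<in> carrier A"
  shows "abelian_group_hom M M (\<lambda>x. a \<odot>\<^bsub>M\<^esub> x)"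
  using unital_left_moduleD[OF assms(1)] assms(2) by (intro abelian_group_hom_intro) auto

lemma module_orbit_hom:
  assumes "unital_left_module A M" "abelian_group A" "x \<in> carrier M"
  shows "abelian_group_hom A M (\<lambda>a. a \<odot>\<^bsub>M\<^esub> x)"
  using unital_left_moduleD[OF assms(1)] assms(2,3) by (intro abelian_group_hom_intro) auto

lemma left_module_hom_abelian_group_hom:
  assumes "unital_left_module A M" "unital_left_module A N" "f \<in> left_module_hom A M N"
  shows "abelian_group_hom M N f"
  using unital_left_moduleD(1)[OF assms(1)] unital_left_moduleD(1)[OF assms(2)] assms(3)
  by (intro abelian_group_hom_intro) (auto simp: left_module_hom_def)

text \<open>The hypotheses make \<open>P\<close> behave like a direct sum of modules
  \<open>A e\<close>, one for each generator: a homomorphism out of \<open>A e\<close> amounts to an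
  element \<open>m\<close> with \<open>e m = m\<close>. In \<open>ext\<close> only an additive map
  with the right values on the elements \<open>a b\<close> is asked for; it commutes with
  \<open>A\<close> because these elements span \<open>P\<close>. To lift \<open>f\<close> along
  \<open>g\<close> it is then enough to lift the images of the generators.\<close>

lemma projective_left_moduleI:
  fixes A :: "('a, 'r) ring_scheme" and P :: "('a, 'p) module"
  assumes P: "unital_left_module A P"
    and A_mult: "\<And>a b. a \<in> carrier A \<Longrightarrow> b \<in> carrier A \<Longrightarrow> a \<otimes>\<^bsub>A\<^esub> b \<in> carrier A"
    and gen: "\<And>i. i \<in> I \<Longrightarrow> b i \<in> carrier P"
    and idem: "\<And>i. i \<in> I \<Longrightarrow> e i \<in> carrier A" "\<And>i. i \<in> I \<Longrightarrow> e i \<otimes>\<^bsub>A\<^esub> e i = e i"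
    and eb: "\<And>i. i \<in> I \<Longrightarrow> e i \<odot>\<^bsub>P\<^esub> b i = b i"
    and span: "carrier P \<subseteq> additive_span P {a \<odot>\<^bsub>P\<^esub> b i |a i. a \<in> carrier A \<and> i \<in> I}"
    and ext: "\<And>(M :: ('a, 'm) module) m. unital_left_module A M \<Longrightarrow>
      (\<And>i. i \<in> I \<Longrightarrow> m i \<in> carrier M) \<Longrightarrow> (\<And>i. i \<in> I \<Longrightarrow> e i \<odot>\<^bsub>M\<^esub> m i = m i) \<Longrightarrow>
      \<exists>h. abelian_group_hom P M h \<and> (\<forall>a\<in>carrier A. \<forall>i\<in>I. h (a \<odot>\<^bsub>P\<^esub> b i) = a \<odot>\<^bsub>M\<^esub> m i)"
  shows "projective_left_module A P TYPE('m) TYPE('n)"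
  unfolding projective_left_module_def
proof (intro conjI allI impI P, elim conjE)
  fix M :: "('a, 'm) module" and N :: "('a, 'n) module" and g f
  assume M: "unital_left_module A M" and N: "unital_left_module A N"
    and g: "g \<in> left_module_hom A M N" and surj: "g ` carrier M = carrier N"
    and f: "f \<in> left_module_hom A P N"
  interpret g: abelian_group_hom M N g by (rule left_module_hom_abelian_group_hom[OF M N g])
  interpret f: abelian_group_hom P N f by (rule left_module_hom_abelian_group_hom[OF P N f])
  note MD = unital_left_moduleD[OF M] and PD = unital_left_moduleD[OF P]
  have "\<exists>x\<in>carrier M. g x = f (b i)" if "i \<in> I" for i
  proof -
    have "f (b i) \<in> g ` carrier M" unfolding surj using gen[OF that] by simp
    then show ?thesis by auto
  qed
  then obtain x where x: "\<And>i. i \<in> I \<Longrightarrow> x i \<in> carrier M" "\<And>i. i \<in> I \<Longrightarrow> g (x i) = f (b i)"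
    by metis
  \<comment> \<open>The preimage \<open>x i\<close> need not be fixed by \<open>e i\<close>.
    Multiplication by the idempotent makes it so, and preserves the image \<open>f (b i)\<close>
    because \<open>e i\<close> fixes \<open>b i\<close>.\<close>
  define m where "m = (\<lambda>i. e i \<odot>\<^bsub>M\<^esub> x i)"
  have m: "m i \<in> carrier M" "e i \<odot>\<^bsub>M\<^esub> m i = m i" if "i \<in> I" for i
    using x(1) idem that MD(2) MD(5)[of "e i" "e i" "x i"] by (simp_all add: m_def)
  have gm: "g (m i) = f (b i)" if "i \<in> I" for i
  proof -
    have "g (m i) = e i \<odot>\<^bsub>N\<^esub> g (x i)"
      using g x(1) idem(1) that by (simp add: m_def left_module_hom_def)
    also have "\<dots> = f (e i \<odot>\<^bsub>P\<^esub> b i)"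
      using f x(2) gen idem(1) that by (simp add: left_module_hom_def)
    finally show ?thesis using eb that by simp
  qed
  obtain h where h: "abelian_group_hom P M h"
      "\<And>a i. a \<in> carrier A \<Longrightarrow> i \<in> I \<Longrightarrow> h (a \<odot>\<^bsub>P\<^esub> b i) = a \<odot>\<^bsub>M\<^esub> m i"
    using ext[OF M m] by blast
  interpret h: abelian_group_hom P M h by fact
  let ?S = "{a \<odot>\<^bsub>P\<^esub> b i |a i. a \<in> carrier A \<and> i \<in> I}"
  have S: "?S \<subseteq> carrier P" using PD(2) gen by auto
  have "h (c \<odot>\<^bsub>P\<^esub> y) = c \<odot>\<^bsub>M\<^esub> h y" if c: "c \<in> carrier A" and y: "y \<in> carrier P" for c y
  proof (rule additive_span_hom_eq[OF _ _ S])
    show "abelian_group_hom P M (\<lambda>y. h (c \<odot>\<^bsub>P\<^esub> y))"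
      by (rule abelian_group_hom_compose[OF module_action_hom[OF P c] h(1)])
    show "abelian_group_hom P M (\<lambda>y. c \<odot>\<^bsub>M\<^esub> h y)"
      by (rule abelian_group_hom_compose[OF h(1) module_action_hom[OF M c]])
    show "h (c \<odot>\<^bsub>P\<^esub> z) = c \<odot>\<^bsub>M\<^esub> h z" if z: "z \<in> ?S" for z
    proof -
      obtain a i where ai: "a \<in> carrier A" "i \<in> I" "z = a \<odot>\<^bsub>P\<^esub> b i" using z by auto
      then have "h (c \<odot>\<^bsub>P\<^esub> z) = h ((c \<otimes>\<^bsub>A\<^esub> a) \<odot>\<^bsub>P\<^esub> b i)"
        using PD(5) c gen by simp
      also have "\<dots> = c \<odot>\<^bsub>M\<^esub> h z"
        using ai c A_mult h(2) MD(5) m by simp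
      finally show ?thesis .
    qed
  qed (use span y in auto)
  then have "h \<in> left_module_hom A P M"
    by (auto simp: left_module_hom_def)
  moreover have "g (h y) = f y" if y: "y \<in> carrier P" for y
  proof (rule additive_span_hom_eq[OF _ _ S])
    show "abelian_group_hom P N (\<lambda>y. g (h y))"
      by (rule abelian_group_hom_compose[OF h(1) g.abelian_group_hom_axioms])
    show "abelian_group_hom P N f" by (rule f.abelian_group_hom_axioms)
    show "g (h z) = f z" if z: "z \<in> ?S" for z
    proof -
      obtain a i where ai: "a \<in> carrier A" "i \<in> I" "z = a \<odot>\<^bsub>P\<^esub> b i" using z by auto
      then show ?thesis
        using h(2) m gm gen f g by (simp add: left_module_hom_def)
    qed
  qed (use span y in auto)
  ultimately show "\<exists>h\<in>left_module_hom A P M. \<forall>x\<in>carrier P. g (h x) = f x" by blast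
qed

section \<open>Restriction of scalars along a homomorphism\<close>

locale rng_hom =
  S: scalar_rng A + R: scalar_rng R
  for A :: "('f::field, 'a) module" and R :: "('f, 'b) module" +
  fixes \<phi> :: "'a \<Rightarrow> 'b"
  assumes \<phi>_hom: "abelian_group_hom A R \<phi>"
    and \<phi>_mult: "a \<in> carrier A \<Longrightarrow> b \<in> carrier A \<Longrightarrow> \<phi> (a \<otimes>\<^bsub>A\<^esub> b) = \<phi> a \<otimes>\<^bsub>R\<^esub> \<phi> b"
begin

sublocale \<phi>: abelian_group_hom A R \<phi> by (rule \<phi>_hom)

text \<open>The carrier is a parameter, so that the Cohn algebra, the kernel and the Leavitt algebra
  become modules by one construction.\<close>

definition submodule :: "'b set \<Rightarrow> ('a, 'b) module" where
  "submodule K = (restrict_scalars \<phi> R)\<lparr>carrier := K\<rparr>"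

lemma submodule_simps [simp]:
  "carrier (submodule K) = K" "add (submodule K) = add R" "zero (submodule K) = zero R"
  "smult (submodule K) = (\<lambda>a x. \<phi> a \<otimes>\<^bsub>R\<^esub> x)"
  by (simp_all add: submodule_def restrict_scalars_def)

lemma submodule_carrier: "submodule (carrier R) = restrict_scalars \<phi> R"
  by (simp add: submodule_def restrict_scalars_def)

context
  fixes K
  assumes K: "additive_subgroup K R"
begin

interpretation K: additive_subgroup K R by (rule K)

lemma abelian_group_submodule: "abelian_group (submodule K)"
  by (rule abelian_group_cong[OF _ _ _ abelian_group_restrict[OF R.abelian_group_axioms K]]) simp_all

lemma additive_span_submodule:
  assumes "S \<subseteq> K"
  shows "additive_span (submodule K) S = additive_span R S"
proof -
  have "additive_span (submodule K) S = additive_span (R\<lparr>carrier := K\<rparr>) S"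
    by (rule additive_span_cong) simp_all
  also have "generate (add_monoid R\<lparr>carrier := K\<rparr>) S = additive_span R S"
    by (rule R.add.generate_consistent) (use assms K.a_subgroup in auto)
  then have "additive_span (R\<lparr>carrier := K\<rparr>) S = additive_span R S" by simp
  finally show ?thesis .
qed

lemma unital_submodule:
  assumes "\<And>a x. a \<in> carrier A \<Longrightarrow> x \<in> K \<Longrightarrow> \<phi> a \<otimes>\<^bsub>R\<^esub> x \<in> K"
    and "K \<subseteq> additive_span R {\<phi> a \<otimes>\<^bsub>R\<^esub> x |a x. a \<in> carrier A \<and> x \<in> K}"
  shows "unital_left_module A (submodule K)"
proof -
  let ?S = "{\<phi> a \<otimes>\<^bsub>R\<^esub> x |a x. a \<in> carrier A \<and> x \<in> K}"
  have sub: "?S \<subseteq> K" using assms(1) by auto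
  have "additive_span R ?S \<subseteq> K" by (rule R.additive_span_minimal[OF K sub])
  with assms(2) have "additive_span R ?S = K" by blast
  then have "additive_span (submodule K) ?S = K"
    using additive_span_submodule[OF sub] by simp
  then show ?thesis
    unfolding unital_left_module_def
    using assms(1) abelian_group_submodule K.a_Hcarr
    by (simp add: R.mult_add_left R.mult_add_right R.mult_assoc \<phi>_mult)
qed

lemma direct_sum_decomp_submodule:
  "direct_sum_decomp (submodule K) S D \<longleftrightarrow> direct_sum_decomp (R\<lparr>carrier := K\<rparr>) S D"
  by (rule direct_sum_decomp_cong) simp_all

end

end

section \<open>Paths and normal forms of words\<close>

locale path_digraph = wf_digraph \<Gamma> for \<Gamma> :: "('v, 'e) pre_digraph" +
  fixes scalars :: "'f::field itself"  \<comment> \<open>only to fix the type \<open>'f\<close>\<close>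
begin

definition src :: "'e list \<Rightarrow> 'v \<Rightarrow> 'v" where
  "src \<alpha> v = (case \<alpha> of [] \<Rightarrow> v | e # _ \<Rightarrow> tail \<Gamma> e)"

lemma src_simps [simp]: "src [] v = v" "src (e # \<alpha>) v = tail \<Gamma> e"
  by (simp_all add: src_def)

text \<open>Paths are described by their arrows and their target rather than their source:
  multiplication from the left adds or removes initial arrows, and the target is what stays fixed.
  \<open>awalk_iff\<close> gives the translation.\<close>

primrec path_to :: "'e list \<Rightarrow> 'v \<Rightarrow> bool" where
  "path_to [] v \<longleftrightarrow> v \<in> verts \<Gamma>"
| "path_to (e # \<alpha>) v \<longleftrightarrow> e \<in> arcs \<Gamma> \<and> head \<Gamma> e = src \<alpha> v \<and> path_to \<alpha> v"

lemma path_to_verts: "path_to \<alpha> v \<Longrightarrow> v \<in> verts \<Gamma>" "path_to \<alpha> v \<Longrightarrow> src \<alpha> v \<in> verts \<Gamma>"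
  by (induction \<alpha>) auto

lemma path_to_arcs: "path_to \<alpha> v \<Longrightarrow> set \<alpha> \<subseteq> arcs \<Gamma>"
  by (induction \<alpha>) auto

lemma path_to_snoc: "path_to (\<alpha> @ [e]) v \<longleftrightarrow> path_to \<alpha> (tail \<Gamma> e) \<and> e \<in> arcs \<Gamma> \<and> head \<Gamma> e = v"
  by (induction \<alpha>) (auto simp: src_def split: list.splits)

lemma src_append: "src (\<alpha> @ \<beta>) v = src \<alpha> (src \<beta> v)"
  by (cases \<alpha>) auto

lemma path_to_append: "path_to \<alpha> (src \<beta> v) \<Longrightarrow> path_to \<beta> v \<Longrightarrow> path_to (\<alpha> @ \<beta>) v"
  by (induction \<alpha>) (auto simp: src_append)

lemma awalk_iff: "awalk u p w \<longleftrightarrow> path_to p w \<and> u = src p w"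
proof (induction p arbitrary: u)
  case Nil
  then show ?case by (auto simp: awalk_Nil_iff)
next
  case (Cons e p)
  then show ?case by (auto simp: awalk_Cons_iff)
qed

lemma paths_iff: "(u, p) \<in> paths \<Gamma> \<longleftrightarrow> (\<exists>w. path_to p w \<and> u = src p w)"
  by (simp add: paths_def awalk_iff)

lemma pathsE:
  assumes "x \<in> paths \<Gamma>"
  obtains p w where "x = (src p w, p)" "path_to p w"
  using assms by (cases x) (auto simp: paths_iff)

lemma path_comp_eq:
  assumes "path_to p w"
  shows "path_comp \<Gamma> (src p w, p) (v, q) = (if w = v then Some (src p w, p @ q) else None)"
proof -
  have "awalk (src p w) p w" using assms by (simp add: awalk_iff)
  then have "awlast (src p w) p = w" by auto
  then show ?thesis by (simp add: path_comp_def)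
qed

lemma partial_semigroup_paths: "partial_semigroup (paths \<Gamma>) (path_comp \<Gamma>)"
proof
  fix x y z assume x: "x \<in> paths \<Gamma>" and y: "y \<in> paths \<Gamma>"
  obtain p v where p: "x = (src p v, p)" "path_to p v" using pathsE[OF x] .
  obtain q w where q: "y = (src q w, q)" "path_to q w" using pathsE[OF y] .
  show "z \<in> paths \<Gamma>" if "path_comp \<Gamma> x y = Some z"
  proof -
    have "src q w = v" "z = (src p v, p @ q)"
      using that p q by (auto simp: path_comp_eq split: if_splits)
    then show ?thesis using p q by (auto simp: paths_iff src_append intro!: exI[of _ w] path_to_append)
  qed
  assume z: "z \<in> paths \<Gamma>"
  obtain r t where r: "z = (src r t, r)" "path_to r t" using pathsE[OF z] .
  show "Option.bind (path_comp \<Gamma> x y) (\<lambda>s. path_comp \<Gamma> s z) = Option.bind (path_comp \<Gamma> y z) (path_comp \<Gamma> x)"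
  proof (cases "v = src q w")
    case True
    then have "path_to (p @ q) w" using p q by (intro path_to_append) auto
    from path_comp_eq[OF this] show ?thesis
      using True p q r by (cases "w = src r t") (auto simp: path_comp_eq src_append)
  next
    \<comment> \<open>Neither bracketing is defined here, whatever the third path is.\<close>
    case False
    then show ?thesis using p q r by (auto simp: path_comp_eq)
  qed
qed

abbreviation path_elem :: "'e list \<Rightarrow> 'v \<Rightarrow> 'f \<Rightarrow> ('v, 'e, 'f) path_elt" where
  "path_elem \<alpha> v k \<equiv> single (src \<alpha> v, \<alpha>) k"

abbreviation A :: "('f, ('v, 'e, 'f) path_elt) module" where "A \<equiv> path_algebra \<Gamma>"

sublocale A: scalar_rng A
  unfolding path_algebra_def
  by (rule partial_semigroup.scalar_rng_basis_algebra[OF partial_semigroup_paths])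

section \<open>The free algebra and its quotient, the Cohn path algebra\<close>

abbreviation \<F> :: "('f, ('v, 'e, 'f) free_elt) module" where "\<F> \<equiv> free_algebra \<Gamma>"

definition is_word :: "('v, 'e) gen list \<Rightarrow> bool" where
  "is_word w \<longleftrightarrow> w \<noteq> [] \<and> set w \<subseteq> gens \<Gamma>"

lemma partial_semigroup_words:
  "partial_semigroup {w. w \<noteq> [] \<and> set w \<subseteq> gens \<Gamma>} (\<lambda>w w'. Some (w @ w'))"
  by standard auto

sublocale F: scalar_rng \<F>
  unfolding free_algebra_def
  by (rule partial_semigroup.scalar_rng_basis_algebra[OF partial_semigroup_words])

lemma free_simps [simp]:
  "carrier \<F> = {a. \<forall>w\<in>keys a. is_word w}"
  "mult \<F> = lin_mult (\<lambda>w w'. Some (w @ w'))"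
  "add \<F> = (+)" "zero \<F> = 0" "smult \<F> = (\<lambda>k. Poly_Mapping.map ((*) k))"
  by (auto simp: free_algebra_def is_word_def)

lemma is_word_append: "is_word u \<Longrightarrow> is_word w \<Longrightarrow> is_word (u @ w)"
  by (auto simp: is_word_def)

lemma gens_iff [simp]:
  "Vtx v \<in> gens \<Gamma> \<longleftrightarrow> v \<in> verts \<Gamma>" "Arr e \<in> gens \<Gamma> \<longleftrightarrow> e \<in> arcs \<Gamma>" "Gst e \<in> gens \<Gamma> \<longleftrightarrow> e \<in> arcs \<Gamma>"
  by (auto simp: gens_def)

lemma cohn_relators_cases:
  fixes x :: "('v, 'e, 'f) free_elt"
  assumes "x \<in> cohn_relators \<Gamma>"
  obtains
    v w where "x = word [Vtx v, Vtx w] - (if v = w then word [Vtx v] else 0)"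
      "v \<in> verts \<Gamma>" "w \<in> verts \<Gamma>"
  | y where "x = word [Vtx (gen_source \<Gamma> y), y] - word [y]" "y \<in> Arr ` arcs \<Gamma> \<union> Gst ` arcs \<Gamma>"
  | y where "x = word [y, Vtx (gen_target \<Gamma> y)] - word [y]" "y \<in> Arr ` arcs \<Gamma> \<union> Gst ` arcs \<Gamma>"
  | e f where "x = word [Gst e, Arr f] - (if e = f then word [Vtx (head \<Gamma> e)] else 0)"
      "e \<in> arcs \<Gamma>" "f \<in> arcs \<Gamma>"
  using assms unfolding cohn_relators_def by blast

lemma cohn_relators_closed: "(cohn_relators \<Gamma> :: ('v, 'e, 'f) free_elt set) \<subseteq> carrier \<F>"
proof
  have diff: "a - b \<in> carrier \<F>" if "a \<in> carrier \<F>" "b \<in> carrier \<F>" for a b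
    using that keys_diff[of a b] by auto
  fix x :: "('v, 'e, 'f) free_elt" assume "x \<in> cohn_relators \<Gamma>"
  then show "x \<in> carrier \<F>"
  proof (cases rule: cohn_relators_cases)
    case 1
    then show ?thesis by (simp only:) (rule diff; auto simp: is_word_def)
  next
    case 2
    then show ?thesis by (simp only:) (rule diff; auto simp: is_word_def)
  next
    case 3
    then show ?thesis by (simp only:) (rule diff; auto simp: is_word_def)
  next
    case 4
    then show ?thesis by (simp only:) (rule diff; auto simp: is_word_def)
  qed
qed

sublocale FI: scalar_rng_ideal \<F> "cohn_ideal \<Gamma>"
  unfolding scalar_rng_ideal_def scalar_rng_ideal_axioms_def cohn_ideal_def
  using F.alg_ideal_alg_ideal_gen[OF cohn_relators_closed] F.scalar_rng_axioms by simp

abbreviation C :: "('f, ('v, 'e, 'f) cohn_elt) module" where "C \<equiv> cohn_algebra \<Gamma>"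

sublocale C: scalar_rng C
  unfolding cohn_algebra_def by (rule FI.scalar_rng_quotient)

abbreviation cohn_mult (infixl \<open>\<cdot>\<close> 70) where "x \<cdot> y \<equiv> x \<otimes>\<^bsub>C\<^esub> y"

abbreviation cls :: "('v, 'e, 'f) free_elt \<Rightarrow> ('v, 'e, 'f) cohn_elt" where "cls \<equiv> cohn_class \<Gamma>"

lemma cls_hom: "abelian_group_hom \<F> C cls"
  using FI.coset_hom unfolding cohn_algebra_def cohn_class_def .

sublocale cls: abelian_group_hom \<F> C cls by (rule cls_hom)

lemma carrier_cohn: "carrier C = cls ` carrier \<F>"
  using FI.carrier_quotient unfolding cohn_algebra_def cohn_class_def .

lemma cls_mult: "x \<in> carrier \<F> \<Longrightarrow> y \<in> carrier \<F> \<Longrightarrow> cls (x \<otimes>\<^bsub>\<F>\<^esub> y) = cls x \<cdot> cls y"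
  using FI.coset_mult unfolding cohn_algebra_def cohn_class_def by simp

lemma cls_scale: "x \<in> carrier \<F> \<Longrightarrow> cls (Poly_Mapping.map ((*) k) x) = k \<odot>\<^bsub>C\<^esub> cls x"
  using FI.coset_scale unfolding cohn_algebra_def cohn_class_def by simp

abbreviation mono :: "('v, 'e) gen list \<Rightarrow> ('v, 'e, 'f) cohn_elt" where
  "mono w \<equiv> cls (word w)"

lemma single_closed [simp]: "is_word w \<Longrightarrow> single w k \<in> carrier \<F>"
  by simp

lemma mono_closed [simp]: "is_word w \<Longrightarrow> cls (single w k) \<in> carrier C"
  by (rule cls.hom_closed) simp

lemma cls_single: "is_word w \<Longrightarrow> cls (single w k) = k \<odot>\<^bsub>C\<^esub> mono w"
  using cls_scale[of "word w" k] by (simp add: map_scale_single)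

lemma mono_append:
  assumes "is_word u" "is_word w"
  shows "cls (single u k) \<cdot> cls (single w l) =
    cls (single (u @ w) (k * l))"
  using cls_mult[of "single u k" "single w l"] assms
  by (simp add: lin_mult_single basis_prod_def)

lemma cohn_span: "carrier C \<subseteq> additive_span C {cls (single w k) |w k. is_word w}"
proof
  let ?S = "{cls (single w k) |w k. is_word w}"
  have S: "?S \<subseteq> carrier C" using mono_closed by blast
  fix x assume "x \<in> carrier C"
  then obtain a where a: "a \<in> carrier \<F>" "x = cls a" using carrier_cohn by auto
  have "cls a \<in> additive_span C ?S"
  proof (rule cls.additive_span_hom[of "{single w k |w k. is_word w}"])
    show "{single w k |w k. is_word w} \<subseteq> carrier \<F>"
      by (auto split: if_splits)
    show "additive_subgroup (additive_span C ?S) C" by (rule C.additive_subgroup_span[OF S])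
    have "{w. w \<noteq> [] \<and> set w \<subseteq> gens \<Gamma>} = {w. is_word w}" by (auto simp: is_word_def)
    then show "a \<in> additive_span \<F> {single w k |w k. is_word w}"
      using subsetD[OF basis_algebra_span, of a "{w. is_word w}"] a(1) unfolding free_algebra_def by auto
  qed (auto intro!: generate.incl split: if_splits)
  with a(2) show "x \<in> additive_span C ?S" by simp
qed

lemma relator_eq:
  fixes x y :: "('v, 'e, 'f) free_elt"
  assumes "x - y \<in> cohn_relators \<Gamma>" "x \<in> carrier \<F>" "y \<in> carrier \<F>"
  shows "cls x = cls y"
proof -
  have "\<ominus>\<^bsub>\<F>\<^esub> y = - y"
    using a_inv_basis_algebra[of y] assms(3) unfolding free_algebra_def by simp
  moreover have "x - y \<in> cohn_ideal \<Gamma>"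
    using assms(1) F.alg_ideal_gen_incl unfolding cohn_ideal_def by blast
  ultimately show ?thesis
    using FI.coset_eq_iff[OF assms(2,3)] unfolding cohn_class_def by simp
qed

lemma cohn_relations:
  "v \<in> verts \<Gamma> \<Longrightarrow> w \<in> verts \<Gamma> \<Longrightarrow> mono [Vtx v, Vtx w] = (if v = w then mono [Vtx v] else \<zero>\<^bsub>C\<^esub>)"
  "x \<in> Arr ` arcs \<Gamma> \<union> Gst ` arcs \<Gamma> \<Longrightarrow> mono [Vtx (gen_source \<Gamma> x), x] = mono [x]"
  "x \<in> Arr ` arcs \<Gamma> \<union> Gst ` arcs \<Gamma> \<Longrightarrow> mono [x, Vtx (gen_target \<Gamma> x)] = mono [x]"
  "e \<in> arcs \<Gamma> \<Longrightarrow> f \<in> arcs \<Gamma> \<Longrightarrow>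
    mono [Gst e, Arr f] = (if e = f then mono [Vtx (head \<Gamma> e)] else \<zero>\<^bsub>C\<^esub>)"
proof -
  have zero: "cls 0 = \<zero>\<^bsub>C\<^esub>" using cls.hom_zero by simp
  show "mono [Vtx v, Vtx w] = (if v = w then mono [Vtx v] else \<zero>\<^bsub>C\<^esub>)"
    if "v \<in> verts \<Gamma>" "w \<in> verts \<Gamma>"
  proof -
    have "mono [Vtx v, Vtx w] = cls (if v = w then word [Vtx v] else 0)"
    proof (rule relator_eq)
      show "word [Vtx v, Vtx w] - (if v = w then word [Vtx v] else 0) \<in> cohn_relators \<Gamma>"
        using that unfolding cohn_relators_def by blast
    qed (use that in \<open>auto simp: is_word_def\<close>)
    then show ?thesis by (simp add: zero split: if_splits)
  qed
  show "mono [Vtx (gen_source \<Gamma> x), x] = mono [x]" if "x \<in> Arr ` arcs \<Gamma> \<union> Gst ` arcs \<Gamma>"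
  proof (rule relator_eq)
    show "word [Vtx (gen_source \<Gamma> x), x] - word [x] \<in> cohn_relators \<Gamma>"
      using that unfolding cohn_relators_def by blast
  qed (use that in \<open>auto simp: is_word_def\<close>)
  show "mono [x, Vtx (gen_target \<Gamma> x)] = mono [x]" if "x \<in> Arr ` arcs \<Gamma> \<union> Gst ` arcs \<Gamma>"
  proof (rule relator_eq)
    show "word [x, Vtx (gen_target \<Gamma> x)] - word [x] \<in> cohn_relators \<Gamma>"
      using that unfolding cohn_relators_def by blast
  qed (use that in \<open>auto simp: is_word_def\<close>)
  show "mono [Gst e, Arr f] = (if e = f then mono [Vtx (head \<Gamma> e)] else \<zero>\<^bsub>C\<^esub>)"
    if "e \<in> arcs \<Gamma>" "f \<in> arcs \<Gamma>"
  proof -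
    have "mono [Gst e, Arr f] = cls (if e = f then word [Vtx (head \<Gamma> e)] else 0)"
    proof (rule relator_eq)
      show "word [Gst e, Arr f] - (if e = f then word [Vtx (head \<Gamma> e)] else 0) \<in> cohn_relators \<Gamma>"
        using that unfolding cohn_relators_def by blast
    qed (use that in \<open>auto simp: is_word_def\<close>)
    then show ?thesis by (simp add: zero split: if_splits)
  qed
qed

end

text \<open>
  \<open>Mon \<alpha> v \<beta>\<close> is the monomial \<open>\<alpha>\<beta>\<^sup>*\<close>, where \<open>v\<close> is the common target of \<open>\<alpha>\<close> and \<open>\<beta>\<close>. The list \<open>\<beta>\<close> is in
  the order of its ghost arrows in a word, hence reversed. \<open>One\<close> is the empty word.
\<close>

datatype ('v, 'e) state = Zero | One | Mon "'e list" 'v "'e list"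

section \<open>Reduction of words to monomials\<close>

context path_digraph
begin

text \<open>
  The left action of a generator on monomials. Because of the test \<open>head \<Gamma> f = src \<alpha>' v\<close> the relations
  of the Cohn algebra hold on all states, including ill-formed ones.
\<close>

primrec step :: "('v, 'e) gen \<Rightarrow> ('v, 'e) state \<Rightarrow> ('v, 'e) state" where
  "step (Vtx u) s = (case s of Zero \<Rightarrow> Zero | One \<Rightarrow> Mon [] u []
     | Mon \<alpha> v \<beta> \<Rightarrow> if u = src \<alpha> v then Mon \<alpha> v \<beta> else Zero)"
| "step (Arr e) s = (case s of Zero \<Rightarrow> Zero | One \<Rightarrow> Mon [e] (head \<Gamma> e) []
     | Mon \<alpha> v \<beta> \<Rightarrow> if head \<Gamma> e = src \<alpha> v then Mon (e # \<alpha>) v \<beta> else Zero)"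
| "step (Gst e) s = (case s of Zero \<Rightarrow> Zero | One \<Rightarrow> Mon [] (head \<Gamma> e) [e]
     | Mon \<alpha> v \<beta> \<Rightarrow> (case \<alpha> of
         [] \<Rightarrow> if tail \<Gamma> e = v then Mon [] (head \<Gamma> e) (e # \<beta>) else Zero
       | f # \<alpha>' \<Rightarrow> if e = f \<and> head \<Gamma> f = src \<alpha>' v then Mon \<alpha>' v \<beta> else Zero))"

abbreviation steps :: "('v, 'e) gen list \<Rightarrow> ('v, 'e) state \<Rightarrow> ('v, 'e) state" where
  "steps w s \<equiv> foldr step w s"

lemma step_Zero [simp]: "step x Zero = Zero"
  by (cases x) auto

lemma steps_Zero [simp]: "steps w Zero = Zero"
  by (induction w) auto

lemma step_not_One: "step x s \<noteq> One"
  by (cases x; cases s) (auto split: list.splits)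

lemma steps_not_One: "w \<noteq> [] \<Longrightarrow> steps w s \<noteq> One"
  by (cases w) (auto simp: step_not_One)

text \<open>The relations of the Cohn algebra as identities between compositions of maps, at every
  state. They are the reason why values computed from states are well defined on the Cohn
  algebra.\<close>

lemma step_relations:
  "step (Vtx v) (step (Vtx w) s) = (if v = w then step (Vtx v) s else Zero)"
  "step (Vtx (head \<Gamma> e)) (step (Gst e) s) = step (Gst e) s"
  "step (Vtx (tail \<Gamma> e)) (step (Arr e) s) = step (Arr e) s"
  "step (Gst e) (step (Vtx (tail \<Gamma> e)) s) = step (Gst e) s"
  "step (Arr e) (step (Vtx (head \<Gamma> e)) s) = step (Arr e) s"
  "step (Gst e) (step (Arr f) s) = (if e = f then step (Vtx (head \<Gamma> e)) s else Zero)"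
  by (cases s; auto split: list.splits)+

text \<open>The composability condition read backwards: \<open>v\<close> is the target of the path,
  and so the source of its ghost.\<close>

primrec ghost_path :: "'v \<Rightarrow> 'e list \<Rightarrow> bool" where
  "ghost_path v [] \<longleftrightarrow> v \<in> verts \<Gamma>"
| "ghost_path v (e # \<beta>) \<longleftrightarrow> e \<in> arcs \<Gamma> \<and> head \<Gamma> e = v \<and> ghost_path (tail \<Gamma> e) \<beta>"

lemma ghost_path_vert: "ghost_path v \<beta> \<Longrightarrow> v \<in> verts \<Gamma>"
  by (cases \<beta>) auto

lemma ghost_path_arcs: "ghost_path v \<beta> \<Longrightarrow> set \<beta> \<subseteq> arcs \<Gamma>"
  by (induction \<beta> arbitrary: v) auto

fun wf_state :: "('v, 'e) state \<Rightarrow> bool" where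
  "wf_state (Mon \<alpha> v \<beta>) \<longleftrightarrow> path_to \<alpha> v \<and> ghost_path v \<beta>"
| "wf_state _ \<longleftrightarrow> True"

lemma wf_step: "x \<in> gens \<Gamma> \<Longrightarrow> wf_state s \<Longrightarrow> wf_state (step x s)"
  by (cases x; cases s) (auto split: list.splits dest: ghost_path_vert)

lemma wf_steps: "set w \<subseteq> gens \<Gamma> \<Longrightarrow> wf_state s \<Longrightarrow> wf_state (steps w s)"
  by (induction w) (auto intro: wf_step)

text \<open>The empty word is not in the free algebra, so a trivial path is represented by its
  vertex.\<close>

definition ghost_word :: "'v \<Rightarrow> 'e list \<Rightarrow> ('v, 'e) gen list" where
  "ghost_word v \<beta> = (if \<beta> = [] then [Vtx v] else map Gst \<beta>)"

abbreviation ghost :: "'v \<Rightarrow> 'e list \<Rightarrow> ('v, 'e, 'f) cohn_elt" where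
  "ghost v \<beta> \<equiv> mono (ghost_word v \<beta>)"

lemma is_word_ghost: "ghost_path v \<beta> \<Longrightarrow> is_word (ghost_word v \<beta>)"
  using ghost_path_arcs[of v \<beta>] by (auto simp: is_word_def ghost_word_def)

lemma is_word_path: "path_to \<alpha> v \<Longrightarrow> is_word (path_word (src \<alpha> v, \<alpha>))"
  using path_to_arcs[of \<alpha> v] path_to_verts(1)[of \<alpha> v] by (auto simp: is_word_def)

lemma steps_ghost_map: "ghost_path v \<beta> \<Longrightarrow> \<beta> \<noteq> [] \<Longrightarrow> steps (map Gst \<beta>) One = Mon [] v \<beta>"
proof (induction \<beta> arbitrary: v)
  case (Cons e \<beta>)
  then show ?case by (cases \<beta>) auto
qed simp

lemma steps_ghost_word: "ghost_path v \<beta> \<Longrightarrow> steps (ghost_word v \<beta>) One = Mon [] v \<beta>"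
  by (simp add: ghost_word_def steps_ghost_map)

lemma steps_path_map:
  "path_to \<alpha> v \<Longrightarrow> \<alpha> \<noteq> [] \<Longrightarrow> steps (map Arr \<alpha>) (Mon \<alpha>' v' \<beta>') =
    (if v = src \<alpha>' v' then Mon (\<alpha> @ \<alpha>') v' \<beta>' else Zero)"
proof (induction \<alpha>)
  case (Cons e \<alpha>)
  then show ?case by (cases \<alpha>) (auto simp: src_append)
qed simp

lemma steps_path_word:
  "path_to \<alpha> v \<Longrightarrow> steps (path_word (src \<alpha> v, \<alpha>)) (Mon \<alpha>' v' \<beta>') =
    (if v = src \<alpha>' v' then Mon (\<alpha> @ \<alpha>') v' \<beta>' else Zero)"
  by (simp add: steps_path_map)

lemma steps_path_word_One:
  assumes "path_to \<alpha> v"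
  shows "steps (path_word (src \<alpha> v, \<alpha>)) One = Mon \<alpha> v []"
proof (cases \<alpha> rule: rev_cases)
  \<comment> \<open>The last arrow acts first and turns \<open>One\<close> into a monomial, to which
    \<open>steps_path_map\<close> then applies.\<close>
  case (snoc \<alpha>' e)
  with assms have p: "path_to \<alpha>' (tail \<Gamma> e)" "head \<Gamma> e = v" by (auto simp: path_to_snoc)
  show ?thesis
  proof (cases "\<alpha>' = []")
    case False
    with p snoc show ?thesis using steps_path_map[of \<alpha>' "tail \<Gamma> e" "[e]" v "[]"] by simp
  qed (use p snoc in simp)
qed simp

text \<open>Multiplication arrow by arrow, so that the trivial path acts as the identity although it
  has no empty word to stand for it.\<close>

primrec path_act :: "'e list \<Rightarrow> ('v, 'e, 'f) cohn_elt \<Rightarrow> ('v, 'e, 'f) cohn_elt" where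
  "path_act [] y = y"
| "path_act (e # \<alpha>) y = mono [Arr e] \<cdot> path_act \<alpha> y"

text \<open>The monomial denoted by a state. The value at \<open>One\<close> is a default, since no
  nonempty word leads to that state.\<close>

fun state_elt :: "('v, 'e) state \<Rightarrow> ('v, 'e, 'f) cohn_elt" where
  "state_elt (Mon \<alpha> v \<beta>) = path_act \<alpha> (ghost v \<beta>)"
| "state_elt _ = \<zero>\<^bsub>C\<^esub>"

lemma is_word_single: "is_word [x] \<longleftrightarrow> x \<in> gens \<Gamma>"
  by (simp add: is_word_def)

lemma gen_closed [simp]: "x \<in> gens \<Gamma> \<Longrightarrow> mono [x] \<in> carrier C"
  by (simp add: is_word_single)

lemma path_act_closed: "set \<alpha> \<subseteq> arcs \<Gamma> \<Longrightarrow> y \<in> carrier C \<Longrightarrow> path_act \<alpha> y \<in> carrier C"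
  by (induction \<alpha>) (auto intro!: C.mult_closed)

lemma mono_Cons: "x \<in> gens \<Gamma> \<Longrightarrow> is_word w \<Longrightarrow> mono [x] \<cdot> mono w = mono (x # w)"
  using mono_append[of "[x]" w 1 1] by (simp add: is_word_single)

lemma gen_act:
  assumes "x \<in> gens \<Gamma>" "y \<in> gens \<Gamma>" "z \<in> carrier C"
  shows "mono [x] \<cdot> (mono [y] \<cdot> z) = mono [x, y] \<cdot> z"
  using assms mono_Cons[of x "[y]"] by (simp add: C.mult_assoc[symmetric] is_word_single)

lemma act_relations:
  assumes z: "z \<in> carrier C"
  shows "v \<in> verts \<Gamma> \<Longrightarrow> w \<in> verts \<Gamma> \<Longrightarrow> mono [Vtx v] \<cdot> (mono [Vtx w] \<cdot> z) =
      (if v = w then mono [Vtx v] \<cdot> z else \<zero>\<^bsub>C\<^esub>)"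
    and "e \<in> arcs \<Gamma> \<Longrightarrow> mono [Vtx (tail \<Gamma> e)] \<cdot> (mono [Arr e] \<cdot> z) = mono [Arr e] \<cdot> z"
    and "e \<in> arcs \<Gamma> \<Longrightarrow> mono [Arr e] \<cdot> (mono [Vtx (head \<Gamma> e)] \<cdot> z) = mono [Arr e] \<cdot> z"
    and "e \<in> arcs \<Gamma> \<Longrightarrow> mono [Gst e] \<cdot> (mono [Vtx (tail \<Gamma> e)] \<cdot> z) = mono [Gst e] \<cdot> z"
    and "e \<in> arcs \<Gamma> \<Longrightarrow> f \<in> arcs \<Gamma> \<Longrightarrow> mono [Gst e] \<cdot> (mono [Arr f] \<cdot> z) =
      (if e = f then mono [Vtx (head \<Gamma> e)] \<cdot> z else \<zero>\<^bsub>C\<^esub>)"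
  using z cohn_relations(2)[of "Arr e"] cohn_relations(3)[of "Arr e"] cohn_relations(3)[of "Gst e"]
  by (simp_all add: gen_act cohn_relations(1,4))

lemma ghost_word_vertex:
  assumes "ghost_path v \<beta>"
  shows "mono [Vtx v] \<cdot> ghost v \<beta> = ghost v \<beta>"
proof (cases \<beta>)
  case Nil
  then show ?thesis
    using assms mono_Cons[of "Vtx v" "[Vtx v]"] cohn_relations(1)[of v v]
    by (simp add: ghost_word_def is_word_single)
next
  case (Cons e \<beta>')
  have e: "e \<in> arcs \<Gamma>" "head \<Gamma> e = v" using assms Cons by auto
  show ?thesis
  proof (cases "\<beta>' = []")
    case True
    have "mono [Vtx v] \<cdot> mono [Gst e] = mono [Vtx v, Gst e]"
      using e head_in_verts[OF e(1)] by (intro mono_Cons) (auto simp: is_word_single)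
    also have "\<dots> = mono [Gst e]"
      using e cohn_relations(2)[of "Gst e"] by simp
    finally show ?thesis using True Cons by (simp add: ghost_word_def)
  next
    case False
    have w: "is_word (map Gst \<beta>')"
      using False ghost_path_arcs[OF assms] Cons by (auto simp: is_word_def)
    have "ghost v \<beta> = mono [Gst e] \<cdot> mono (map Gst \<beta>')"
      using e w Cons by (simp add: ghost_word_def mono_Cons)
    moreover have "mono [Vtx v] \<cdot> (mono [Gst e] \<cdot> mono (map Gst \<beta>')) =
        mono [Vtx v, Gst e] \<cdot> mono (map Gst \<beta>')"
      using e w head_in_verts[OF e(1)] by (intro gen_act) auto
    moreover have "mono [Vtx v, Gst e] = mono [Gst e]"
      using e cohn_relations(2)[of "Gst e"] by simp
    ultimately show ?thesis by simp
  qed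
qed

lemma path_act_vertex:
  assumes "path_to \<alpha> v" "y \<in> carrier C" "mono [Vtx v] \<cdot> y = y"
  shows "mono [Vtx (src \<alpha> v)] \<cdot> path_act \<alpha> y = path_act \<alpha> y"
proof (cases \<alpha>)
  case (Cons e \<alpha>')
  then have "path_act \<alpha>' y \<in> carrier C" "e \<in> arcs \<Gamma>"
    using assms path_to_arcs[OF assms(1)] by (auto intro: path_act_closed)
  then show ?thesis using Cons by (simp add: act_relations)
qed (use assms in simp)

text \<open>Each clause of \<open>step\<close> computes left multiplication of a monomial by a
  generator, by means of the defining relations.\<close>

lemma state_elt_step:
  assumes x: "x \<in> gens \<Gamma>" and s: "wf_state s" "s \<noteq> One"
  shows "mono [x] \<cdot> state_elt s = state_elt (step x s)"
proof (cases s)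
  case (Mon \<alpha> v \<beta>)
  then have \<alpha>: "path_to \<alpha> v" and \<beta>: "ghost_path v \<beta>" using s by auto
  define y where "y = ghost v \<beta>"
  have y: "y \<in> carrier C" "mono [Vtx v] \<cdot> y = y"
    using \<beta> ghost_word_vertex is_word_ghost by (auto simp: y_def)
  have T: "path_act \<alpha> y \<in> carrier C"
    using y path_to_arcs[OF \<alpha>] by (simp add: path_act_closed)
  note vert = path_act_vertex[OF \<alpha> y] and sv = path_to_verts[OF \<alpha>]
  have sy: "state_elt s = path_act \<alpha> y" by (simp add: Mon y_def)
  show ?thesis
  proof (cases x)
    case (Vtx u)
    then show ?thesis
      using x act_relations(1)[OF T, of u "src \<alpha> v"] vert sv sy Mon by (auto simp: y_def)
  next
    case (Arr e)
    have e: "e \<in> arcs \<Gamma>" using x Arr by simp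
    \<comment> \<open>The arrow absorbs its head and the monomial absorbs its source. If these
      vertices differ, their product is zero and kills the whole expression.\<close>
    have "mono [Arr e] \<cdot> path_act \<alpha> y =
        mono [Arr e] \<cdot> (mono [Vtx (head \<Gamma> e)] \<cdot> (mono [Vtx (src \<alpha> v)] \<cdot> path_act \<alpha> y))"
      using e T sv vert by (simp add: act_relations)
    then have "mono [Arr e] \<cdot> path_act \<alpha> y = \<zero>\<^bsub>C\<^esub>" if "head \<Gamma> e \<noteq> src \<alpha> v"
      using that e T sv by (simp add: act_relations)
    then show ?thesis using Arr sy Mon by (auto simp: y_def)
  next
    case (Gst e)
    have e: "e \<in> arcs \<Gamma>" using x Gst by simp
    show ?thesis
    proof (cases \<alpha>)
      case Nil
      show ?thesis
      proof (cases "tail \<Gamma> e = v")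
        case True
        have "mono [Gst e] \<cdot> y = mono (ghost_word (head \<Gamma> e) (e # \<beta>))"
        proof (cases "\<beta> = []")
          case True
          then show ?thesis
            using e \<open>tail \<Gamma> e = v\<close> cohn_relations(3)[of "Gst e"] mono_Cons[of "Gst e" "[Vtx v]"] sv
            by (simp add: y_def ghost_word_def is_word_single)
        next
          case False
          then show ?thesis
            using e is_word_ghost[OF \<beta>] by (simp add: y_def ghost_word_def mono_Cons)
        qed
        then show ?thesis using Gst sy Mon Nil True by simp
      next
        case False
        have "mono [Gst e] \<cdot> y =
            mono [Gst e] \<cdot> (mono [Vtx (tail \<Gamma> e)] \<cdot> (mono [Vtx v] \<cdot> y))"
          using e y sv by (simp add: act_relations)
        then have "mono [Gst e] \<cdot> y = \<zero>\<^bsub>C\<^esub>"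
          using False e y(1) sv by (simp add: act_relations)
        then show ?thesis using Gst sy Mon Nil False by simp
      qed
    next
      case (Cons f \<alpha>')
      have f: "f \<in> arcs \<Gamma>" "head \<Gamma> f = src \<alpha>' v" "path_to \<alpha>' v" using \<alpha> Cons by auto
      have T': "path_act \<alpha>' y \<in> carrier C"
        using y path_to_arcs[OF f(3)] by (simp add: path_act_closed)
      show ?thesis
        using Gst sy Mon Cons e f T' path_act_vertex[OF f(3) y]
        by (auto simp: act_relations y_def)
    qed
  qed
qed (use assms in auto)

text \<open>The letters act one by one from the right end of the word, each as left multiplication
  on the monomial reached so far.\<close>

lemma mono_eq_state_elt:
  assumes "is_word w"
  shows "mono w = state_elt (steps w One)"
  using assms
proof (induction w)
  case (Cons x w)
  have x: "x \<in> gens \<Gamma>" using Cons.prems by (simp add: is_word_def)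
  show ?case
  proof (cases "w = []")
    \<comment> \<open>A single letter acts on \<open>One\<close>, which denotes no element, so
      \<open>state_elt_step\<close> does not apply. An arrow, for instance, becomes itself times its
      head.\<close>
    case True
    then show ?thesis
      using x cohn_relations(3)[of "Arr _"] mono_Cons[of "Arr _" "[Vtx _]"]
      by (cases x) (auto simp: ghost_word_def is_word_single)
  next
    case False
    then have w: "is_word w" using Cons.prems by (simp add: is_word_def)
    have "mono (x # w) = mono [x] \<cdot> state_elt (steps w One)"
      using x w Cons.IH by (simp add: mono_Cons[symmetric])
    also have "\<dots> = state_elt (step x (steps w One))"
      using x w False wf_steps steps_not_One by (intro state_elt_step) (auto simp: is_word_def)
    finally show ?thesis by simp
  qed
qed (simp add: is_word_def)

text \<open>Equalities between words in the Cohn algebra become computations with states.\<close>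

lemma cls_single_eq:
  assumes "is_word w" "is_word w'" "steps w One = steps w' One"
  shows "cls (single w k) = cls (single w' k)"
proof -
  have "mono w = mono w'" using assms(3) mono_eq_state_elt[OF assms(1)] mono_eq_state_elt[OF assms(2)] by simp
  then show ?thesis using cls_single[OF assms(1), of k] cls_single[OF assms(2), of k] by simp
qed

lemma cls_single_zero:
  assumes "is_word w" "steps w One = Zero"
  shows "cls (single w k) = \<zero>\<^bsub>C\<^esub>"
proof -
  have "mono w = \<zero>\<^bsub>C\<^esub>" using assms(2) mono_eq_state_elt[OF assms(1)] by simp
  then show ?thesis
    using abelian_group_hom.hom_zero[OF C.scale_hom] cls_single[OF assms(1), of k] by simp
qed

end

text \<open>From here on \<open>path_word\<close> stays folded, so that the rules about words of
  paths apply to it.\<close>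

declare path_word.simps [simp del]

section \<open>Additive maps on the Cohn algebra\<close>

text \<open>Admissible values on the multiples of states: additive in the scalar, and zero at the
  state that denotes zero.\<close>

definition zero_preserving ::
  "('m, 'r) ring_scheme \<Rightarrow> (('v, 'e) state \<Rightarrow> 'f::field \<Rightarrow> 'm) \<Rightarrow> bool" where
  "zero_preserving M \<theta> \<longleftrightarrow> additive_family M \<theta> \<and> (\<forall>k. \<theta> Zero k = \<zero>\<^bsub>M\<^esub>)"

context path_digraph
begin

text \<open>The parameter \<open>s\<close> is the state on which words start to act. The map finally
  obtained has \<open>s = One\<close>; other starting states come from right factors.\<close>

definition state_extend :: "('m, 'r) ring_scheme \<Rightarrow>
  (('v, 'e) state \<Rightarrow> 'f \<Rightarrow> 'm) \<Rightarrow> ('v, 'e) state \<Rightarrow> ('v, 'e, 'f) free_elt \<Rightarrow> 'm" where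
  "state_extend M \<theta> s = basis_extend M (\<lambda>w. \<theta> (steps w s))"

text \<open>
  Left multiplication in the argument changes \<open>\<theta>\<close> and right multiplication changes \<open>s\<close>; with both of
  them universally quantified this is an ideal.
\<close>

definition common_kernel :: "('m, 'r) ring_scheme \<Rightarrow> ('v, 'e, 'f) free_elt set" where
  "common_kernel M =
    {x \<in> carrier \<F>. \<forall>\<theta> s. zero_preserving M \<theta> \<longrightarrow> state_extend M \<theta> s x = \<zero>\<^bsub>M\<^esub>}"

context
  fixes M :: "('m, 'r) ring_scheme" (structure)
  assumes M: "abelian_group M"
begin

interpretation M: abelian_group M by (rule M)

lemma additive_family_steps: "zero_preserving M \<theta> \<Longrightarrow> additive_family M (\<lambda>w. \<theta> (steps w s))"
  by (auto simp: zero_preserving_def additive_family_def additive_family_axioms_def)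

lemma state_extend_hom: "zero_preserving M \<theta> \<Longrightarrow> abelian_group_hom \<F> M (state_extend M \<theta> s)"
  unfolding state_extend_def free_algebra_def
  by (rule additive_family.basis_extend_hom[OF additive_family_steps])

lemma state_extend_add:
  "zero_preserving M \<theta> \<Longrightarrow> state_extend M \<theta> s (a + b) = state_extend M \<theta> s a \<oplus> state_extend M \<theta> s b"
  unfolding state_extend_def by (rule additive_family.basis_extend_add[OF additive_family_steps])

lemma state_extend_single:
  "zero_preserving M \<theta> \<Longrightarrow> state_extend M \<theta> s (single w k) = \<theta> (steps w s) k"
  unfolding state_extend_def by (rule additive_family.basis_extend_single[OF additive_family_steps])

lemma state_extend_zero [simp]: "state_extend M \<theta> s 0 = \<zero>"
  by (simp add: state_extend_def basis_extend_def)

lemma zero_preserving_shift: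
  assumes "zero_preserving M \<theta>"
  shows "zero_preserving M (\<lambda>t l. \<theta> (steps u t) (k * l))"
    and "zero_preserving M (\<lambda>t l. \<theta> t (k * l))" "zero_preserving M (\<lambda>t l. \<theta> t (l * k))"
  using assms
  by (auto simp: zero_preserving_def additive_family_def additive_family_axioms_def
      distrib_left distrib_right)

lemma state_extend_scale:
  assumes "zero_preserving M \<theta>"
  shows "state_extend M \<theta> s (Poly_Mapping.map ((*) k) x) = state_extend M (\<lambda>t l. \<theta> t (k * l)) s x"
  by (induction x rule: poly_mapping_additive_induct[where B=UNIV, OF subset_UNIV])
    (use assms zero_preserving_shift[OF assms] in
      \<open>simp_all add: state_extend_add state_extend_single map_scale_single map_scale_add\<close>)

text \<open>A left factor acts last, so it can be absorbed into \<open>\<theta>\<close>.\<close>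

lemma state_extend_left:
  assumes "zero_preserving M \<theta>"
  shows "state_extend M \<theta> s (lin_mult (\<lambda>w w'. Some (w @ w')) (single u k) x) =
    state_extend M (\<lambda>t l. \<theta> (steps u t) (k * l)) s x"
  by (induction x rule: poly_mapping_additive_induct[where B=UNIV, OF subset_UNIV])
    (use assms zero_preserving_shift[OF assms] in
      \<open>simp_all add: state_extend_add state_extend_single lin_mult_single basis_prod_def lin_mult_add_right\<close>)

text \<open>A right factor acts first, so apart from its coefficient it only changes the starting
  state.\<close>

lemma state_extend_right:
  assumes "zero_preserving M \<theta>"
  shows "state_extend M \<theta> s (lin_mult (\<lambda>w w'. Some (w @ w')) x (single u k)) =
    state_extend M (\<lambda>t l. \<theta> t (l * k)) (steps u s) x"
  by (induction x rule: poly_mapping_additive_induct[where B=UNIV, OF subset_UNIV])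
    (use assms zero_preserving_shift[OF assms] in
      \<open>simp_all add: state_extend_add state_extend_single lin_mult_single basis_prod_def lin_mult_add_left\<close>)

lemma alg_ideal_common_kernel: "alg_ideal \<F> (common_kernel M)"
proof -
  have "additive_subgroup (common_kernel M) \<F>"
  proof (rule F.additive_subgroup_criterion)
    show "\<zero>\<^bsub>\<F>\<^esub> \<in> common_kernel M" by (simp add: common_kernel_def)
    show "a \<oplus>\<^bsub>\<F>\<^esub> b \<in> common_kernel M" if "a \<in> common_kernel M" "b \<in> common_kernel M" for a b
    proof -
      have "a \<oplus>\<^bsub>\<F>\<^esub> b \<in> carrier \<F>" using that by (intro F.a_closed) (auto simp: common_kernel_def)
      with that show ?thesis by (simp add: common_kernel_def state_extend_add)
    qed
    show "\<ominus>\<^bsub>\<F>\<^esub> a \<in> common_kernel M" if "a \<in> common_kernel M" for a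
    proof -
      have a: "a \<in> carrier \<F>" using that by (simp add: common_kernel_def)
      have "state_extend M \<theta> s (\<ominus>\<^bsub>\<F>\<^esub> a) = \<zero>" if \<theta>: "zero_preserving M \<theta>" for \<theta> s
        using abelian_group_hom.hom_a_inv[OF state_extend_hom[OF \<theta>] a] \<open>a \<in> common_kernel M\<close> \<theta>
          M.minus_equality[of \<zero> \<zero>]
        by (simp add: common_kernel_def)
      moreover have "\<ominus>\<^bsub>\<F>\<^esub> a \<in> carrier \<F>" using a by (rule F.a_inv_closed)
      ultimately show ?thesis by (simp add: common_kernel_def)
    qed
  qed (auto simp: common_kernel_def)
  moreover have "k \<odot>\<^bsub>\<F>\<^esub> x \<in> common_kernel M" if "x \<in> common_kernel M" for k x
  proof -
    have "k \<odot>\<^bsub>\<F>\<^esub> x \<in> carrier \<F>" using that by (intro F.scale_closed) (simp add: common_kernel_def)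
    with that show ?thesis
      by (simp add: common_kernel_def state_extend_scale zero_preserving_shift)
  qed
  moreover have "r \<otimes>\<^bsub>\<F>\<^esub> x \<in> common_kernel M" if r: "r \<in> carrier \<F>" and x: "x \<in> common_kernel M" for r x
  proof -
    have "state_extend M \<theta> s (lin_mult (\<lambda>w w'. Some (w @ w')) r x) = \<zero>" if \<theta>: "zero_preserving M \<theta>" for \<theta> s
      by (induction r rule: poly_mapping_additive_induct[where B=UNIV, OF subset_UNIV])
        (use \<theta> x zero_preserving_shift[OF \<theta>] in
          \<open>simp_all add: state_extend_left lin_mult_add_left state_extend_add common_kernel_def\<close>)
    moreover have "r \<otimes>\<^bsub>\<F>\<^esub> x \<in> carrier \<F>"
      using r x by (intro F.mult_closed) (auto simp: common_kernel_def)
    ultimately show ?thesis by (simp add: common_kernel_def)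
  qed
  moreover have "x \<otimes>\<^bsub>\<F>\<^esub> r \<in> common_kernel M" if r: "r \<in> carrier \<F>" and x: "x \<in> common_kernel M" for r x
  proof -
    have "state_extend M \<theta> s (lin_mult (\<lambda>w w'. Some (w @ w')) x r) = \<zero>" if \<theta>: "zero_preserving M \<theta>" for \<theta> s
      by (induction r rule: poly_mapping_additive_induct[where B=UNIV, OF subset_UNIV])
        (use \<theta> x zero_preserving_shift[OF \<theta>] in
          \<open>simp_all add: state_extend_right lin_mult_add_right state_extend_add common_kernel_def\<close>)
    moreover have "x \<otimes>\<^bsub>\<F>\<^esub> r \<in> carrier \<F>"
      using r x by (intro F.mult_closed) (auto simp: common_kernel_def)
    ultimately show ?thesis by (simp add: common_kernel_def)
  qed
  ultimately show ?thesis unfolding alg_ideal_def alg_subspace_def by blast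
qed

lemma common_kernel_diff:
  assumes "x - y \<in> carrier \<F>" "y \<in> carrier \<F>"
    and "\<And>\<theta> s. zero_preserving M \<theta> \<Longrightarrow> state_extend M \<theta> s x = state_extend M \<theta> s y"
  shows "x - y \<in> common_kernel M"
proof -
  have "state_extend M \<theta> s (x - y) = \<zero>" if \<theta>: "zero_preserving M \<theta>" for \<theta> s
  proof -
    interpret h: abelian_group_hom \<F> M "state_extend M \<theta> s" by (rule state_extend_hom[OF \<theta>])
    have "state_extend M \<theta> s y = state_extend M \<theta> s (x - y) \<oplus> state_extend M \<theta> s y"
      using state_extend_add[OF \<theta>, of s "x - y" y] assms(3)[OF \<theta>] by simp
    then show ?thesis
      using h.hom_closed[OF assms(1)] h.hom_closed[OF assms(2)] by simp
  qed
  with assms(1) show ?thesis by (simp add: common_kernel_def)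
qed

text \<open>By \<open>step_relations\<close> the two terms of a relator lead from every state to the
  same value, so the relators lie in the common kernel; as this is an ideal, it contains what they
  generate.\<close>

lemma cohn_ideal_common_kernel: "cohn_ideal \<Gamma> \<subseteq> common_kernel M"
  unfolding cohn_ideal_def
proof (rule F.alg_ideal_gen_minimal[OF alg_ideal_common_kernel], rule subsetI)
  fix x :: "('v, 'e, 'f) free_elt" assume x: "x \<in> cohn_relators \<Gamma>"
  then have xc: "x \<in> carrier \<F>" using cohn_relators_closed by blast
  \<comment> \<open>With the clauses of \<open>step\<close> folded, the relations apply at a state
    of unknown shape.\<close>
  note step.simps [simp del] step_relations [simp]
  from x show "x \<in> common_kernel M"
  proof (cases rule: cohn_relators_cases)
    case 1
    show ?thesis
      unfolding 1(1) by (rule common_kernel_diff)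
        (use xc 1 in \<open>auto simp: state_extend_single is_word_def zero_preserving_def\<close>)
  next
    case 2
    show ?thesis
      unfolding 2(1) by (rule common_kernel_diff)
        (use xc 2 in \<open>auto simp: state_extend_single is_word_def\<close>)
  next
    case 3
    show ?thesis
      unfolding 3(1) by (rule common_kernel_diff)
        (use xc 3 in \<open>auto simp: state_extend_single is_word_def\<close>)
  next
    case 4
    show ?thesis
      unfolding 4(1) by (rule common_kernel_diff)
        (use xc 4 in \<open>auto simp: state_extend_single is_word_def zero_preserving_def\<close>)
  qed
qed

text \<open>Independence of the monomials, as a mapping property: acting on \<open>One\<close>, a
  word arrives at its reduced form, and the values on reduced forms are at the disposal of
  \<open>\<theta>\<close>.\<close>

lemma cohn_lift:
  assumes "zero_preserving M \<theta>"
  shows "\<exists>h. abelian_group_hom C M h \<and>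
    (\<forall>w k. is_word w \<longrightarrow> h (cls (single w k)) = \<theta> (steps w One) k)"
proof -
  have "\<exists>h. abelian_group_hom FI.Q M h \<and>
      (\<forall>x\<in>carrier \<F>. h (cohn_ideal \<Gamma> +>\<^bsub>\<F>\<^esub> x) = state_extend M \<theta> One x)"
  proof (rule FI.lift_quotient[OF state_extend_hom[OF assms]])
    show "state_extend M \<theta> One x = \<zero>" if "x \<in> cohn_ideal \<Gamma>" for x
      using that cohn_ideal_common_kernel assms by (auto simp: common_kernel_def)
  qed
  then obtain h where "abelian_group_hom C M h"
      "\<And>x. x \<in> carrier \<F> \<Longrightarrow> h (cls x) = state_extend M \<theta> One x"
    unfolding cohn_algebra_def cohn_class_def by blast
  then show ?thesis by (intro exI[of _ h]) (auto simp: state_extend_single[OF assms])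
qed

end

section \<open>The path algebra acting on the Cohn algebra\<close>

abbreviation \<phi> :: "('v, 'e, 'f) path_elt \<Rightarrow> ('v, 'e, 'f) cohn_elt" where "\<phi> \<equiv> path_to_cohn \<Gamma>"

lemma path_algebra_simps [simp]:
  "carrier A = {a. keys a \<subseteq> paths \<Gamma>}" "mult A = lin_mult (path_comp \<Gamma>)"
  "add A = (+)" "zero A = 0"
  by (simp_all add: path_algebra_def)

lemma path_in_paths: "path_to \<alpha> v \<Longrightarrow> (src \<alpha> v, \<alpha>) \<in> paths \<Gamma>"
  by (auto simp: paths_iff)

lemma single_path_closed: "path_to \<alpha> v \<Longrightarrow> path_elem \<alpha> v k \<in> carrier A"
  by (simp add: path_in_paths)

lemma path_algebra_hom_eq:
  assumes "abelian_group_hom A M f" "abelian_group_hom A M g" "a \<in> carrier A"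
    and "\<And>\<alpha> v k. path_to \<alpha> v \<Longrightarrow>
      f (path_elem \<alpha> v k) = g (path_elem \<alpha> v k)"
  shows "f a = g a"
proof (rule additive_span_hom_eq[OF assms(1,2)])
  let ?S = "{single p k |p k. p \<in> paths \<Gamma>}"
  show "a \<in> additive_span A ?S"
    using assms(3) basis_algebra_span unfolding path_algebra_def by blast
  show "?S \<subseteq> carrier A" by (auto split: if_splits)
  show "f x = g x" if "x \<in> ?S" for x
    using that assms(4) by (auto elim!: pathsE)
qed

lemma path_to_cohn_sum:
  assumes "finite P" "keys a \<subseteq> P"
  shows "\<phi> a = cls (\<Sum>p\<in>P. single (path_word p) (lookup a p))"
  unfolding path_to_cohn_def
  by (rule arg_cong[of _ _ cls], rule sum.mono_neutral_left) (use assms in \<open>auto simp: in_keys_iff\<close>)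

lemma path_word_closed:
  assumes "P \<subseteq> paths \<Gamma>"
  shows "(\<Sum>p\<in>P. single (path_word p) (lookup a p)) \<in> carrier \<F>"
proof -
  have "is_word (path_word p)" if "p \<in> paths \<Gamma>" for p
    using that by (auto elim!: pathsE simp: is_word_path)
  then have "(\<Union>p\<in>P. keys (single (path_word p) (lookup a p)))
      \<subseteq> {w. is_word w}"
    using assms by (auto split: if_splits)
  with keys_sum[of "\<lambda>p. single (path_word p) (lookup a p)" P]
  show ?thesis by (auto dest: subsetD)
qed

lemma path_to_cohn_single: "\<phi> (single p k) = cls (single (path_word p) k)"
  by (subst path_to_cohn_sum[where P="{p}"]) auto

lemma path_to_cohn_hom: "abelian_group_hom A C \<phi>"
proof (rule abelian_group_hom_intro)
  show "\<phi> \<in> carrier A \<rightarrow> carrier C"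
    unfolding path_to_cohn_def by (auto intro!: cls.hom_closed path_word_closed)
  fix x y assume xy: "x \<in> carrier A" "y \<in> carrier A"
  let ?P = "keys x \<union> keys y"
  have P: "finite ?P" "?P \<subseteq> paths \<Gamma>" using xy by auto
  have "\<phi> (x + y) = cls (\<Sum>p\<in>?P. single (path_word p) (lookup (x + y) p))"
    using keys_add[of x y] by (intro path_to_cohn_sum) auto
  also have "\<dots> = cls ((\<Sum>p\<in>?P. single (path_word p) (lookup x p)) \<oplus>\<^bsub>\<F>\<^esub>
      (\<Sum>p\<in>?P. single (path_word p) (lookup y p)))"
    by (simp add: lookup_add single_add sum.distrib)
  also have "\<dots> = \<phi> x \<oplus>\<^bsub>C\<^esub> \<phi> y"
    using P by (subst cls.hom_add) (auto intro: path_word_closed simp del: free_simps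
        simp: path_to_cohn_sum[of ?P])
  finally show "\<phi> (x \<oplus>\<^bsub>A\<^esub> y) = \<phi> x \<oplus>\<^bsub>C\<^esub> \<phi> y" by simp
qed (rule A.abelian_group_axioms C.abelian_group_axioms)+

sublocale \<phi>: abelian_group_hom A C \<phi> by (rule path_to_cohn_hom)

text \<open>By additivity in both arguments it suffices to multiply two paths. If they compose, two
  words with the same state are compared; otherwise the word reduces to zero.\<close>

lemma path_to_cohn_mult:
  assumes a: "a \<in> carrier A" and b: "b \<in> carrier A"
  shows "\<phi> (a \<otimes>\<^bsub>A\<^esub> b) = \<phi> a \<cdot> \<phi> b"
proof (rule path_algebra_hom_eq[OF _ _ a])
  show "abelian_group_hom A C (\<lambda>a. \<phi> (a \<otimes>\<^bsub>A\<^esub> b))"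
    by (rule abelian_group_hom_compose[OF A.mult_right_hom[OF b] path_to_cohn_hom])
  show "abelian_group_hom A C (\<lambda>a. \<phi> a \<cdot> \<phi> b)"
    by (rule abelian_group_hom_compose[OF path_to_cohn_hom C.mult_right_hom[OF \<phi>.hom_closed[OF b]]])
  fix \<alpha> v and k :: 'f assume \<alpha>: "path_to \<alpha> v"
  let ?a = "path_elem \<alpha> v k"
  have a: "?a \<in> carrier A" by (rule single_path_closed[OF \<alpha>])
  show "\<phi> (?a \<otimes>\<^bsub>A\<^esub> b) = \<phi> ?a \<cdot> \<phi> b"
  proof (rule path_algebra_hom_eq[OF _ _ b])
    show "abelian_group_hom A C (\<lambda>b. \<phi> (?a \<otimes>\<^bsub>A\<^esub> b))"
      by (rule abelian_group_hom_compose[OF A.mult_left_hom[OF a] path_to_cohn_hom])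
    show "abelian_group_hom A C (\<lambda>b. \<phi> ?a \<cdot> \<phi> b)"
      by (rule abelian_group_hom_compose[OF path_to_cohn_hom C.mult_left_hom[OF \<phi>.hom_closed[OF a]]])
    fix \<beta> w and l :: 'f assume \<beta>: "path_to \<beta> w"
    let ?u = "path_word (src \<alpha> v, \<alpha>)" and ?w = "path_word (src \<beta> w, \<beta>)"
    have words: "is_word ?u" "is_word ?w" "is_word (?u @ ?w)"
      using \<alpha> \<beta> by (auto intro!: is_word_path is_word_append)
    have "\<phi> ?a \<cdot> \<phi> (path_elem \<beta> w l) = cls (single (?u @ ?w) (k * l))"
      using words by (simp add: path_to_cohn_single mono_append)
    also have "\<dots> = \<phi> (?a \<otimes>\<^bsub>A\<^esub> path_elem \<beta> w l)"
    proof (cases "v = src \<beta> w")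
      case True
      then have \<alpha>\<beta>: "path_to (\<alpha> @ \<beta>) w" using \<alpha> \<beta> by (intro path_to_append) auto
      have "cls (single (?u @ ?w) (k * l)) =
          cls (single (path_word (src (\<alpha> @ \<beta>) w, \<alpha> @ \<beta>)) (k * l))"
        using words \<alpha> \<beta> \<alpha>\<beta> True
        by (intro cls_single_eq) (simp_all add: is_word_path steps_path_word_One steps_path_word)
      then show ?thesis
        using True \<alpha> by (simp add: lin_mult_single basis_prod_def path_comp_eq path_to_cohn_single src_append)
    next
      case False
      have "cls (single (?u @ ?w) (k * l)) = \<zero>\<^bsub>C\<^esub>"
        using words \<alpha> \<beta> False
        by (intro cls_single_zero) (simp_all add: steps_path_word_One steps_path_word)
      then show ?thesis
        using False \<alpha> \<phi>.hom_zero by (simp add: lin_mult_single basis_prod_def path_comp_eq)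
    qed
    finally show "\<phi> (?a \<otimes>\<^bsub>A\<^esub> path_elem \<beta> w l) =
        \<phi> ?a \<cdot> \<phi> (path_elem \<beta> w l)" by simp
  qed
qed

sublocale AC: rng_hom A C \<phi>
  by (intro rng_hom.intro rng_hom_axioms.intro A.scalar_rng_axioms C.scalar_rng_axioms
      path_to_cohn_hom path_to_cohn_mult)

lemma cohn_module_eq: "cohn_module \<Gamma> = AC.submodule (carrier C)"
  by (simp add: cohn_module_def AC.submodule_carrier)

lemma path_vertex_closed: "v \<in> verts \<Gamma> \<Longrightarrow> path_vertex v \<in> carrier A"
  using single_path_closed[of "[]" v 1] by (simp add: path_vertex_def)

lemma path_vertex_idem:
  "v \<in> verts \<Gamma> \<Longrightarrow> path_vertex v \<otimes>\<^bsub>A\<^esub> path_vertex v = path_vertex v"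
  using path_comp_eq[of "[]" v v "[]"] by (simp add: path_vertex_def lin_mult_single basis_prod_def)

lemma path_to_cohn_vertex: "\<phi> (path_vertex v) = mono [Vtx v]"
  by (simp add: path_vertex_def path_to_cohn_single path_word.simps)

lemma path_to_cohn_ghost:
  assumes "path_to \<alpha> u" "ghost_path v \<beta>"
  shows "\<phi> (path_elem \<alpha> u k) \<cdot> ghost v \<beta> =
    cls (single (path_word (src \<alpha> u, \<alpha>) @ ghost_word v \<beta>) k)"
  using assms by (simp add: path_to_cohn_single mono_append is_word_path is_word_ghost)

text \<open>The path and the ghost path read off from the state of a word form a second word with
  the same state.\<close>

lemma word_factor:
  assumes w: "is_word w"
  shows "cls (single w k) = \<zero>\<^bsub>C\<^esub> \<or>
    (\<exists>\<alpha> v \<beta>. path_to \<alpha> v \<and> ghost_path v \<beta> \<and> cls (single w k) =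
      \<phi> (path_elem \<alpha> v k) \<cdot> ghost v \<beta>)"
proof (cases "steps w One")
  case Zero
  then show ?thesis by (simp add: cls_single_zero[OF w])
next
  case One
  then show ?thesis using w steps_not_One by (auto simp: is_word_def)
next
  case (Mon \<alpha> v \<beta>)
  have "wf_state (steps w One)" using w by (intro wf_steps) (auto simp: is_word_def)
  then have wf: "path_to \<alpha> v" "ghost_path v \<beta>" using Mon by auto
  have "cls (single w k) =
      cls (single (path_word (src \<alpha> v, \<alpha>) @ ghost_word v \<beta>) k)"
    using wf w Mon
    by (intro cls_single_eq is_word_append is_word_path is_word_ghost)
      (simp_all add: steps_ghost_word steps_path_word)
  with wf path_to_cohn_ghost[OF wf, of k] show ?thesis by metis
qed

lemma cohn_generated:
  "carrier C \<subseteq> additive_span C {\<phi> a \<cdot> ghost v \<beta> |a v \<beta>. a \<in> carrier A \<and> ghost_path v \<beta>}"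
proof -
  let ?S = "{\<phi> a \<cdot> ghost v \<beta> |a v \<beta>. a \<in> carrier A \<and> ghost_path v \<beta>}"
  have S: "?S \<subseteq> carrier C" using is_word_ghost by (auto intro!: C.mult_closed \<phi>.hom_closed mono_closed)
  have "cls (single w k) \<in> additive_span C ?S" if w: "is_word w" for w k
    using word_factor[OF w, of k]
  proof (elim disjE exE conjE)
    assume "cls (single w k) = \<zero>\<^bsub>C\<^esub>"
    then show ?thesis using generate.one[of "add_monoid C" ?S] by simp
  next
    fix \<alpha> v \<beta> assume "path_to \<alpha> v" "ghost_path v \<beta>" "cls (single w k) =
      \<phi> (path_elem \<alpha> v k) \<cdot> ghost v \<beta>"
    then show ?thesis
      using single_path_closed[of \<alpha> v k] by (intro generate.incl) blast
  qed
  then have "additive_span C {cls (single w k) |w k. is_word w} \<subseteq> additive_span C ?S"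
    by (intro C.additive_span_minimal C.additive_subgroup_span[OF S]) auto
  with cohn_span show ?thesis by (rule subset_trans)
qed

section \<open>Projectivity of the Cohn path algebra\<close>

lemma unital_cohn_module: "unital_left_module A (cohn_module \<Gamma>)"
  unfolding cohn_module_eq
proof (rule AC.unital_submodule)
  show "additive_subgroup (carrier C) C" by (rule C.additive_subgroup_criterion) auto
  show "carrier C \<subseteq> additive_span C {\<phi> a \<cdot> x |a x. a \<in> carrier A \<and> x \<in> carrier C}"
    by (intro subset_trans[OF cohn_generated] C.add.mono_generate) (blast intro: mono_closed is_word_ghost)
qed (auto simp del: path_algebra_simps)

text \<open>As \<open>x = v x\<close>, acting by a path on \<open>x\<close> is acting by its product
  with \<open>v\<close>, which is zero because the path ends elsewhere.\<close>

lemma action_zero: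
  assumes "unital_left_module A M" "x \<in> carrier M" "path_vertex v \<odot>\<^bsub>M\<^esub> x = x"
    and "v \<in> verts \<Gamma>" "path_to \<alpha> u" "u \<noteq> v"
  shows "path_elem \<alpha> u k \<odot>\<^bsub>M\<^esub> x = \<zero>\<^bsub>M\<^esub>"
proof -
  let ?a = "path_elem \<alpha> u k"
  have "?a \<odot>\<^bsub>M\<^esub> x = (?a \<otimes>\<^bsub>A\<^esub> path_vertex v) \<odot>\<^bsub>M\<^esub> x"
    using assms unital_left_moduleD(5)[OF assms(1), of ?a "path_vertex v" x]
      single_path_closed path_vertex_closed by (simp del: path_algebra_simps)
  also have "?a \<otimes>\<^bsub>A\<^esub> path_vertex v = \<zero>\<^bsub>A\<^esub>"
    using assms(5,6) by (simp add: path_vertex_def lin_mult_single basis_prod_def path_comp_eq)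
  also have "\<zero>\<^bsub>A\<^esub> \<odot>\<^bsub>M\<^esub> x = \<zero>\<^bsub>M\<^esub>"
    by (rule abelian_group_hom.hom_zero[OF module_orbit_hom[OF assms(1) A.abelian_group_axioms assms(2)]])
  finally show ?thesis .
qed

text \<open>The monomials \<open>a b^*\<close> with \<open>b\<close> fixed are indexed by the paths
  \<open>a\<close> that end where \<open>b\<close> does. Hence \<open>b^*\<close> may be sent to any
  element fixed by that vertex.\<close>

lemma cohn_module_extension:
  assumes M: "unital_left_module A M"
    and m: "\<And>v \<beta>. ghost_path v \<beta> \<Longrightarrow> m v \<beta> \<in> carrier M"
    and em: "\<And>v \<beta>. ghost_path v \<beta> \<Longrightarrow> path_vertex v \<odot>\<^bsub>M\<^esub> m v \<beta> = m v \<beta>"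
  shows "\<exists>h. abelian_group_hom C M h \<and>
    (\<forall>a\<in>carrier A. \<forall>v \<beta>. ghost_path v \<beta> \<longrightarrow> h (\<phi> a \<cdot> ghost v \<beta>) = a \<odot>\<^bsub>M\<^esub> m v \<beta>)"
proof -
  note MD = unital_left_moduleD[OF M]
  interpret M: abelian_group M by (rule MD(1))
  \<comment> \<open>Additivity is required at all states, including ill-formed ones. There the path
    element may lie outside the path algebra, where nothing is known about its action on
    \<open>M\<close>; the value zero is used instead.\<close>
  define \<theta> where "\<theta> = (\<lambda>s k. case s of
      Mon \<alpha> v \<beta> \<Rightarrow> if path_to \<alpha> v \<and> ghost_path v \<beta>
        then path_elem \<alpha> v k \<odot>\<^bsub>M\<^esub> m v \<beta> else \<zero>\<^bsub>M\<^esub>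
    | _ \<Rightarrow> \<zero>\<^bsub>M\<^esub>)"
  have "\<theta> s k \<in> carrier M" "\<theta> s (k + l) = \<theta> s k \<oplus>\<^bsub>M\<^esub> \<theta> s l" for s k l
    using MD(2,3) m single_path_closed
    by (auto simp: \<theta>_def single_add split: state.split simp del: path_algebra_simps(1) simp flip: path_algebra_simps(3))
  then have "zero_preserving M \<theta>"
    unfolding zero_preserving_def additive_family_def additive_family_axioms_def
    using MD(1) by (auto simp: \<theta>_def)
  from cohn_lift[OF MD(1) this] obtain h where h: "abelian_group_hom C M h"
      "\<And>w k. is_word w \<Longrightarrow> h (cls (single w k)) = \<theta> (steps w One) k"
    by blast
  have "h (\<phi> a \<cdot> ghost v \<beta>) = a \<odot>\<^bsub>M\<^esub> m v \<beta>"
    if a: "a \<in> carrier A" and \<beta>: "ghost_path v \<beta>" for a v \<beta>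
  proof (rule path_algebra_hom_eq[OF _ _ a])
    show "abelian_group_hom A M (\<lambda>a. h (\<phi> a \<cdot> ghost v \<beta>))"
      using is_word_ghost[OF \<beta>]
      by (intro abelian_group_hom_compose[OF _ h(1)] abelian_group_hom_compose[OF path_to_cohn_hom]
          C.mult_right_hom mono_closed)
    show "abelian_group_hom A M (\<lambda>a. a \<odot>\<^bsub>M\<^esub> m v \<beta>)"
      by (rule module_orbit_hom[OF M A.abelian_group_axioms m[OF \<beta>]])
    fix \<alpha> u and k :: 'f assume \<alpha>: "path_to \<alpha> u"
    have "h (\<phi> (path_elem \<alpha> u k) \<cdot> ghost v \<beta>) =
        \<theta> (steps (path_word (src \<alpha> u, \<alpha>) @ ghost_word v \<beta>) One) k"
      using \<alpha> \<beta> by (simp add: path_to_cohn_ghost h(2) is_word_append is_word_path is_word_ghost)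
    also have "\<dots> = (if u = v then path_elem \<alpha> u k \<odot>\<^bsub>M\<^esub> m v \<beta> else \<zero>\<^bsub>M\<^esub>)"
      using \<alpha> \<beta> by (auto simp: steps_ghost_word steps_path_word \<theta>_def)
    \<comment> \<open>For a path that does not end at \<open>v\<close> the module action is zero as
      well.\<close>
    also have "\<dots> = path_elem \<alpha> u k \<odot>\<^bsub>M\<^esub> m v \<beta>"
      using action_zero[OF M m em ghost_path_vert \<alpha>] \<beta> by auto
    finally show "h (\<phi> (path_elem \<alpha> u k) \<cdot> ghost v \<beta>) =
        path_elem \<alpha> u k \<odot>\<^bsub>M\<^esub> m v \<beta>" .
  qed
  with h(1) show ?thesis by blast
qed

text \<open>The generators are the ghost paths, and the idempotent attached to each is the vertex at
  which it starts.\<close>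

theorem projective_cohn_module:
  "projective_left_module A (cohn_module \<Gamma>) TYPE('m) TYPE('n)"
proof (rule projective_left_moduleI[where I="{(v, \<beta>). ghost_path v \<beta>}"
      and b="\<lambda>(v, \<beta>). ghost v \<beta>" and e="\<lambda>(v, \<beta>). path_vertex v"])
  show "unital_left_module A (cohn_module \<Gamma>)" by (rule unital_cohn_module)
  show "carrier (cohn_module \<Gamma>) \<subseteq> additive_span (cohn_module \<Gamma>)
      {a \<odot>\<^bsub>cohn_module \<Gamma>\<^esub> (case i of (v, \<beta>) \<Rightarrow> ghost v \<beta>) |a i.
        a \<in> carrier A \<and> i \<in> {(v, \<beta>). ghost_path v \<beta>}}" (is "_ \<subseteq> additive_span _ ?S")
  proof -
    have "?S = {\<phi> a \<cdot> ghost v \<beta> |a v \<beta>. a \<in> carrier A \<and> ghost_path v \<beta>}"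
      by (auto simp: cohn_module_eq simp del: path_algebra_simps)
    moreover have "additive_span (cohn_module \<Gamma>) X = additive_span C X" for X
      by (rule additive_span_cong) (simp_all add: cohn_module_eq)
    ultimately show ?thesis using cohn_generated by (simp add: cohn_module_eq del: path_algebra_simps)
  qed
  fix M :: "(('v, 'e, 'f) path_elt, 'm) module" and m
  assume M: "unital_left_module A M"
    and m: "\<And>i. i \<in> {(v, \<beta>). ghost_path v \<beta>} \<Longrightarrow> m i \<in> carrier M"
    and em: "\<And>i. i \<in> {(v, \<beta>). ghost_path v \<beta>} \<Longrightarrow> (case i of (v, \<beta>) \<Rightarrow> path_vertex v) \<odot>\<^bsub>M\<^esub> m i = m i"
  have "\<exists>h. abelian_group_hom C M h \<and>
    (\<forall>a\<in>carrier A. \<forall>v \<beta>. ghost_path v \<beta> \<longrightarrow> h (\<phi> a \<cdot> ghost v \<beta>) = a \<odot>\<^bsub>M\<^esub> m (v, \<beta>))"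
    using m em by (intro cohn_module_extension[OF M]) fastforce+
  then obtain h where h: "abelian_group_hom C M h"
      "\<And>a v \<beta>. a \<in> carrier A \<Longrightarrow> ghost_path v \<beta> \<Longrightarrow>
        h (\<phi> a \<cdot> ghost v \<beta>) = a \<odot>\<^bsub>M\<^esub> m (v, \<beta>)" by blast
  interpret h: abelian_group_hom C M h by fact
  have "abelian_group_hom (cohn_module \<Gamma>) M h"
    using unital_left_moduleD(1)[OF unital_cohn_module] h.H.abelian_group_axioms
    by (intro abelian_group_hom_intro) (auto simp: cohn_module_eq)
  with h(2) show "\<exists>h. abelian_group_hom (cohn_module \<Gamma>) M h \<and>
      (\<forall>a\<in>carrier A. \<forall>i\<in>{(v, \<beta>). ghost_path v \<beta>}.
        h (a \<odot>\<^bsub>cohn_module \<Gamma>\<^esub> (case i of (v, \<beta>) \<Rightarrow> ghost v \<beta>)) = a \<odot>\<^bsub>M\<^esub> m i)"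
    by (intro exI[of _ h]) (auto simp: cohn_module_eq simp del: path_algebra_simps)
qed (use is_word_ghost ghost_path_vert path_vertex_closed path_vertex_idem ghost_word_vertex in
    \<open>auto simp: cohn_module_eq path_to_cohn_vertex simp del: path_algebra_simps\<close>)

end

section \<open>The kernel of the map to the Leavitt path algebra\<close>

text \<open>At most the summand of index \<open>j\<close> survives, and it cancels \<open>x\<close>;
  if \<open>j\<close> lies outside \<open>S\<close>, both terms are zero.\<close>

lemma (in abelian_group) minus_finsum_single:
  assumes "finite S" "\<And>i. i \<in> S \<Longrightarrow> i \<noteq> j \<Longrightarrow> t i = \<zero>" "t j \<in> carrier G"
    and "x = (if j \<in> S then t j else \<zero>)"
  shows "x \<ominus> finsum G t S = \<zero>"
proof -
  have "finsum G t S = (if j \<in> S then t j else \<zero>)"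
  proof (cases "j \<in> S")
    case True
    have "finsum G t S = finsum G (\<lambda>i. if j = i then t i else \<zero>) S"
      using assms(2,3) by (intro finsum_cong') auto
    also have "\<dots> = t j"
    proof -
      have "finsum G (\<lambda>i. if j = i then t i else \<zero>) S = finsum G (\<lambda>i. if j = i then t j else \<zero>) S"
        using assms(3) by (intro finsum_cong') auto
      also have "\<dots> = t j" using True assms(1,3) by (intro finsum_singleton) auto
      finally show ?thesis .
    qed
    finally show ?thesis using True by simp
  next
    case False
    then have "finsum G t S = finsum G (\<lambda>i. \<zero>) S"
      using assms(2) by (intro finsum_cong') auto
    with False show ?thesis by simp
  qed
  with assms(3,4) show ?thesis by (simp add: a_minus_def r_neg)
qed

context path_digraph
begin

text \<open>This is \<open>q_v\<close>, defined for every vertex. At a sink the sum is empty and the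
  element is the vertex itself, which is why sinks are excluded from the generators of the
  kernel.\<close>

definition ck2 :: "'v \<Rightarrow> ('v, 'e, 'f) cohn_elt" where
  "ck2 v = mono [Vtx v] \<ominus>\<^bsub>C\<^esub> (\<Oplus>\<^bsub>C\<^esub>e\<in>out_arcs \<Gamma> v. mono [Arr e] \<cdot> mono [Gst e])"

lemma ck2_elements_eq: "ck2_elements \<Gamma> = {ck2 v |v. v \<in> verts \<Gamma> \<and> \<not> sink \<Gamma> v}"
  by (simp add: ck2_elements_def ck2_def)

lemma mono_mult: "is_word u \<Longrightarrow> is_word w \<Longrightarrow> mono u \<cdot> mono w = mono (u @ w)"
  by (simp add: mono_append)

lemma ck2_closed [simp]: "v \<in> verts \<Gamma> \<Longrightarrow> ck2 v \<in> carrier C"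
  unfolding ck2_def a_minus_def
  by (intro C.a_closed C.a_inv_closed C.finsum_closed) auto

lemma ck2_elements_closed: "ck2_elements \<Gamma> \<subseteq> carrier C"
  by (auto simp: ck2_elements_eq)

text \<open>Evaluates an additive map at \<open>q_v\<close> through its values on words. It is
  applied to one-sided multiplications, to the identity and to the maps constructed for the
  kernel.\<close>

lemma hom_ck2:
  assumes "abelian_group_hom C N f" "v \<in> verts \<Gamma>"
  shows "f (ck2 v) = f (mono [Vtx v]) \<ominus>\<^bsub>N\<^esub> (\<Oplus>\<^bsub>N\<^esub>e\<in>out_arcs \<Gamma> v. f (mono [Arr e, Gst e]))"
proof -
  interpret f: abelian_group_hom C N f by fact
  have arcs: "mono [Arr e] \<cdot> mono [Gst e] = mono [Arr e, Gst e]"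
      "mono [Arr e, Gst e] \<in> carrier C" if "e \<in> out_arcs \<Gamma> v" for e
    using that by (simp_all add: mono_mult is_word_def)
  have "(\<Oplus>\<^bsub>C\<^esub>e\<in>out_arcs \<Gamma> v. mono [Arr e] \<cdot> mono [Gst e]) =
      (\<Oplus>\<^bsub>C\<^esub>e\<in>out_arcs \<Gamma> v. mono [Arr e, Gst e])"
    using arcs by (intro C.finsum_cong') auto
  then have ck2: "ck2 v = mono [Vtx v] \<oplus>\<^bsub>C\<^esub> \<ominus>\<^bsub>C\<^esub> (\<Oplus>\<^bsub>C\<^esub>e\<in>out_arcs \<Gamma> v. mono [Arr e, Gst e])"
    by (simp add: ck2_def a_minus_def)
  have sum: "(\<Oplus>\<^bsub>C\<^esub>e\<in>out_arcs \<Gamma> v. mono [Arr e, Gst e]) \<in> carrier C"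
    using arcs by (intro C.finsum_closed) auto
  have "f (\<Oplus>\<^bsub>C\<^esub>e\<in>out_arcs \<Gamma> v. mono [Arr e, Gst e]) = (\<Oplus>\<^bsub>N\<^esub>e\<in>out_arcs \<Gamma> v. f (mono [Arr e, Gst e]))"
    using arcs by (intro f.hom_finsum) auto
  then show ?thesis
    using sum assms(2) by (simp add: ck2 a_minus_def[of N])
qed

lemma mono_eqI:
  assumes "is_word w" "is_word w'" "steps w One = (if P then steps w' One else Zero)"
  shows "mono w = (if P then mono w' else \<zero>\<^bsub>C\<^esub>)"
  using cls_single_eq[OF assms(1,2)] cls_single_zero[OF assms(1)] assms(3) by (cases P) simp_all

lemma short_words:
  assumes "v \<in> verts \<Gamma>" "e \<in> arcs \<Gamma>" "f \<in> arcs \<Gamma>"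
  shows "mono [Gst f, Vtx v] = (if tail \<Gamma> f = v then mono [Gst f] else \<zero>\<^bsub>C\<^esub>)"
    and "mono [Gst f, Arr e, Gst e] = (if e = f then mono [Gst f] else \<zero>\<^bsub>C\<^esub>)"
    and "mono [Vtx v, Arr f] = (if tail \<Gamma> f = v then mono [Arr f] else \<zero>\<^bsub>C\<^esub>)"
    and "mono [Arr e, Gst e, Arr f] = (if e = f then mono [Arr f] else \<zero>\<^bsub>C\<^esub>)"
    and "mono [Vtx v, Arr e, Gst e] = (if tail \<Gamma> e = v then mono [Arr e, Gst e] else \<zero>\<^bsub>C\<^esub>)"
    and "mono [Arr e, Gst e, Vtx v] = (if tail \<Gamma> e = v then mono [Arr e, Gst e] else \<zero>\<^bsub>C\<^esub>)"
  by (rule mono_eqI; use assms in \<open>auto simp: is_word_def\<close>)+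

end

locale row_finite_digraph = path_digraph \<Gamma> scalars
  for \<Gamma> :: "('v, 'e) pre_digraph" and scalars :: "'f::field itself" +
  assumes row_finite: "row_finite \<Gamma>"
begin

lemma finite_out_arcs: "v \<in> verts \<Gamma> \<Longrightarrow> finite (out_arcs \<Gamma> v)"
  using row_finite by (simp add: row_finite_def)

text \<open>Among the products \<open>f^* e e^*\<close> only the one with \<open>e = f\<close> is
  nonzero, and it cancels \<open>f^* v\<close>. If \<open>f\<close> does not start at
  \<open>v\<close>, every term vanishes.\<close>

lemma ghost_ck2:
  assumes "v \<in> verts \<Gamma>" "f \<in> arcs \<Gamma>"
  shows "mono [Gst f] \<cdot> ck2 v = \<zero>\<^bsub>C\<^esub>"
proof -
  have "mono [Gst f] \<cdot> ck2 v = mono [Gst f] \<cdot> mono [Vtx v] \<ominus>\<^bsub>C\<^esub>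
      (\<Oplus>\<^bsub>C\<^esub>e\<in>out_arcs \<Gamma> v. mono [Gst f] \<cdot> mono [Arr e, Gst e])"
    using assms by (intro hom_ck2 C.mult_left_hom) auto
  also have "\<dots> = \<zero>\<^bsub>C\<^esub>"
    using assms finite_out_arcs short_words(1,2)
    by (intro C.minus_finsum_single[where j=f]) (auto simp: mono_mult is_word_def)
  finally show ?thesis .
qed

lemma ck2_arrow:
  assumes "v \<in> verts \<Gamma>" "f \<in> arcs \<Gamma>"
  shows "ck2 v \<cdot> mono [Arr f] = \<zero>\<^bsub>C\<^esub>"
proof -
  have "ck2 v \<cdot> mono [Arr f] = mono [Vtx v] \<cdot> mono [Arr f] \<ominus>\<^bsub>C\<^esub>
      (\<Oplus>\<^bsub>C\<^esub>e\<in>out_arcs \<Gamma> v. mono [Arr e, Gst e] \<cdot> mono [Arr f])"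
    using assms by (intro hom_ck2[where f="\<lambda>x. x \<cdot> mono [Arr f]"] C.mult_right_hom) auto
  also have "\<dots> = \<zero>\<^bsub>C\<^esub>"
    using assms finite_out_arcs short_words(3,4)
    by (intro C.minus_finsum_single[where j=f]) (auto simp: mono_mult is_word_def)
  finally show ?thesis .
qed

lemma vertex_ck2:
  assumes "u \<in> verts \<Gamma>" "v \<in> verts \<Gamma>"
  shows "mono [Vtx u] \<cdot> ck2 v = (if u = v then ck2 v else \<zero>\<^bsub>C\<^esub>)"
proof -
  have "mono [Vtx u] \<cdot> ck2 v = mono [Vtx u] \<cdot> mono [Vtx v] \<ominus>\<^bsub>C\<^esub>
      (\<Oplus>\<^bsub>C\<^esub>e\<in>out_arcs \<Gamma> v. mono [Vtx u] \<cdot> mono [Arr e, Gst e])"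
    using assms by (intro hom_ck2 C.mult_left_hom) auto
  also have "(\<Oplus>\<^bsub>C\<^esub>e\<in>out_arcs \<Gamma> v. mono [Vtx u] \<cdot> mono [Arr e, Gst e]) =
      (\<Oplus>\<^bsub>C\<^esub>e\<in>out_arcs \<Gamma> v. if u = v then mono [Arr e, Gst e] else \<zero>\<^bsub>C\<^esub>)"
    using assms short_words(5)
    by (intro C.finsum_cong') (auto simp: mono_mult is_word_def)
  also have "mono [Vtx u] \<cdot> mono [Vtx v] = (if u = v then mono [Vtx v] else \<zero>\<^bsub>C\<^esub>)"
    using assms cohn_relations(1) by (simp add: mono_mult is_word_def)
  finally show ?thesis
    using hom_ck2[OF C.abelian_group_hom_id assms(2)] by (auto simp: a_minus_def[of C] C.r_neg)
qed

lemma ck2_vertex: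
  assumes "u \<in> verts \<Gamma>" "v \<in> verts \<Gamma>"
  shows "ck2 v \<cdot> mono [Vtx u] = (if u = v then ck2 v else \<zero>\<^bsub>C\<^esub>)"
proof -
  have "ck2 v \<cdot> mono [Vtx u] = mono [Vtx v] \<cdot> mono [Vtx u] \<ominus>\<^bsub>C\<^esub>
      (\<Oplus>\<^bsub>C\<^esub>e\<in>out_arcs \<Gamma> v. mono [Arr e, Gst e] \<cdot> mono [Vtx u])"
    using assms by (intro hom_ck2[where f="\<lambda>x. x \<cdot> mono [Vtx u]"] C.mult_right_hom) auto
  also have "(\<Oplus>\<^bsub>C\<^esub>e\<in>out_arcs \<Gamma> v. mono [Arr e, Gst e] \<cdot> mono [Vtx u]) =
      (\<Oplus>\<^bsub>C\<^esub>e\<in>out_arcs \<Gamma> v. if u = v then mono [Arr e, Gst e] else \<zero>\<^bsub>C\<^esub>)"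
    using assms short_words(6)
    by (intro C.finsum_cong') (auto simp: mono_mult is_word_def)
  also have "mono [Vtx v] \<cdot> mono [Vtx u] = (if u = v then mono [Vtx v] else \<zero>\<^bsub>C\<^esub>)"
    using assms cohn_relations(1) by (simp add: mono_mult is_word_def)
  finally show ?thesis
    using hom_ck2[OF C.abelian_group_hom_id assms(2)] by (auto simp: a_minus_def[of C] C.r_neg)
qed

section \<open>Generators of the kernel as a left module\<close>

sublocale CI: scalar_rng_ideal C "ck2_ideal \<Gamma>"
  unfolding scalar_rng_ideal_def scalar_rng_ideal_axioms_def ck2_ideal_def
  using C.alg_ideal_alg_ideal_gen[OF ck2_elements_closed] C.scalar_rng_axioms by simp

lemma ck2_in_ideal: "v \<in> verts \<Gamma> \<Longrightarrow> \<not> sink \<Gamma> v \<Longrightarrow> ck2 v \<in> ck2_ideal \<Gamma>"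
  using C.alg_ideal_gen_incl[of "ck2_elements \<Gamma>"] unfolding ck2_ideal_def ck2_elements_eq by auto

text \<open>The sandwiched products span an ideal. In the absence of a unit it contains
  \<open>q_v\<close> because \<open>q_v = v q_v v\<close>.\<close>

lemma ck2_ideal_sandwich:
  "ck2_ideal \<Gamma> \<subseteq> additive_span C {(c \<cdot> ck2 v) \<cdot> d |c v d.
    c \<in> carrier C \<and> d \<in> carrier C \<and> v \<in> verts \<Gamma> \<and> \<not> sink \<Gamma> v}" (is "_ \<subseteq> additive_span C ?S")
  unfolding ck2_ideal_def
proof (rule C.alg_ideal_gen_minimal)
  have S: "?S \<subseteq> carrier C" by auto
  have elim: "\<exists>c v d. y = (c \<cdot> ck2 v) \<cdot> d \<and> c \<in> carrier C \<and> d \<in> carrier C \<and>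
      v \<in> verts \<Gamma> \<and> \<not> sink \<Gamma> v" if "y \<in> ?S" for y
    using that by blast
  show "alg_ideal C (additive_span C ?S)"
  proof (rule C.alg_ideal_additive_span[OF S])
    fix r y k assume "y \<in> ?S"
    from elim[OF this] obtain c v d where y: "y = (c \<cdot> ck2 v) \<cdot> d" "c \<in> carrier C"
      "d \<in> carrier C" "v \<in> verts \<Gamma>" "\<not> sink \<Gamma> v" by blast
    have "k \<odot>\<^bsub>C\<^esub> y = ((k \<odot>\<^bsub>C\<^esub> c) \<cdot> ck2 v) \<cdot> d"
      using y by (simp add: C.scale_mult_left)
    with y show "k \<odot>\<^bsub>C\<^esub> y \<in> additive_span C ?S"
      using C.scale_closed[of c k] by (intro generate.incl CollectI exI conjI)
    assume r: "r \<in> carrier C"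
    then have "r \<cdot> y = ((r \<cdot> c) \<cdot> ck2 v) \<cdot> d"
      using y by (simp add: C.mult_assoc)
    with y r show "r \<cdot> y \<in> additive_span C ?S"
      using C.mult_closed[of r c] by (intro generate.incl CollectI exI conjI)
    have "y \<cdot> r = (c \<cdot> ck2 v) \<cdot> (d \<cdot> r)"
      using y r by (simp add: C.mult_assoc)
    with y r show "y \<cdot> r \<in> additive_span C ?S"
      using C.mult_closed[of d r] by (intro generate.incl CollectI exI conjI)
  qed
  show "ck2_elements \<Gamma> \<subseteq> additive_span C ?S"
  proof
    fix x :: "('v, 'e, 'f) cohn_elt" assume "x \<in> ck2_elements \<Gamma>"
    then obtain v where v: "x = ck2 v" "v \<in> verts \<Gamma>" "\<not> sink \<Gamma> v" by (auto simp: ck2_elements_eq)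
    then have "x = (mono [Vtx v] \<cdot> ck2 v) \<cdot> mono [Vtx v]" "mono [Vtx v] \<in> carrier C"
      by (simp_all add: vertex_ck2 ck2_vertex)
    with v show "x \<in> additive_span C ?S" by (intro generate.incl) blast
  qed
qed

text \<open>The rightmost ghost arrow meets \<open>q_v\<close> and the product is zero; only a
  trivial ghost path survives.\<close>

lemma ghost_word_ck2:
  assumes "ghost_path u \<beta>" "v \<in> verts \<Gamma>"
  shows "ghost u \<beta> \<cdot> ck2 v = (if u = v \<and> \<beta> = [] then ck2 v else \<zero>\<^bsub>C\<^esub>)"
proof (cases \<beta> rule: rev_cases)
  case Nil
  then show ?thesis using assms by (simp add: ghost_word_def vertex_ck2)
next
  case (snoc \<beta>' f)
  then have f: "f \<in> arcs \<Gamma>" "set \<beta>' \<subseteq> arcs \<Gamma>" using ghost_path_arcs[OF assms(1)] by auto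
  show ?thesis
  proof (cases "\<beta>' = []")
    case True
    then show ?thesis using snoc f assms by (simp add: ghost_word_def ghost_ck2)
  next
    case False
    then have w: "is_word (map Gst \<beta>')" using f by (auto simp: is_word_def)
    have "ghost u \<beta> = mono (map Gst \<beta>') \<cdot> mono [Gst f]"
      using w f snoc by (simp add: ghost_word_def mono_mult is_word_single)
    then have "ghost u \<beta> \<cdot> ck2 v = mono (map Gst \<beta>') \<cdot> (mono [Gst f] \<cdot> ck2 v)"
      using w f assms(2) by (simp add: C.mult_assoc)
    then show ?thesis using w f assms(2) snoc by (simp add: ghost_ck2)
  qed
qed

text \<open>For a monomial \<open>a b^*\<close> the product \<open>a b^* q_v\<close> is zero unless
  \<open>b\<close> is trivial, so ghost arrows contribute nothing on the left of
  \<open>q_v\<close>.\<close>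

lemma left_multiples_ck2:
  assumes v: "v \<in> verts \<Gamma>" and c: "c \<in> carrier C"
  shows "\<exists>a\<in>carrier A. c \<cdot> ck2 v = \<phi> a \<cdot> ck2 v"
proof -
  have hom: "abelian_group_hom A C (\<lambda>a. \<phi> a \<cdot> ck2 v)"
    using v by (intro abelian_group_hom_compose[OF path_to_cohn_hom] C.mult_right_hom) simp
  interpret h: abelian_group_hom A C "\<lambda>a. \<phi> a \<cdot> ck2 v" by (rule hom)
  let ?K = "(\<lambda>a. \<phi> a \<cdot> ck2 v) ` carrier A"
  have K: "additive_subgroup ?K C"
    by (rule h.additive_subgroup_image, rule A.additive_subgroup_criterion)
      (auto simp del: path_algebra_simps)
  have "c \<cdot> ck2 v \<in> ?K"
  proof (rule abelian_group_hom.additive_span_hom[OF C.mult_right_hom _ K])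
    show "c \<in> additive_span C {cls (single w k) |w k. is_word w}"
      using c cohn_span by blast
    show "{cls (single w k) |w k. is_word w} \<subseteq> carrier C" by auto
    show "x \<cdot> ck2 v \<in> ?K" if x: "x \<in> {cls (single w k) |w k. is_word w}" for x
    proof -
      obtain w k where "is_word w" "x = cls (single w k)" using x by auto
      then consider "x = \<zero>\<^bsub>C\<^esub>"
        | \<alpha> u \<beta> where "path_to \<alpha> u" "ghost_path u \<beta>"
          "x = \<phi> (path_elem \<alpha> u k) \<cdot> ghost u \<beta>"
        using word_factor by metis
      then show ?thesis
      proof cases
        case 1
        then show ?thesis using v additive_subgroup.zero_closed[OF K] by simp
      next
        case 2
        have a: "path_elem \<alpha> u k \<in> carrier A" by (rule single_path_closed[OF 2(1)])
        have "x \<cdot> ck2 v = \<phi> (path_elem \<alpha> u k) \<cdot>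
            (if u = v \<and> \<beta> = [] then ck2 v else \<zero>\<^bsub>C\<^esub>)"
          using 2 v \<phi>.hom_closed[OF a] is_word_ghost[OF 2(2)]
          by (simp add: C.mult_assoc ghost_word_ck2)
        with a \<phi>.hom_closed[OF a] show ?thesis
          using additive_subgroup.zero_closed[OF K] by (auto simp del: path_algebra_simps)
      qed
    qed
  qed (use v in simp)
  then show ?thesis by auto
qed

text \<open>The multipliers \<open>a\<close> are included, so that the additive span is closed under
  the path algebra.\<close>

definition ck2_generators :: "('v, 'e, 'f) cohn_elt set" where
  "ck2_generators = {\<phi> a \<cdot> (ck2 v \<cdot> ghost v \<beta>) |a v \<beta>.
    a \<in> carrier A \<and> ghost_path v \<beta> \<and> \<not> sink \<Gamma> v}"

lemma ck2_ghost_closed: "ghost_path v \<beta> \<Longrightarrow> ck2 v \<cdot> ghost v \<beta> \<in> carrier C"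
  using ghost_path_vert is_word_ghost by (intro C.mult_closed ck2_closed mono_closed) auto

lemma ck2_generators_closed: "ck2_generators \<subseteq> carrier C"
  unfolding ck2_generators_def
  by (auto intro!: C.mult_closed[OF \<phi>.hom_closed ck2_ghost_closed] simp del: path_algebra_simps)

text \<open>If the reduced form begins with an arrow, \<open>q_v\<close> annihilates it. Otherwise
  it is a ghost path, and \<open>q_v = q_v v\<close> leaves only those starting at
  \<open>v\<close>.\<close>

lemma ck2_word:
  assumes v: "v \<in> verts \<Gamma>" and w: "is_word w"
  shows "ck2 v \<cdot> mono w = \<zero>\<^bsub>C\<^esub> \<or>
    (\<exists>\<beta>. ghost_path v \<beta> \<and> ck2 v \<cdot> mono w = ck2 v \<cdot> ghost v \<beta>)"
proof (cases "steps w One")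
  case Zero
  then show ?thesis using v cls_single_zero[OF w] by simp
next
  case One
  then show ?thesis using w steps_not_One by (auto simp: is_word_def)
next
  case (Mon \<alpha> u \<beta>)
  have "wf_state (steps w One)" using w by (intro wf_steps) (auto simp: is_word_def)
  then have wf: "path_to \<alpha> u" "ghost_path u \<beta>" using Mon by auto
  define y where "y = ghost u \<beta>"
  have y: "y \<in> carrier C" using is_word_ghost[OF wf(2)] by (simp add: y_def)
  have w_eq: "mono w = path_act \<alpha> y" using mono_eq_state_elt[OF w] Mon by (simp add: y_def)
  show ?thesis
  proof (cases \<alpha>)
    case Nil
    have "ck2 v \<cdot> y = (ck2 v \<cdot> mono [Vtx u]) \<cdot> y"
      using v y ghost_path_vert[OF wf(2)] ghost_word_vertex[OF wf(2)] by (simp add: C.mult_assoc y_def)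
    also have "\<dots> = (if u = v then ck2 v \<cdot> y else \<zero>\<^bsub>C\<^esub>)"
      using v y ghost_path_vert[OF wf(2)] by (simp add: ck2_vertex)
    finally show ?thesis using w_eq Nil wf(2) by (cases "u = v") (auto simp: y_def)
  next
    case (Cons f \<alpha>')
    have f: "f \<in> arcs \<Gamma>" "path_act \<alpha>' y \<in> carrier C"
      using wf(1) Cons y path_to_arcs[OF wf(1)] by (auto intro!: path_act_closed)
    have "ck2 v \<cdot> mono w = (ck2 v \<cdot> mono [Arr f]) \<cdot> path_act \<alpha>' y"
      using w_eq Cons f v by (simp add: C.mult_assoc)
    then show ?thesis using f v by (simp add: ck2_arrow)
  qed
qed

lemma right_multiples_ck2:
  assumes v: "v \<in> verts \<Gamma>" "\<not> sink \<Gamma> v" and d: "d \<in> carrier C"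
  shows "ck2 v \<cdot> d \<in> additive_span C ck2_generators"
proof (rule abelian_group_hom.additive_span_hom[OF C.mult_left_hom])
  show "d \<in> additive_span C {cls (single w k) |w k. is_word w}"
    using d cohn_span by blast
  show "{cls (single w k) |w k. is_word w} \<subseteq> carrier C" by auto
  show K: "additive_subgroup (additive_span C ck2_generators) C"
    by (rule C.additive_subgroup_span[OF ck2_generators_closed])
  show "ck2 v \<cdot> x \<in> additive_span C ck2_generators"
    if x: "x \<in> {cls (single w k) |w k. is_word w}" for x
  proof -
    obtain w k where w: "is_word w" "x = cls (single w k)" using x by auto
    have x_eq: "ck2 v \<cdot> x = k \<odot>\<^bsub>C\<^esub> (ck2 v \<cdot> mono w)"
      using v w cls_single[OF w(1), of k] by (simp add: C.scale_mult_right)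
    from ck2_word[OF v(1) w(1)] show ?thesis
    proof (elim disjE exE conjE)
      assume "ck2 v \<cdot> mono w = \<zero>\<^bsub>C\<^esub>"
      then show ?thesis
        using x_eq abelian_group_hom.hom_zero[OF C.scale_hom] additive_subgroup.zero_closed[OF K] by simp
    next
      fix \<beta> assume \<beta>: "ghost_path v \<beta>"
        and eq: "ck2 v \<cdot> mono w = ck2 v \<cdot> ghost v \<beta>"
      \<comment> \<open>The scalar is moved to the left of \<open>q_v\<close> as the element
        \<open>k v\<close> of the path algebra.\<close>
      let ?z = "ck2 v \<cdot> ghost v \<beta>" and ?a = "single (src [] v, []) k"
      have a: "?a \<in> carrier A" using single_path_closed[of "[]" v k] v(1) by simp
      have "\<phi> ?a = k \<odot>\<^bsub>C\<^esub> mono [Vtx v]"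
        using v(1) cls_single[of "[Vtx v]" k] by (simp add: path_to_cohn_single path_word.simps is_word_def)
      then have "\<phi> ?a \<cdot> ?z = k \<odot>\<^bsub>C\<^esub> ((mono [Vtx v] \<cdot> ck2 v) \<cdot> ghost v \<beta>)"
        using v(1) is_word_ghost[OF \<beta>] by (simp add: C.scale_mult_left C.mult_assoc)
      then have "ck2 v \<cdot> x = \<phi> ?a \<cdot> ?z"
        using x_eq eq v(1) by (simp add: vertex_ck2)
      then have "ck2 v \<cdot> x \<in> ck2_generators"
        using a \<beta> v(2) unfolding ck2_generators_def by blast
      then show ?thesis by (rule generate.incl)
    qed
  qed
qed (use v in simp)

lemma ck2_generators_action:
  assumes a: "a \<in> carrier A" and x: "x \<in> additive_span C ck2_generators"
  shows "\<phi> a \<cdot> x \<in> additive_span C ck2_generators"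
proof (rule abelian_group_hom.additive_span_hom[OF C.mult_left_hom[OF \<phi>.hom_closed[OF a]] ck2_generators_closed _ _ x])
  show "additive_subgroup (additive_span C ck2_generators) C"
    by (rule C.additive_subgroup_span[OF ck2_generators_closed])
  fix y assume "y \<in> ck2_generators"
  then obtain b v \<beta> where y: "y = \<phi> b \<cdot> (ck2 v \<cdot> ghost v \<beta>)" "b \<in> carrier A"
      "ghost_path v \<beta>" "\<not> sink \<Gamma> v"
    unfolding ck2_generators_def by blast
  have "\<phi> a \<cdot> y = \<phi> (a \<otimes>\<^bsub>A\<^esub> b) \<cdot> (ck2 v \<cdot> ghost v \<beta>)"
    using y(1) C.mult_assoc[OF \<phi>.hom_closed[OF a] \<phi>.hom_closed[OF y(2)] ck2_ghost_closed[OF y(3)]]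
      path_to_cohn_mult[OF a y(2)] by simp
  then have "\<phi> a \<cdot> y \<in> ck2_generators"
    using A.mult_closed[OF a y(2)] y(3,4) unfolding ck2_generators_def by blast
  then show "\<phi> a \<cdot> y \<in> additive_span C ck2_generators" by (rule generate.incl)
qed

text \<open>In \<open>c q_v d\<close> the factor \<open>c\<close> may be replaced by a path element;
  then \<open>q_v d\<close> is expanded, and the path element acts on the resulting
  generators.\<close>

lemma ck2_ideal_generated: "ck2_ideal \<Gamma> \<subseteq> additive_span C ck2_generators"
proof -
  have "(c \<cdot> ck2 v) \<cdot> d \<in> additive_span C ck2_generators"
    if cd: "c \<in> carrier C" "d \<in> carrier C" "v \<in> verts \<Gamma>" "\<not> sink \<Gamma> v" for c d v
  proof -
    obtain a where a: "a \<in> carrier A" "c \<cdot> ck2 v = \<phi> a \<cdot> ck2 v"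
      using left_multiples_ck2 cd by blast
    then have "(c \<cdot> ck2 v) \<cdot> d = \<phi> a \<cdot> (ck2 v \<cdot> d)"
      using cd C.mult_assoc[OF \<phi>.hom_closed[OF a(1)]] by simp
    then show ?thesis
      using ck2_generators_action[OF a(1)] right_multiples_ck2 cd by simp
  qed
  then show ?thesis
    by (intro subset_trans[OF ck2_ideal_sandwich] C.additive_span_minimal
        C.additive_subgroup_span[OF ck2_generators_closed]) blast
qed

lemma ck2_ghost_in_ideal:
  "ghost_path v \<beta> \<Longrightarrow> \<not> sink \<Gamma> v \<Longrightarrow> ck2 v \<cdot> ghost v \<beta> \<in> ck2_ideal \<Gamma>"
  using ghost_path_vert is_word_ghost by (intro CI.ideal_mult(2) mono_closed ck2_in_ideal) auto

lemma ck2_generators_ideal: "ck2_generators \<subseteq> ck2_ideal \<Gamma>"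
  unfolding ck2_generators_def
  using CI.ideal_mult(1)[OF \<phi>.hom_closed ck2_ghost_in_ideal] by blast

section \<open>Additive maps with prescribed values on the generators of the kernel\<close>

definition chosen_arrow :: "'v \<Rightarrow> 'e" where
  "chosen_arrow v = (SOME e. e \<in> out_arcs \<Gamma> v)"

lemma chosen_arrow: "\<not> sink \<Gamma> v \<Longrightarrow> chosen_arrow v \<in> out_arcs \<Gamma> v"
  unfolding chosen_arrow_def sink_def by (rule someI_ex) auto

text \<open>
  The value on \<open>\<alpha>\<beta>\<^sup>*\<close> of the additive map sending every \<open>\<alpha>(ck2 v)\<beta>\<^sup>*\<close> to \<open>\<alpha> m\<^sub>v\<^sub>\<beta>\<close>. With \<open>\<beta>\<close> reversed, a
  common last arrow of the two paths is \<open>last \<alpha>\<close> and the head of \<open>\<beta>\<close>.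
\<close>

primrec strip ::
  "(('v, 'e, 'f) path_elt, 'm) module \<Rightarrow> ('v \<Rightarrow> 'e list \<Rightarrow> 'm) \<Rightarrow> 'e list \<Rightarrow> 'e list \<Rightarrow> 'f \<Rightarrow> 'm" where
  "strip M m [] \<alpha> k = \<zero>\<^bsub>M\<^esub>"
| "strip M m (e # \<beta>) \<alpha> k =
    (if \<alpha> \<noteq> [] \<and> last \<alpha> = e \<and> e = chosen_arrow (tail \<Gamma> e)
     then strip M m \<beta> (butlast \<alpha>) k \<ominus>\<^bsub>M\<^esub>
       single (src (butlast \<alpha>) (tail \<Gamma> e), butlast \<alpha>) k \<odot>\<^bsub>M\<^esub> m (tail \<Gamma> e) \<beta>
     else \<zero>\<^bsub>M\<^esub>)"

lemma nonsink_tail: "e \<in> arcs \<Gamma> \<Longrightarrow> \<not> sink \<Gamma> (tail \<Gamma> e)"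
  by (auto simp: sink_def)

text \<open>The map is defined on all of \<open>C\<close>, by \<open>strip\<close> on monomials. The
  element \<open>a q_v b^*\<close> is \<open>a b^*\<close> minus the monomials with one arrow
  \<open>e\<close> appended to both paths. Of these only the one with the chosen arrow can have a
  nonzero value, namely the value of \<open>a b^*\<close> minus \<open>a m\<close>. The values of
  \<open>a b^*\<close> cancel and \<open>a m\<close> remains.\<close>

lemma ck2_ideal_extension:
  assumes M: "unital_left_module A M"
    and m: "\<And>v \<beta>. ghost_path v \<beta> \<Longrightarrow> \<not> sink \<Gamma> v \<Longrightarrow> m v \<beta> \<in> carrier M"
    and em: "\<And>v \<beta>. ghost_path v \<beta> \<Longrightarrow> \<not> sink \<Gamma> v \<Longrightarrow> path_vertex v \<odot>\<^bsub>M\<^esub> m v \<beta> = m v \<beta>"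
  shows "\<exists>h. abelian_group_hom C M h \<and> (\<forall>a\<in>carrier A. \<forall>v \<beta>. ghost_path v \<beta> \<longrightarrow> \<not> sink \<Gamma> v \<longrightarrow>
    h (\<phi> a \<cdot> (ck2 v \<cdot> ghost v \<beta>)) = a \<odot>\<^bsub>M\<^esub> m v \<beta>)"
proof -
  note MD = unital_left_moduleD[OF M]
  interpret M: abelian_group M by (rule MD(1))
  have split: "path_to (butlast \<alpha>) (tail \<Gamma> e) \<and> e \<in> arcs \<Gamma>"
    if "path_to \<alpha> v" "\<alpha> \<noteq> []" "last \<alpha> = e" for \<alpha> v e
    using that by (cases \<alpha> rule: rev_cases) (auto simp: path_to_snoc)
  have closed: "strip M m \<beta> \<alpha> k \<in> carrier M" if "path_to \<alpha> v" "ghost_path v \<beta>" for \<alpha> v \<beta> k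
    using that
  proof (induction \<beta> arbitrary: \<alpha> v)
    case (Cons e \<beta>)
    then show ?case
      using split[of \<alpha> v e] nonsink_tail
      by (auto intro!: M.minus_closed MD(2) m single_path_closed simp del: path_algebra_simps)
  qed simp
  have add: "strip M m \<beta> \<alpha> (k + l) = strip M m \<beta> \<alpha> k \<oplus>\<^bsub>M\<^esub> strip M m \<beta> \<alpha> l"
    if "path_to \<alpha> v" "ghost_path v \<beta>" for \<alpha> v \<beta> k l
    using that
  proof (induction \<beta> arbitrary: \<alpha> v)
    case (Cons e \<beta>)
    show ?case
    proof (cases "\<alpha> \<noteq> [] \<and> last \<alpha> = e \<and> e = chosen_arrow (tail \<Gamma> e)")
      case True
      let ?a = "\<lambda>k. single (src (butlast \<alpha>) (tail \<Gamma> e), butlast \<alpha>) k"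
      have p: "path_to (butlast \<alpha>) (tail \<Gamma> e)" "e \<in> arcs \<Gamma>" using split[of \<alpha> v e] Cons.prems True by auto
      have g: "ghost_path (tail \<Gamma> e) \<beta>" using Cons.prems by simp
      have x: "m (tail \<Gamma> e) \<beta> \<in> carrier M" using m[OF g nonsink_tail[OF p(2)]] .
      have a: "?a j \<in> carrier A" for j by (rule single_path_closed[OF p(1)])
      have "?a (k + l) \<odot>\<^bsub>M\<^esub> m (tail \<Gamma> e) \<beta> =
          ?a k \<odot>\<^bsub>M\<^esub> m (tail \<Gamma> e) \<beta> \<oplus>\<^bsub>M\<^esub> ?a l \<odot>\<^bsub>M\<^esub> m (tail \<Gamma> e) \<beta>"
        using MD(3)[OF a a x, of k l] by (simp add: single_add)
      then show ?thesis
        using True Cons.IH[OF p(1) g] closed[OF p(1) g] MD(2)[OF a x]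
        by (simp add: a_minus_def M.minus_add M.a_ac)
    qed auto
  qed simp
  define \<theta> where "\<theta> = (\<lambda>s k. case s of
      Mon \<alpha> v \<beta> \<Rightarrow> if path_to \<alpha> v \<and> ghost_path v \<beta> then strip M m \<beta> \<alpha> k else \<zero>\<^bsub>M\<^esub>
    | _ \<Rightarrow> \<zero>\<^bsub>M\<^esub>)"
  have \<theta>: "\<theta> s k \<in> carrier M" "\<theta> s (k + l) = \<theta> s k \<oplus>\<^bsub>M\<^esub> \<theta> s l" for s k l
    using closed add by (auto simp: \<theta>_def split: state.split)
  then have "zero_preserving M \<theta>"
    unfolding zero_preserving_def additive_family_def additive_family_axioms_def
    using MD(1) by (auto simp: \<theta>_def)
  from cohn_lift[OF MD(1) this] obtain h where h: "abelian_group_hom C M h"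
      "\<And>w k. is_word w \<Longrightarrow> h (cls (single w k)) = \<theta> (steps w One) k"
    by blast
  have "h (\<phi> a \<cdot> (ck2 v \<cdot> ghost v \<beta>)) = a \<odot>\<^bsub>M\<^esub> m v \<beta>"
    if a: "a \<in> carrier A" and \<beta>: "ghost_path v \<beta>" and v: "\<not> sink \<Gamma> v" for a v \<beta>
  proof (rule path_algebra_hom_eq[OF _ _ a])
    have vv: "v \<in> verts \<Gamma>" by (rule ghost_path_vert[OF \<beta>])
    have G: "is_word (ghost_word v \<beta>)" by (rule is_word_ghost[OF \<beta>])
    show "abelian_group_hom A M (\<lambda>a. h (\<phi> a \<cdot> (ck2 v \<cdot> ghost v \<beta>)))"
      by (intro abelian_group_hom_compose[OF _ h(1)] abelian_group_hom_compose[OF path_to_cohn_hom]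
          C.mult_right_hom ck2_ghost_closed[OF \<beta>])
    show "abelian_group_hom A M (\<lambda>a. a \<odot>\<^bsub>M\<^esub> m v \<beta>)"
      by (rule module_orbit_hom[OF M A.abelian_group_axioms m[OF \<beta> v]])
    fix \<alpha> u and k :: 'f assume \<alpha>: "path_to \<alpha> u"
    let ?a = "path_elem \<alpha> u k" and ?w = "path_word (src \<alpha> u, \<alpha>)"
    have W: "is_word ?w" by (rule is_word_path[OF \<alpha>])
    have ac: "\<phi> ?a \<in> carrier C" by (rule \<phi>.hom_closed[OF single_path_closed[OF \<alpha>]])
    \<comment> \<open>With the middle factor as the variable, \<open>hom_ck2\<close> expands
      \<open>ck2 v\<close> in place.\<close>
    define F where "F = (\<lambda>x. h (\<phi> ?a \<cdot> (x \<cdot> ghost v \<beta>)))"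
    have F: "abelian_group_hom C M F"
      unfolding F_def using G ac
      by (intro abelian_group_hom_compose[OF _ h(1)] abelian_group_hom_compose[OF C.mult_right_hom]
          C.mult_left_hom mono_closed)
    have F_word: "F (mono w) = \<theta> (steps (?w @ w @ ghost_word v \<beta>) One) k" if "is_word w" for w
      using that G W by (simp add: F_def mono_mult path_to_cohn_single mono_append is_word_append h(2))
    have "h (\<phi> ?a \<cdot> (ck2 v \<cdot> ghost v \<beta>)) = F (ck2 v)" by (simp add: F_def)
    also have "\<dots> = F (mono [Vtx v]) \<ominus>\<^bsub>M\<^esub> (\<Oplus>\<^bsub>M\<^esub>e\<in>out_arcs \<Gamma> v. F (mono [Arr e, Gst e]))"
      by (rule hom_ck2[OF F vv])
    also have "\<dots> = ?a \<odot>\<^bsub>M\<^esub> m v \<beta>"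
    proof (cases "u = v")
      \<comment> \<open>The path does not end at \<open>v\<close>, so every term on the left is
        zero, and so is its action on \<open>m v \<beta>\<close>.\<close>
      case False
      have "F (mono [Vtx v]) = \<zero>\<^bsub>M\<^esub>"
        using False \<alpha> \<beta> vv by (simp add: F_word is_word_def steps_ghost_word steps_path_word \<theta>_def)
      moreover have "(\<Oplus>\<^bsub>M\<^esub>e\<in>out_arcs \<Gamma> v. F (mono [Arr e, Gst e])) = (\<Oplus>\<^bsub>M\<^esub>e\<in>out_arcs \<Gamma> v. \<zero>\<^bsub>M\<^esub>)"
        using False \<alpha> \<beta>
        by (intro M.finsum_cong') (auto simp: F_word is_word_def steps_ghost_word steps_path_word \<theta>_def)
      ultimately show ?thesis
        using action_zero[OF M m[OF \<beta> v] em[OF \<beta> v] vv \<alpha> False, of k]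
        by (simp add: a_minus_def M.r_neg)
    next
      case True
      let ?x = "?a \<odot>\<^bsub>M\<^esub> m v \<beta>" and ?t = "strip M m \<beta> \<alpha> k" and ?f = "chosen_arrow v"
      have x: "?x \<in> carrier M" by (rule MD(2)[OF single_path_closed[OF \<alpha>] m[OF \<beta> v]])
      have t: "?t \<in> carrier M" using closed \<alpha> \<beta> True by blast
      have F1: "F (mono [Vtx v]) = ?t"
        using True \<alpha> \<beta> vv by (simp add: F_word is_word_def steps_ghost_word steps_path_word \<theta>_def)
      \<comment> \<open>Here \<open>e\<close> is both the last arrow of
        \<open>\<alpha> @ [e]\<close> and the head of \<open>e # \<beta>\<close>. One unfolding of
        \<open>strip\<close> leads back to the pair of \<open>\<alpha>\<close> and
        \<open>\<beta>\<close> if \<open>e\<close> is the chosen arrow, and stops at zero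
        otherwise.\<close>
      have F2: "F (mono [Arr e, Gst e]) = (if ?f = e then ?t \<ominus>\<^bsub>M\<^esub> ?x else \<zero>\<^bsub>M\<^esub>)"
        if e: "e \<in> out_arcs \<Gamma> v" for e
      proof -
        have "path_to (\<alpha> @ [e]) (head \<Gamma> e)" "ghost_path (head \<Gamma> e) (e # \<beta>)"
          using e \<alpha> \<beta> True by (auto simp: path_to_snoc)
        moreover have "F (mono [Arr e, Gst e]) = \<theta> (Mon (\<alpha> @ [e]) (head \<Gamma> e) (e # \<beta>)) k"
          using e True \<alpha> \<beta> by (simp add: F_word is_word_def steps_ghost_word steps_path_word)
        ultimately show ?thesis using e True by (auto simp: \<theta>_def)
      qed
      have "(\<Oplus>\<^bsub>M\<^esub>e\<in>out_arcs \<Gamma> v. F (mono [Arr e, Gst e])) =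
          (\<Oplus>\<^bsub>M\<^esub>e\<in>out_arcs \<Gamma> v. if ?f = e then ?t \<ominus>\<^bsub>M\<^esub> ?x else \<zero>\<^bsub>M\<^esub>)"
        using F2 x t by (intro M.finsum_cong') (auto simp: M.minus_closed)
      also have "\<dots> = ?t \<ominus>\<^bsub>M\<^esub> ?x"
        using chosen_arrow[OF v] finite_out_arcs[OF vv] x t
        by (intro M.finsum_singleton) (auto simp: M.minus_closed)
      finally show ?thesis
        using F1 x t by (simp add: a_minus_def M.minus_add M.minus_minus M.a_assoc[symmetric] M.r_neg)
    qed
    finally show "h (\<phi> ?a \<cdot> (ck2 v \<cdot> ghost v \<beta>)) = ?a \<odot>\<^bsub>M\<^esub> m v \<beta>" .
  qed
  with h(1) show ?thesis by blast
qed

section \<open>The Leavitt path algebra, the kernel module and the exact sequence\<close>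

abbreviation L :: "('f, ('v, 'e, 'f) leavitt_elt) module" where "L \<equiv> leavitt_algebra \<Gamma>"
abbreviation \<pi> :: "('v, 'e, 'f) cohn_elt \<Rightarrow> ('v, 'e, 'f) leavitt_elt" where "\<pi> \<equiv> cohn_to_leavitt \<Gamma>"

sublocale L: scalar_rng L
  unfolding leavitt_algebra_def by (rule CI.scalar_rng_quotient)

lemma \<pi>_hom: "abelian_group_hom C L \<pi>"
  using CI.coset_hom unfolding leavitt_algebra_def cohn_to_leavitt_def .

sublocale \<pi>: abelian_group_hom C L \<pi> by (rule \<pi>_hom)

lemma carrier_leavitt: "carrier L = \<pi> ` carrier C"
  using CI.carrier_quotient unfolding leavitt_algebra_def cohn_to_leavitt_def .

lemma \<pi>_mult: "x \<in> carrier C \<Longrightarrow> y \<in> carrier C \<Longrightarrow> \<pi> (x \<cdot> y) = \<pi> x \<otimes>\<^bsub>L\<^esub> \<pi> y"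
  using CI.coset_mult unfolding leavitt_algebra_def cohn_to_leavitt_def by simp

lemma leavitt_kernel_eq: "(leavitt_kernel \<Gamma> :: ('v, 'e, 'f) cohn_elt set) = ck2_ideal \<Gamma>"
  using CI.kernel_coset unfolding leavitt_kernel_def leavitt_algebra_def cohn_to_leavitt_def .

lemma kernel_module_eq: "kernel_module \<Gamma> = AC.submodule (ck2_ideal \<Gamma>)"
  by (simp add: kernel_module_def cohn_module_def leavitt_kernel_eq AC.submodule_def)

lemma additive_span_kernel_module:
  "S \<subseteq> ck2_ideal \<Gamma> \<Longrightarrow> additive_span (kernel_module \<Gamma>) S = additive_span C S"
  unfolding kernel_module_eq
  by (rule AC.additive_span_submodule[OF CI.J.additive_subgroup_axioms])

lemma unital_kernel_module: "unital_left_module A (kernel_module \<Gamma>)"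
  unfolding kernel_module_eq
proof (rule AC.unital_submodule[OF CI.J.additive_subgroup_axioms])
  show "\<phi> a \<cdot> x \<in> ck2_ideal \<Gamma>" if "a \<in> carrier A" "x \<in> ck2_ideal \<Gamma>" for a x
    using that \<phi>.hom_closed CI.ideal_mult(1) by blast
  show "ck2_ideal \<Gamma> \<subseteq> additive_span C {\<phi> a \<cdot> x |a x. a \<in> carrier A \<and> x \<in> ck2_ideal \<Gamma>}"
    by (intro subset_trans[OF ck2_ideal_generated] C.add.mono_generate)
      (unfold ck2_generators_def, use ck2_ghost_in_ideal in blast)
qed

text \<open>The generators are the \<open>q_v b^*\<close> with \<open>v\<close> not a sink, each
  with the vertex \<open>v\<close> as its idempotent. They and their multiples lie in the kernel, so
  the additive map found on \<open>C\<close> only has to be restricted.\<close>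

theorem projective_kernel_module:
  "projective_left_module A (kernel_module \<Gamma>) TYPE('m) TYPE('n)"
proof (rule projective_left_moduleI[where I="{(v, \<beta>). ghost_path v \<beta> \<and> \<not> sink \<Gamma> v}"
      and b="\<lambda>(v, \<beta>). ck2 v \<cdot> ghost v \<beta>" and e="\<lambda>(v, \<beta>). path_vertex v"])
  show "unital_left_module A (kernel_module \<Gamma>)" by (rule unital_kernel_module)
  show "(case i of (v, \<beta>) \<Rightarrow> ck2 v \<cdot> ghost v \<beta>) \<in> carrier (kernel_module \<Gamma>)"
    if "i \<in> {(v, \<beta>). ghost_path v \<beta> \<and> \<not> sink \<Gamma> v}" for i
    using that ck2_ghost_in_ideal by (auto simp: kernel_module_eq)
  show "(case i of (v, \<beta>) \<Rightarrow> path_vertex v) \<odot>\<^bsub>kernel_module \<Gamma>\<^esub>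
      (case i of (v, \<beta>) \<Rightarrow> ck2 v \<cdot> ghost v \<beta>) =
      (case i of (v, \<beta>) \<Rightarrow> ck2 v \<cdot> ghost v \<beta>)"
    if i_in: "i \<in> {(v, \<beta>). ghost_path v \<beta> \<and> \<not> sink \<Gamma> v}" for i
  proof -
    obtain v \<beta> where i: "i = (v, \<beta>)" "ghost_path v \<beta>" using i_in by auto
    have "mono [Vtx v] \<cdot> (ck2 v \<cdot> ghost v \<beta>) =
        (mono [Vtx v] \<cdot> ck2 v) \<cdot> ghost v \<beta>"
      using ghost_path_vert[OF i(2)] is_word_ghost[OF i(2)] by (simp add: C.mult_assoc)
    then show ?thesis
      using i ghost_path_vert[OF i(2)] by (simp add: kernel_module_eq path_to_cohn_vertex vertex_ck2)
  qed
  show "carrier (kernel_module \<Gamma>) \<subseteq> additive_span (kernel_module \<Gamma>)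
      {a \<odot>\<^bsub>kernel_module \<Gamma>\<^esub> (case i of (v, \<beta>) \<Rightarrow> ck2 v \<cdot> ghost v \<beta>) |a i.
        a \<in> carrier A \<and> i \<in> {(v, \<beta>). ghost_path v \<beta> \<and> \<not> sink \<Gamma> v}}" (is "_ \<subseteq> additive_span _ ?S")
  proof -
    have S: "?S = ck2_generators"
      by (auto simp: kernel_module_eq ck2_generators_def simp del: path_algebra_simps)
    show ?thesis
      unfolding S additive_span_kernel_module[OF ck2_generators_ideal]
      using ck2_ideal_generated by (simp add: kernel_module_eq)
  qed
  fix M :: "(('v, 'e, 'f) path_elt, 'm) module" and m
  assume M: "unital_left_module A M"
    and m: "\<And>i. i \<in> {(v, \<beta>). ghost_path v \<beta> \<and> \<not> sink \<Gamma> v} \<Longrightarrow> m i \<in> carrier M"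
    and em: "\<And>i. i \<in> {(v, \<beta>). ghost_path v \<beta> \<and> \<not> sink \<Gamma> v} \<Longrightarrow>
      (case i of (v, \<beta>) \<Rightarrow> path_vertex v) \<odot>\<^bsub>M\<^esub> m i = m i"
  have "\<exists>h. abelian_group_hom C M h \<and> (\<forall>a\<in>carrier A. \<forall>v \<beta>. ghost_path v \<beta> \<longrightarrow> \<not> sink \<Gamma> v \<longrightarrow>
    h (\<phi> a \<cdot> (ck2 v \<cdot> ghost v \<beta>)) = a \<odot>\<^bsub>M\<^esub> m (v, \<beta>))"
    using m em by (intro ck2_ideal_extension[OF M]) fastforce+
  then obtain h where h: "abelian_group_hom C M h"
      "\<And>a v \<beta>. a \<in> carrier A \<Longrightarrow> ghost_path v \<beta> \<Longrightarrow> \<not> sink \<Gamma> v \<Longrightarrow>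
        h (\<phi> a \<cdot> (ck2 v \<cdot> ghost v \<beta>)) = a \<odot>\<^bsub>M\<^esub> m (v, \<beta>)" by blast
  interpret h: abelian_group_hom C M h by fact
  have "abelian_group_hom (kernel_module \<Gamma>) M h"
    using unital_left_moduleD(1)[OF unital_kernel_module] h.H.abelian_group_axioms CI.J.a_Hcarr
    by (intro abelian_group_hom_intro) (auto simp: kernel_module_eq)
  with h(2) show "\<exists>h. abelian_group_hom (kernel_module \<Gamma>) M h \<and>
      (\<forall>a\<in>carrier A. \<forall>i\<in>{(v, \<beta>). ghost_path v \<beta> \<and> \<not> sink \<Gamma> v}.
        h (a \<odot>\<^bsub>kernel_module \<Gamma>\<^esub> (case i of (v, \<beta>) \<Rightarrow> ck2 v \<cdot> ghost v \<beta>)) = a \<odot>\<^bsub>M\<^esub> m i)"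
    by (intro exI[of _ h]) (auto simp: kernel_module_eq simp del: path_algebra_simps)
qed (use ghost_path_vert path_vertex_closed path_vertex_idem in
    \<open>auto simp del: path_algebra_simps\<close>)

sublocale AL: rng_hom A L "\<pi> \<circ> \<phi>"
proof (intro rng_hom.intro rng_hom_axioms.intro A.scalar_rng_axioms L.scalar_rng_axioms)
  show "abelian_group_hom A L (\<pi> \<circ> \<phi>)"
    using abelian_group_hom_compose[OF path_to_cohn_hom \<pi>_hom] by (simp add: comp_def)
  show "(\<pi> \<circ> \<phi>) (a \<otimes>\<^bsub>A\<^esub> b) = (\<pi> \<circ> \<phi>) a \<otimes>\<^bsub>L\<^esub> (\<pi> \<circ> \<phi>) b"
    if "a \<in> carrier A" "b \<in> carrier A" for a b
    using path_to_cohn_mult[OF that] \<pi>_mult \<phi>.hom_closed[OF that(1)] \<phi>.hom_closed[OF that(2)] by simp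
qed

lemma leavitt_module_eq: "leavitt_module \<Gamma> = AL.submodule (carrier L)"
  by (simp add: leavitt_module_def AL.submodule_carrier)

text \<open>Generation by products is pushed forward from the Cohn algebra along the surjection
  \<open>\<pi>\<close>.\<close>

lemma unital_leavitt_module: "unital_left_module A (leavitt_module \<Gamma>)"
  unfolding leavitt_module_eq
proof (rule AL.unital_submodule)
  show "additive_subgroup (carrier L) L" by (rule L.additive_subgroup_criterion) auto
  show "(\<pi> \<circ> \<phi>) a \<otimes>\<^bsub>L\<^esub> x \<in> carrier L" if "a \<in> carrier A" "x \<in> carrier L" for a x
    using that \<phi>.hom_closed by (simp del: path_algebra_simps)
  let ?S = "{(\<pi> \<circ> \<phi>) a \<otimes>\<^bsub>L\<^esub> x |a x. a \<in> carrier A \<and> x \<in> carrier L}"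
  show "carrier L \<subseteq> additive_span L ?S"
  proof
    fix y assume "y \<in> carrier L"
    then obtain x where x: "x \<in> carrier C" "y = \<pi> x" using carrier_leavitt by auto
    let ?T = "{\<phi> a \<cdot> ghost v \<beta> |a v \<beta>. a \<in> carrier A \<and> ghost_path v \<beta>}"
    have "\<pi> x \<in> additive_span L ?S"
    proof (rule \<pi>.additive_span_hom[of ?T])
      show "?T \<subseteq> carrier C"
        using is_word_ghost by (auto intro!: C.mult_closed \<phi>.hom_closed mono_closed)
      show "additive_subgroup (additive_span L ?S) L"
        by (rule L.additive_subgroup_span) (use \<phi>.hom_closed in \<open>auto simp del: path_algebra_simps\<close>)
      show "x \<in> additive_span C ?T" using cohn_generated x(1) by (rule subsetD)
      fix z assume "z \<in> ?T"
      then obtain a v \<beta> where z: "z = \<phi> a \<cdot> ghost v \<beta>" "a \<in> carrier A" "ghost_path v \<beta>"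
        by blast
      have G: "ghost v \<beta> \<in> carrier C" using is_word_ghost[OF z(3)] by simp
      have "\<pi> z = (\<pi> \<circ> \<phi>) a \<otimes>\<^bsub>L\<^esub> \<pi> (ghost v \<beta>)"
        using z(1) \<pi>_mult[OF \<phi>.hom_closed[OF z(2)] G] by simp
      then show "\<pi> z \<in> additive_span L ?S"
        using z(2) \<pi>.hom_closed[OF G] by (intro generate.incl) blast
    qed
    with x(2) show "y \<in> additive_span L ?S" by simp
  qed
qed

text \<open>The kernel module is \<open>cohn_module\<close> with a smaller carrier, so the inclusion
  is the identity function, and exactness in the middle is the definition of
  \<open>leavitt_kernel\<close>.\<close>

lemma short_exact_cohn_leavitt:
  "short_exact A (kernel_module \<Gamma>) (cohn_module \<Gamma>) (leavitt_module \<Gamma>) (\<lambda>x. x) \<pi>"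
proof -
  have "(\<lambda>x. x) \<in> left_module_hom A (kernel_module \<Gamma>) (cohn_module \<Gamma>)"
    using CI.J.a_Hcarr by (auto simp: left_module_hom_def kernel_module_eq cohn_module_eq)
  moreover have "\<pi> \<in> left_module_hom A (cohn_module \<Gamma>) (leavitt_module \<Gamma>)"
    using \<pi>_mult \<phi>.hom_closed
    by (auto simp: left_module_hom_def cohn_module_eq leavitt_module_eq simp del: path_algebra_simps)
  moreover have "a_kernel (cohn_module \<Gamma>) (leavitt_module \<Gamma>) \<pi> = leavitt_kernel \<Gamma>"
    unfolding leavitt_kernel_def by (rule a_kernel_cong) (simp_all add: cohn_module_eq leavitt_module_eq)
  ultimately show ?thesis
    by (simp add: short_exact_def kernel_module_eq cohn_module_eq leavitt_module_eq leavitt_kernel_eq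
        carrier_leavitt)
qed

end

section \<open>Gradings\<close>

text \<open>The projection to index \<open>g\<close> fixes \<open>x\<close> as an element of
  \<open>D g\<close>, and would kill it as an element of \<open>D h\<close> if the indices
  differed.\<close>

lemma homogeneous_degree_unique:
  assumes "abelian_group M" "direct_sum_decomp M S D" "g \<in> S" "h \<in> S" "x \<in> D g" "x \<in> D h" "x \<noteq> \<zero>\<^bsub>M\<^esub>"
  shows "g = h"
proof -
  obtain \<pi> where "component_maps M S D \<pi>"
    using direct_sum_decomp_component_maps[OF assms(1,2)] by blast
  with assms show ?thesis unfolding component_maps_def by metis
qed

locale graded_path_algebra = row_finite_digraph \<Gamma> scalars + H: group H
  for \<Gamma> :: "('v, 'e) pre_digraph" and scalars :: "'f::field itself" and H :: "'g monoid" +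
  fixes D :: "'g \<Rightarrow> ('v, 'e, 'f) path_elt set"
  assumes grading: "algebra_grading H A D"
    and homogeneous: "generators_homogeneous H \<Gamma> D"
begin

section \<open>Degrees of vertices, arrows and paths\<close>

abbreviation arr_deg :: "'e \<Rightarrow> 'g" where "arr_deg \<equiv> arrow_degree H \<Gamma> D"
abbreviation wdeg :: "('v, 'e) gen list \<Rightarrow> 'g" where "wdeg \<equiv> word_degree H arr_deg"

lemma grading_decomp: "direct_sum_decomp A (carrier H) D"
  using grading by (simp add: algebra_grading_def)

text \<open>A vertex is a nonzero idempotent, so its degree satisfies \<open>g = g g\<close> and is
  the unit of the group.\<close>

lemma path_vertex_degree:
  assumes v: "v \<in> verts \<Gamma>"
  shows "path_vertex v \<in> D \<one>\<^bsub>H\<^esub>"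
proof -
  obtain g where g: "g \<in> carrier H" "path_vertex v \<in> D g"
    using homogeneous v by (auto simp: generators_homogeneous_def)
  then have "path_vertex v \<otimes>\<^bsub>A\<^esub> path_vertex v \<in> D (g \<otimes>\<^bsub>H\<^esub> g)"
    using grading unfolding algebra_grading_def by blast
  then have "path_vertex v \<in> D (g \<otimes>\<^bsub>H\<^esub> g)" using path_vertex_idem[OF v] by simp
  moreover have "(path_vertex v :: ('v, 'e, 'f) path_elt) \<noteq> \<zero>\<^bsub>A\<^esub>"
    by (simp add: path_vertex_def) (metis lookup_single_eq lookup_zero zero_neq_one)
  ultimately have "g = g \<otimes>\<^bsub>H\<^esub> g"
    using homogeneous_degree_unique[OF A.abelian_group_axioms grading_decomp] g H.m_closed by metis
  then have "g = \<one>\<^bsub>H\<^esub>" using g(1) H.l_cancel_one' by blast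
  with g show ?thesis by simp
qed

lemma arrow_degree:
  assumes e: "e \<in> arcs \<Gamma>"
  shows "arr_deg e \<in> carrier H" "path_arrow \<Gamma> e \<in> D (arr_deg e)"
proof -
  have "(path_arrow \<Gamma> e :: ('v, 'e, 'f) path_elt) \<noteq> \<zero>\<^bsub>A\<^esub>"
    by (simp add: path_arrow_def) (metis lookup_single_eq lookup_zero zero_neq_one)
  then have "\<exists>!g. g \<in> carrier H \<and> path_arrow \<Gamma> e \<in> D g"
    using homogeneous e homogeneous_degree_unique[OF A.abelian_group_axioms grading_decomp]
    unfolding generators_homogeneous_def by metis
  from theI'[OF this] show "arr_deg e \<in> carrier H" "path_arrow \<Gamma> e \<in> D (arr_deg e)"
    unfolding arrow_degree_def by auto
qed

lemma gen_degree_closed: "x \<in> gens \<Gamma> \<Longrightarrow> gen_degree H arr_deg x \<in> carrier H"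
  by (cases x) (auto simp: arrow_degree)

lemma wdeg_closed: "set w \<subseteq> gens \<Gamma> \<Longrightarrow> wdeg w \<in> carrier H"
  by (induction w) (auto simp: word_degree_def gen_degree_closed)

lemma wdeg_simps:
  "wdeg [] = \<one>\<^bsub>H\<^esub>" "wdeg (x # w) = gen_degree H arr_deg x \<otimes>\<^bsub>H\<^esub> wdeg w"
  by (simp_all add: word_degree_def)

lemma wdeg_append:
  "set u \<subseteq> gens \<Gamma> \<Longrightarrow> set w \<subseteq> gens \<Gamma> \<Longrightarrow> wdeg (u @ w) = wdeg u \<otimes>\<^bsub>H\<^esub> wdeg w"
  by (induction u) (auto simp: wdeg_simps wdeg_closed gen_degree_closed H.m_assoc)

lemma path_gens: "path_to \<alpha> v \<Longrightarrow> set (map Arr \<alpha>) \<subseteq> gens \<Gamma>"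
  using path_to_arcs[of \<alpha> v] by auto

lemma wdeg_path_word: "path_to \<alpha> v \<Longrightarrow> wdeg (path_word (src \<alpha> v, \<alpha>)) = wdeg (map Arr \<alpha>)"
  by (simp add: path_word.simps wdeg_simps)

lemma path_degree:
  assumes "path_to \<alpha> v"
  shows "path_elem \<alpha> v 1 \<in> D (wdeg (map Arr \<alpha>))"
  using assms
proof (induction \<alpha>)
  case Nil
  then show ?case using path_vertex_degree by (simp add: path_vertex_def wdeg_simps)
next
  case (Cons e \<alpha>)
  have e: "e \<in> arcs \<Gamma>" "head \<Gamma> e = src \<alpha> v" "path_to \<alpha> v" using Cons.prems by auto
  have "path_arrow \<Gamma> e \<otimes>\<^bsub>A\<^esub> path_elem \<alpha> v 1 \<in> D (arr_deg e \<otimes>\<^bsub>H\<^esub> wdeg (map Arr \<alpha>))"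
    using grading arrow_degree[OF e(1)] Cons.IH[OF e(3)] wdeg_closed[OF path_gens[OF e(3)]]
    unfolding algebra_grading_def by blast
  moreover have "path_arrow \<Gamma> e \<otimes>\<^bsub>A\<^esub> path_elem \<alpha> v 1 =
      single (src (e # \<alpha>) v, e # \<alpha>) 1"
    using e path_comp_eq[of "[e]" "head \<Gamma> e" "src \<alpha> v" \<alpha>] head_in_verts[OF e(1)]
    by (simp add: path_arrow_def lin_mult_single basis_prod_def)
  ultimately show ?case by (simp add: wdeg_simps)
qed

abbreviation path_component :: "'g \<Rightarrow> ('v, 'e, 'f) path_elt set" where
  "path_component g \<equiv>
    {a \<in> carrier (basis_algebra (paths \<Gamma>) (path_comp \<Gamma>)). \<forall>p\<in>keys a. wdeg (map Arr (snd p)) = g}"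

lemma path_component_grading: "algebra_grading H A path_component"
  unfolding path_algebra_def
proof (rule basis_algebra_grading[OF partial_semigroup_paths H.group_axioms])
  show "wdeg (map Arr (snd p)) \<in> carrier H" if "p \<in> paths \<Gamma>" for p
    using that path_gens wdeg_closed by (auto elim!: pathsE)
  show "wdeg (map Arr (snd r)) = wdeg (map Arr (snd p)) \<otimes>\<^bsub>H\<^esub> wdeg (map Arr (snd q))"
    if p: "p \<in> paths \<Gamma>" and q: "q \<in> paths \<Gamma>" and r: "path_comp \<Gamma> p q = Some r" for p q r
  proof -
    obtain \<alpha> v where \<alpha>: "p = (src \<alpha> v, \<alpha>)" "path_to \<alpha> v" using pathsE[OF p] .
    obtain \<beta> w where \<beta>: "q = (src \<beta> w, \<beta>)" "path_to \<beta> w" using pathsE[OF q] .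
    have "r = (src \<alpha> v, \<alpha> @ \<beta>)"
      using r \<alpha> \<beta> by (simp add: path_comp_eq split: if_splits)
    then show ?thesis
      using \<alpha> \<beta> wdeg_append[OF path_gens[OF \<alpha>(2)] path_gens[OF \<beta>(2)]] by simp
  qed
qed

text \<open>In the given grading every path is homogeneous of the product degree of its arrows, so
  \<open>D g\<close> contains the combinations of paths of degree \<open>g\<close>. These already
  span the path algebra, which leaves no room for more in \<open>D g\<close>.\<close>

lemma component_eq: "g \<in> carrier H \<Longrightarrow> D g = path_component g"
proof (rule direct_sum_decomp_refine[OF A.abelian_group_axioms grading_decomp])
  have dsd: "direct_sum_decomp A (carrier H) path_component"
    using path_component_grading by (simp add: algebra_grading_def)
  show "carrier A \<subseteq> additive_span A (\<Union>g\<in>carrier H. path_component g)"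
    by (rule direct_sum_decomp_span[OF A.abelian_group_axioms dsd])
  show "additive_subgroup (path_component g) A" if "g \<in> carrier H" for g
    using dsd that by (simp add: direct_sum_decomp_def)
  show "path_component g \<subseteq> D g" if g: "g \<in> carrier H" for g
  proof
    interpret K: additive_subgroup "D g" A
      using grading_decomp g by (simp add: direct_sum_decomp_def)
    fix a assume "a \<in> path_component g"
    then have "keys a \<subseteq> paths \<Gamma> \<inter> {p. wdeg (map Arr (snd p)) = g}" by auto
    then show "a \<in> D g"
    proof (induction a rule: poly_mapping_additive_induct)
      case zero
      show ?case using K.zero_closed by simp
    next
      case (single p k)
      then obtain \<alpha> v where p: "p = (src \<alpha> v, \<alpha>)" "path_to \<alpha> v" "wdeg (map Arr \<alpha>) = g"
        by (auto elim!: pathsE)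
      \<comment> \<open>Homogeneity is known for paths with coefficient one; other coefficients need
        the components to be subspaces.\<close>
      have "k \<odot>\<^bsub>A\<^esub> single p 1 \<in> D g"
        using grading g path_degree[OF p(2)] p(1,3)
        unfolding algebra_grading_def alg_subspace_def by blast
      then show ?case by (simp add: path_algebra_def map_scale_single)
    next
      case (add a b)
      then show ?case using K.a_closed by simp
    qed
  qed
qed

section \<open>The induced gradings of the Cohn and Leavitt path algebras\<close>

abbreviation cohn_comp :: "'g \<Rightarrow> ('v, 'e, 'f) cohn_elt set" where
  "cohn_comp \<equiv> cohn_grading H \<Gamma> D"

abbreviation free_component :: "'g \<Rightarrow> ('v, 'e, 'f) free_elt set" where
  "free_component g \<equiv> {a \<in> carrier \<F>. \<forall>w\<in>keys a. wdeg w = g}"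

lemma free_grading: "algebra_grading H \<F> free_component"
  unfolding free_algebra_def
  by (rule basis_algebra_grading[OF partial_semigroup_words H.group_axioms])
    (auto simp: wdeg_append intro: wdeg_closed)

lemma free_component_diff:
  assumes "x \<in> free_component g" "y \<in> free_component g"
  shows "x - y \<in> free_component g"
  using assms keys_diff[of x y] by auto

text \<open>The terms of a relator have equal degree: the unit for products of vertices and for
  \<open>e^* e\<close>, the degree of the generator when a vertex is absorbed. For distinct
  \<open>e\<close> and \<open>f\<close> the relator is the single word \<open>e^* f\<close>.\<close>

lemma relator_homogeneous:
  assumes "x \<in> cohn_relators \<Gamma>"
  shows "\<exists>g\<in>carrier H. x \<in> free_component g"
proof -
  have word: "word w \<in> free_component g" if "is_word w" "wdeg w = g" for w g
    using that by simp
  have zero: "0 \<in> free_component g" for g by simp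
  from assms show ?thesis
  proof (cases rule: cohn_relators_cases)
    case (1 v w)
    show ?thesis
      unfolding 1(1)
      by (rule bexI[of _ "\<one>\<^bsub>H\<^esub>"], rule free_component_diff)
        (use 1(2,3) in \<open>auto simp: wdeg_simps is_word_def\<close>)
  next
    case (2 y)
    have "y \<in> gens \<Gamma>" using 2(2) by auto
    then show ?thesis
      unfolding 2(1)
      by (intro bexI[of _ "gen_degree H arr_deg y"] free_component_diff word gen_degree_closed)
        (use 2(2) in \<open>auto simp: wdeg_simps is_word_def gen_degree_closed\<close>)
  next
    case (3 y)
    have "y \<in> gens \<Gamma>" using 3(2) by auto
    then show ?thesis
      unfolding 3(1)
      by (intro bexI[of _ "gen_degree H arr_deg y"] free_component_diff word gen_degree_closed)
        (use 3(2) in \<open>auto simp: wdeg_simps is_word_def gen_degree_closed\<close>)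
  next
    case (4 e f)
    show ?thesis
    proof (cases "e = f")
      case True
      then show ?thesis
        unfolding 4(1)
        by (intro bexI[of _ "\<one>\<^bsub>H\<^esub>"] free_component_diff)
          (use 4(2,3) in \<open>auto simp: wdeg_simps is_word_def arrow_degree\<close>)
    next
      case False
      have "set [Gst e, Arr f] \<subseteq> gens \<Gamma>" using 4(2,3) by simp
      with False show ?thesis
        unfolding 4(1)
        by (intro bexI[of _ "wdeg [Gst e, Arr f]"] wdeg_closed)
          (use 4(2,3) in \<open>auto simp: is_word_def\<close>)
    qed
  qed
qed

lemma cohn_algebra_grading: "algebra_grading H C (cohn_comp)"
proof -
  have "cohn_ideal \<Gamma> \<subseteq> additive_span \<F> (\<Union>g\<in>carrier H. cohn_ideal \<Gamma> \<inter> free_component g)"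
    unfolding cohn_ideal_def
    by (rule F.homogeneous_alg_ideal_gen[OF H.group_axioms free_grading relator_homogeneous])
  from FI.quotient_grading[OF free_grading this]
  show ?thesis
    unfolding cohn_algebra_def cohn_grading_def cohn_class_def .
qed

lemma cohn_decomp: "direct_sum_decomp C (carrier H) (cohn_comp)"
  using cohn_algebra_grading by (simp add: algebra_grading_def)

lemma mono_homogeneous: "is_word w \<Longrightarrow> mono w \<in> cohn_comp (wdeg w)"
  unfolding cohn_grading_def by (rule imageI) simp

text \<open>The degrees of \<open>e\<close> and \<open>e^*\<close> are inverse to each other, so
  each \<open>e e^*\<close> has the same degree as the vertex.\<close>

lemma ck2_homogeneous:
  assumes v: "v \<in> verts \<Gamma>"
  shows "ck2 v \<in> cohn_comp \<one>\<^bsub>H\<^esub>"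
proof -
  interpret K: additive_subgroup "cohn_comp \<one>\<^bsub>H\<^esub>" C
    using cohn_decomp by (simp add: direct_sum_decomp_def)
  have arcs: "mono [Arr e, Gst e] \<in> cohn_comp \<one>\<^bsub>H\<^esub>" if "e \<in> out_arcs \<Gamma> v" for e
    using that mono_homogeneous[of "[Arr e, Gst e]"] arrow_degree(1)[of e]
    by (simp add: is_word_def wdeg_simps)
  have "finsum C (\<lambda>e. mono [Arr e, Gst e]) S \<in> cohn_comp \<one>\<^bsub>H\<^esub>"
    if "finite S" "S \<subseteq> out_arcs \<Gamma> v" for S
    using that
  proof (induction S)
    case (insert e S)
    then have "finsum C (\<lambda>e. mono [Arr e, Gst e]) (insert e S) =
        mono [Arr e, Gst e] \<oplus>\<^bsub>C\<^esub> finsum C (\<lambda>e. mono [Arr e, Gst e]) S"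
      by (intro C.finsum_insert) (auto simp: is_word_def)
    then show ?case using insert arcs by (simp add: K.a_closed)
  qed (use K.zero_closed in simp)
  then have "(\<Oplus>\<^bsub>C\<^esub>e\<in>out_arcs \<Gamma> v. mono [Arr e, Gst e]) \<in> cohn_comp \<one>\<^bsub>H\<^esub>"
    using finite_out_arcs[OF v] by simp
  moreover have "mono [Vtx v] \<in> cohn_comp \<one>\<^bsub>H\<^esub>"
    using mono_homogeneous[of "[Vtx v]"] v by (simp add: is_word_def wdeg_simps)
  ultimately show ?thesis
    unfolding hom_ck2[OF C.abelian_group_hom_id v] a_minus_def by (intro K.a_closed K.a_inv_closed)
qed

lemma ck2_ideal_homogeneous:
  "ck2_ideal \<Gamma> \<subseteq> additive_span C (\<Union>g\<in>carrier H. ck2_ideal \<Gamma> \<inter> cohn_comp g)"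
  unfolding ck2_ideal_def
proof (rule C.homogeneous_alg_ideal_gen[OF H.group_axioms cohn_algebra_grading])
  show "\<exists>g\<in>carrier H. x \<in> cohn_comp g" if "x \<in> ck2_elements \<Gamma>" for x
    using that ck2_homogeneous unfolding ck2_elements_eq by (auto intro!: bexI[of _ "\<one>\<^bsub>H\<^esub>"])
qed

lemma leavitt_algebra_grading: "algebra_grading H L (leavitt_grading H \<Gamma> D)"
  using CI.quotient_grading[OF cohn_algebra_grading ck2_ideal_homogeneous]
  unfolding leavitt_algebra_def leavitt_grading_def cohn_to_leavitt_def .

text \<open>By \<open>component_eq\<close> an element of \<open>D g\<close> involves only paths of
  degree \<open>g\<close>, and a path read as a word keeps its degree. This links the given grading
  with the one by degrees of words.\<close>

lemma path_to_cohn_degree: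
  assumes g: "g \<in> carrier H" and a: "a \<in> D g"
  shows "\<phi> a \<in> cohn_comp g"
proof -
  let ?x = "\<Sum>p\<in>keys a. single (path_word p) (lookup a p)"
  have a': "keys a \<subseteq> paths \<Gamma>" "\<And>p. p \<in> keys a \<Longrightarrow> wdeg (map Arr (snd p)) = g"
    using a component_eq[OF g] by auto
  have "wdeg w = g" if w: "w \<in> keys ?x" for w
  proof -
    have "w \<in> (\<Union>p\<in>keys a. keys
        (single (path_word p) (lookup a p)))"
      using w keys_sum by (rule rev_subsetD)
    then obtain p where p: "p \<in> keys a" "w = path_word p" by (auto split: if_splits)
    with a'(1) obtain \<alpha> v where "p = (src \<alpha> v, \<alpha>)" "path_to \<alpha> v" by (blast elim: pathsE)
    then show ?thesis using p a'(2)[OF p(1)] wdeg_path_word by simp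
  qed
  then show ?thesis
    unfolding cohn_grading_def path_to_cohn_def
    using path_word_closed[OF a'(1), of a] by blast
qed

lemma cohn_grading_action:
  assumes "g \<in> carrier H" "h \<in> carrier H" "a \<in> D g" "x \<in> cohn_comp h"
  shows "\<phi> a \<cdot> x \<in> cohn_comp (g \<otimes>\<^bsub>H\<^esub> h)"
  using cohn_algebra_grading path_to_cohn_degree[OF assms(1,3)] assms unfolding algebra_grading_def by blast

lemma degree_component_closed: "g \<in> carrier H \<Longrightarrow> a \<in> D g \<Longrightarrow> a \<in> carrier A"
  using component_eq by simp

section \<open>The graded modules and the degrees of the two maps\<close>

lemma graded_cohn_module: "graded_left_module H A D (cohn_module \<Gamma>) (cohn_comp)"
proof -
  have "direct_sum_decomp (cohn_module \<Gamma>) (carrier H) (cohn_comp)"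
    by (subst direct_sum_decomp_cong[of "cohn_module \<Gamma>" C])
      (simp_all add: cohn_module_eq cohn_decomp)
  then show ?thesis
    using unital_cohn_module cohn_grading_action by (simp add: graded_left_module_def cohn_module_eq)
qed

lemma graded_kernel_module: "graded_left_module H A D (kernel_module \<Gamma>) (kernel_grading H \<Gamma> D)"
proof -
  have gr: "kernel_grading H \<Gamma> D = (\<lambda>g. ck2_ideal \<Gamma> \<inter> cohn_comp g)"
    by (rule ext) (simp add: kernel_grading_def leavitt_kernel_eq)
  have "direct_sum_decomp (C\<lparr>carrier := ck2_ideal \<Gamma>\<rparr>) (carrier H) (kernel_grading H \<Gamma> D)"
    unfolding gr
    by (rule direct_sum_decomp_sub[OF C.abelian_group_axioms cohn_decomp CI.J.additive_subgroup_axioms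
          ck2_ideal_homogeneous])
  then have "direct_sum_decomp (kernel_module \<Gamma>) (carrier H) (kernel_grading H \<Gamma> D)"
    unfolding kernel_module_eq
    by (rule iffD2[OF AC.direct_sum_decomp_submodule[OF CI.J.additive_subgroup_axioms]])
  moreover have "\<phi> a \<cdot> x \<in> kernel_grading H \<Gamma> D (g \<otimes>\<^bsub>H\<^esub> h)"
    if "g \<in> carrier H" "h \<in> carrier H" "a \<in> D g" "x \<in> kernel_grading H \<Gamma> D h" for g h a x
    using that cohn_grading_action[of g h a x]
      CI.ideal_mult(1)[OF \<phi>.hom_closed[OF degree_component_closed[of g a]], of x]
    by (simp add: gr)
  ultimately show ?thesis
    using unital_kernel_module by (simp add: graded_left_module_def kernel_module_eq)
qed

lemma graded_leavitt_module: "graded_left_module H A D (leavitt_module \<Gamma>) (leavitt_grading H \<Gamma> D)"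
proof -
  have "direct_sum_decomp L (carrier H) (leavitt_grading H \<Gamma> D)"
    using leavitt_algebra_grading by (simp add: algebra_grading_def)
  then have "direct_sum_decomp (leavitt_module \<Gamma>) (carrier H) (leavitt_grading H \<Gamma> D)"
    by (subst direct_sum_decomp_cong[of "leavitt_module \<Gamma>" L]) (simp_all add: leavitt_module_eq)
  moreover have "\<pi> (\<phi> a) \<otimes>\<^bsub>L\<^esub> x \<in> leavitt_grading H \<Gamma> D (g \<otimes>\<^bsub>H\<^esub> h)"
    if gh: "g \<in> carrier H" "h \<in> carrier H" and a: "a \<in> D g" and x: "x \<in> leavitt_grading H \<Gamma> D h" for g h a x
  proof -
    have "\<pi> (\<phi> a) \<in> leavitt_grading H \<Gamma> D g"
      using path_to_cohn_degree[OF gh(1) a] unfolding leavitt_grading_def by (rule imageI)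
    with leavitt_algebra_grading gh x show ?thesis unfolding algebra_grading_def by blast
  qed
  ultimately show ?thesis
    using unital_leavitt_module by (simp add: graded_left_module_def leavitt_module_eq)
qed

lemma inclusion_degree_preserving:
  "degree_preserving H (kernel_grading H \<Gamma> D) (cohn_comp) (\<lambda>x. x)"
  by (auto simp: degree_preserving_def kernel_grading_def)

lemma projection_degree_preserving:
  "degree_preserving H (cohn_comp) (leavitt_grading H \<Gamma> D) \<pi>"
  by (auto simp: degree_preserving_def leavitt_grading_def)

end

theorem fact5p2:
  fixes \<Gamma> :: "('v, 'e) pre_digraph"
  assumes "wf_digraph \<Gamma>" and "row_finite \<Gamma>"
  shows
    "let A = (path_algebra \<Gamma> :: ('f::field, ('v, 'e, 'f) path_elt) module);
         I = (kernel_module \<Gamma> :: (('v, 'e, 'f) path_elt, ('v, 'e, 'f) cohn_elt) module);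
         C = (cohn_module \<Gamma> :: (('v, 'e, 'f) path_elt, ('v, 'e, 'f) cohn_elt) module);
         L = (leavitt_module \<Gamma> :: (('v, 'e, 'f) path_elt, ('v, 'e, 'f) leavitt_elt) module);
         \<iota> = (\<lambda>x. x);
         \<pi> = cohn_to_leavitt \<Gamma>
     in carrier I = alg_ideal_gen (cohn_algebra \<Gamma>) (ck2_elements \<Gamma>) \<and>
        short_projective_resolution A I C L \<iota> \<pi> TYPE('m) TYPE('n) \<and>
        (\<forall>(H :: 'g monoid) D.
           group H \<and> algebra_grading H A D \<and> generators_homogeneous H \<Gamma> D \<longrightarrow>
             graded_left_module H A D I (kernel_grading H \<Gamma> D) \<and>
             graded_left_module H A D C (cohn_grading H \<Gamma> D) \<and>
             graded_left_module H A D L (leavitt_grading H \<Gamma> D) \<and>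
             degree_preserving H (kernel_grading H \<Gamma> D) (cohn_grading H \<Gamma> D) \<iota> \<and>
             degree_preserving H (cohn_grading H \<Gamma> D) (leavitt_grading H \<Gamma> D) \<pi>)"
proof -
  interpret row_finite_digraph \<Gamma> "TYPE('f)"
    using assms
    by (intro row_finite_digraph.intro path_digraph.intro row_finite_digraph_axioms.intro)
  have graded: "graded_left_module H A D (kernel_module \<Gamma>) (kernel_grading H \<Gamma> D) \<and>
      graded_left_module H A D (cohn_module \<Gamma>) (cohn_grading H \<Gamma> D) \<and>
      graded_left_module H A D (leavitt_module \<Gamma>) (leavitt_grading H \<Gamma> D) \<and>
      degree_preserving H (kernel_grading H \<Gamma> D) (cohn_grading H \<Gamma> D) (\<lambda>x. x) \<and>
      degree_preserving H (cohn_grading H \<Gamma> D) (leavitt_grading H \<Gamma> D) \<pi>"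
    if "group H" "algebra_grading H A D" "generators_homogeneous H \<Gamma> D" for H :: "'g monoid" and D
  proof -
    interpret graded_path_algebra \<Gamma> "TYPE('f)" H D
      using that row_finite_digraph_axioms
      by (simp add: graded_path_algebra_def graded_path_algebra_axioms_def)
    show ?thesis
      by (intro conjI graded_kernel_module graded_cohn_module graded_leavitt_module
          inclusion_degree_preserving projection_degree_preserving)
  qed
  have "carrier (kernel_module \<Gamma> :: (('v, 'e, 'f) path_elt, ('v, 'e, 'f) cohn_elt) module) =
      alg_ideal_gen (cohn_algebra \<Gamma>) (ck2_elements \<Gamma>)"
    by (simp add: kernel_module_eq ck2_ideal_def)
  moreover have "short_projective_resolution A (kernel_module \<Gamma>) (cohn_module \<Gamma>) (leavitt_module \<Gamma>)
      (\<lambda>x. x) \<pi> TYPE('m) TYPE('n)"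
    unfolding short_projective_resolution_def
    by (intro conjI projective_kernel_module projective_cohn_module unital_leavitt_module
        short_exact_cohn_leavitt)
  ultimately show ?thesis
    unfolding Let_def using graded by blast
qed

end
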